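(* Let $F$ be a non-bipartite graph and $r$ a positive integer. Then for every $n$ there is an $n$-vertex complete $(\chi(F)-1)$-partite graph $T$ such that \[\mathrm{ex}_r(n,F)=e_r(T)+\Theta\big(\mathrm{biex}(n,F)\,n^{r-1}\big)\] as $n\to\infty$.
   Context: For a graph $G$ with degree sequence $d_1,\dots,d_n$, $e_r(G)=\sum_i d_i^r$; $\mathrm{ex}_r(n,F)$ is the maximum of $e_r(G)$ over $n$-vertex $F$-free graphs $G$. For a graph $F$ with $\chi(F)=k+1$, its decomposition family $\mathcal{D}(F)$ is the family of bipartite graphs obtained as the subgraph of $F$ induced by the union of two color classes of some proper $(k+1)$-coloring of $F$. $\mathrm{biex}(n,F)=\mathrm{ex}(n,\mathcal{D}(F))$, the maximum number of edges of an $n$-vertex graph containing no member of $\mathcal{D}(F)$. *)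

theory Defs
  imports Complex_Main "HOL-Library.FuncSet" "HOL-Library.Landau_Symbols"
begin

type_synonym 'a graph = "'a set \<times> 'a set set"

abbreviation verts :: "'a graph \<Rightarrow> 'a set" where
  "verts G \<equiv> fst G"

abbreviation edges :: "'a graph \<Rightarrow> 'a set set" where
  "edges G \<equiv> snd G"

definition simple_graph :: "'a graph \<Rightarrow> bool" where
  "simple_graph G \<longleftrightarrow> finite (verts G) \<and> (\<forall>e\<in>edges G. e \<subseteq> verts G \<and> card e = 2)"

definition degree :: "'a graph \<Rightarrow> 'a \<Rightarrow> nat" where
  "degree G v = card {e \<in> edges G. v \<in> e}"

definition degree_power_sum :: "nat \<Rightarrow> 'a graph \<Rightarrow> nat" where
  "degree_power_sum r G = (\<Sum>v\<in>verts G. degree G v ^ r)"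

text \<open>Containment is as a not necessarily induced subgraph, up to isomorphism.\<close>

definition contains_copy :: "'a graph \<Rightarrow> 'b graph \<Rightarrow> bool" where
  "contains_copy G H \<longleftrightarrow>
     (\<exists>f. inj_on f (verts H) \<and> f ` verts H \<subseteq> verts G \<and> (\<forall>e\<in>edges H. f ` e \<in> edges G))"

definition induced_subgraph :: "'a graph \<Rightarrow> 'a set \<Rightarrow> 'a graph" where
  "induced_subgraph G S = (verts G \<inter> S, {e \<in> edges G. e \<subseteq> S})"

definition proper_colouring :: "'a graph \<Rightarrow> nat \<Rightarrow> ('a \<Rightarrow> nat) \<Rightarrow> bool" where
  "proper_colouring G k c \<longleftrightarrow>
     c \<in> verts G \<rightarrow> {..<k} \<and> (\<forall>u v. {u, v} \<in> edges G \<longrightarrow> c u \<noteq> c v)"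

definition chromatic_number :: "'a graph \<Rightarrow> nat" where
  "chromatic_number G = (LEAST k. \<exists>c. proper_colouring G k c)"

definition bipartite :: "'a graph \<Rightarrow> bool" where
  "bipartite G \<longleftrightarrow> (\<exists>c. proper_colouring G 2 c)"

definition decomposition_family :: "'a graph \<Rightarrow> 'a graph set" where
  "decomposition_family F =
     {induced_subgraph F {v \<in> verts F. c v = i \<or> c v = j} | c i j.
        proper_colouring F (chromatic_number F) c \<and>
        i < chromatic_number F \<and> j < chromatic_number F \<and> i \<noteq> j}"

text \<open>
  The extremal numbers only depend on graphs up to isomorphism, so \<open>n\<close>-vertex graphs are
  taken on the vertex set \<open>{..<n}\<close>. The maxima are over finite sets, which are nonempty as
  soon as each forbidden graph has an edge. This is the case for a non-bipartite graph and,
  because two colour classes of an optimal colouring cannot be merged, for the members of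
  its decomposition family.
\<close>

definition ex_power :: "nat \<Rightarrow> nat \<Rightarrow> 'a graph \<Rightarrow> nat" where
  "ex_power r n F =
     Max {degree_power_sum r G | G :: nat graph.
            simple_graph G \<and> verts G = {..<n} \<and> \<not> contains_copy G F}"

definition ex_family :: "nat \<Rightarrow> 'a graph set \<Rightarrow> nat" where
  "ex_family n \<F> =
     Max {card (edges G) | G :: nat graph.
            simple_graph G \<and> verts G = {..<n} \<and> (\<forall>H\<in>\<F>. \<not> contains_copy G H)}"

definition biex :: "nat \<Rightarrow> 'a graph \<Rightarrow> nat" where
  "biex n F = ex_family n (decomposition_family F)"

text \<open>
  The parts are the classes \<open>{v \<in> verts G. c v = i}\<close> for \<open>i < k\<close>. All of them are required
  to be nonempty, except when there are fewer than \<open>k\<close> vertices.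
\<close>

definition complete_partite :: "nat \<Rightarrow> 'a graph \<Rightarrow> bool" where
  "complete_partite k G \<longleftrightarrow>
     (\<exists>c. c \<in> verts G \<rightarrow> {..<k} \<and>
          (k \<le> card (verts G) \<longrightarrow> c ` verts G = {..<k}) \<and>
          edges G = {{u, v} | u v. u \<in> verts G \<and> v \<in> verts G \<and> c u \<noteq> c v})"

end

theory Submission
  imports Defs
begin

text \<open>
  Write \<open>k = \<chi>(F) - 1\<close>. Supersaturation and Erdos's majorisation argument show that an extremal
  graph \<open>G\<close> is, up to \<open>o(n\<^sup>2)\<close> edges, complete \<open>k\<close>-partite with linear parts. Replacing the
  neighbourhood of a vertex by the common neighbourhood of \<open>|V(F)|\<close> typical vertices of a part
  keeps \<open>G\<close> free of \<open>F\<close>, so by extremality every vertex with few neighbours in some part is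
  joined to almost all vertices outside that part. The vertices with many neighbours in every
  part are bounded in number. If \<open>F - s\<close> is \<open>k\<close>-colourable for some vertex \<open>s\<close> there are none, and
  otherwise stars contain no member of the decomposition family, so that \<open>biex(n, F)\<close> is at least
  linear and absorbs their contribution. Reassigning all other vertices to their sparse parts, the
  edges inside each part contain no member of the decomposition family, which gives the upper
  bound with \<open>T\<close> the complete \<open>k\<close>-partite graph on these parts. For the lower bound, a positive
  proportion of the edges of an extremal graph for \<open>biex(n, F)\<close> forms a bipartite graph on few
  vertices, which can be added inside one part of \<open>T\<close> without creating \<open>F\<close>.
\<close>

section \<open>Boxes in dense relations\<close>

text \<open>For large \<open>r\<close> the complete partite graph with the largest power sum need
  not be balanced, so \<open>T\<close> cannot be prescribed as a Turan graph. It is read off the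
  extremal graph: the upper bound returns a partition with all parts of size at least
  \<open>\<beta> * n\<close>, and the lower bound works for every such partition, so that one
  \<open>T\<close> serves both. The exceptional vertices left by stability may still number a small
  multiple of \<open>n\<close>. The permitted error can be much smaller: \<open>biex(n, F)\<close>
  vanishes for large \<open>n\<close> if a member of the family has a single edge. Hence every
  exceptional vertex needs an individual exchange argument, and only a bounded number of them may be
  paid for. The tolerances are nested: \<open>\<gamma>\<close> for the part sizes is fixed first,
  \<open>\<epsilon>1\<close> for sparse neighbourhoods is small against it, and
  \<open>\<epsilon>\<close> for typical vertices is small against both. The factor
  \<open>n ^ (r - 1)\<close> is the marginal value of one more neighbour at a vertex of linear
  degree.\<close>

lemma sum_card_swap:
  assumes "finite A" "finite B"
  shows "(\<Sum>x\<in>A. card {y\<in>B. P x y}) = (\<Sum>y\<in>B. card {x\<in>A. P x y})"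
proof -
  have "(\<Sum>x\<in>A. card {y\<in>B. P x y}) = (\<Sum>x\<in>A. \<Sum>y\<in>B. if P x y then 1 else 0)"
    using assms by (intro sum.cong refl) (simp add: sum.If_cases Int_def)
  also have "\<dots> = (\<Sum>y\<in>B. \<Sum>x\<in>A. if P x y then 1 else 0)"
    by (rule sum.swap)
  also have "\<dots> = (\<Sum>y\<in>B. card {x\<in>A. P x y})"
    using assms by (intro sum.cong refl) (simp add: sum.If_cases Int_def)
  finally show ?thesis .
qed

section \<open>Counting tuples with prescribed entry sets\<close>

lemma set_Cons_eq_image: "set_Cons A L = (\<lambda>(x, xs). x # xs) ` (A \<times> L)"
  by (auto simp: set_Cons_def image_def)

lemma finite_listset: "(\<And>A. A \<in> set S \<Longrightarrow> finite A) \<Longrightarrow> finite (listset S)"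
  by (induction S) (auto simp: set_Cons_eq_image)

lemma card_set_Cons: "card (set_Cons A L) = card A * card L"
proof -
  have "inj_on (\<lambda>(x, xs). x # xs) (A \<times> L)"
    by (auto simp: inj_on_def)
  then show ?thesis
    by (simp add: set_Cons_eq_image card_image card_cartesian_product)
qed

lemma card_eq_sum_heads:
  assumes "finite A" "finite L" "R \<subseteq> set_Cons A L"
  shows "card R = (\<Sum>x\<in>A. card {xs\<in>L. x # xs \<in> R})"
proof -
  have "R = (\<lambda>(x, xs). x # xs) ` (SIGMA x:A. {xs\<in>L. x # xs \<in> R})"
    (is "_ = ?B")
  proof
    show "R \<subseteq> ?B"
    proof
      fix z assume "z \<in> R"
      with assms(3) obtain x xs where "z = x # xs" "x \<in> A" "xs \<in> L"
        by (auto simp: set_Cons_def)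
      with \<open>z \<in> R\<close> show "z \<in> ?B"
        by (intro image_eqI[of _ _ "(x, xs)"]) auto
    qed
  qed auto
  moreover have inj: "inj_on (\<lambda>(x, xs). x # xs) (SIGMA x:A. {xs\<in>L. x # xs \<in> R})"
    by (auto simp: inj_on_def)
  ultimately have "card R = card (SIGMA x:A. {xs\<in>L. x # xs \<in> R})"
    using card_image[OF inj] by argo
  then show ?thesis
    using assms by (simp add: card_SigmaI)
qed

lemma listset_card_pos:
  "(\<And>A. A \<in> set S \<Longrightarrow> finite A \<and> card A > 0) \<Longrightarrow> card (listset S) > 0"
  by (induction S) (auto simp: card_set_Cons)

text \<open>An averaging step: with \<open>M\<close> the trivial maximum, a large sum forces many
  elements of value at least \<open>a\<close>.\<close>

lemma sum_le_heavy:
  fixes f :: "'b \<Rightarrow> real"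
  assumes "finite A" "\<And>x. x \<in> A \<Longrightarrow> f x \<le> M" "0 \<le> a"
  shows "(\<Sum>x\<in>A. f x) \<le> real (card {x\<in>A. a \<le> f x}) * M + real (card A) * a"
proof -
  have "(\<Sum>x\<in>A. f x) = (\<Sum>x\<in>{x\<in>A. a \<le> f x}. f x) + (\<Sum>x\<in>{x\<in>A. \<not> a \<le> f x}. f x)"
    using assms(1) by (subst sum.union_disjoint[symmetric]) (auto intro!: sum.cong)
  also have "(\<Sum>x\<in>{x\<in>A. a \<le> f x}. f x) \<le> real (card {x\<in>A. a \<le> f x}) * M"
    using assms(2) by (intro sum_bounded_above) auto
  also have "(\<Sum>x\<in>{x\<in>A. \<not> a \<le> f x}. f x) \<le> real (card {x\<in>A. \<not> a \<le> f x}) * a"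
    by (intro sum_bounded_above) auto
  also have "\<dots> \<le> real (card A) * a"
    using assms by (intro mult_right_mono) (auto intro!: card_mono)
  finally show ?thesis by simp
qed

text \<open>
  The induction keeps only a bounded number of dense first entries, so that a single set of
  \<open>t\<close> of them is common to a positive proportion of the tails.
\<close>

lemma dense_relation_contains_box:
  fixes \<epsilon> :: real
  assumes "\<epsilon> > 0"
  shows "\<exists>N. \<forall>S. length S = m \<longrightarrow> (\<forall>A\<in>set S. finite A \<and> N \<le> card A) \<longrightarrow>
           (\<forall>R\<subseteq>listset S. \<epsilon> * real (card (listset S)) \<le> real (card R) \<longrightarrow>
              (\<exists>Q. list_all2 (\<lambda>B A. B \<subseteq> A \<and> card B = t) Q S \<and> listset Q \<subseteq> R))"
  using assms
proof (induction m arbitrary: \<epsilon>)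
  case 0
  show ?case
  proof (intro exI[of _ 0] allI impI)
    fix S :: "'a set list" and R
    assume "length S = 0" "R \<subseteq> listset S" "\<epsilon> * real (card (listset S)) \<le> real (card R)"
    moreover from this have "R \<noteq> {}"
      using \<open>\<epsilon> > 0\<close> by (intro notI) simp
    ultimately show "\<exists>Q. list_all2 (\<lambda>B A. B \<subseteq> A \<and> card B = t) Q S \<and> listset Q \<subseteq> R"
      by (intro exI[of _ "[]"]) auto
  qed
next
  case (Suc m)
  \<comment> \<open>\<open>s\<close> dense heads are kept, enough that asking a tail for
    \<open>t\<close> of them costs at most half of the average
    \<open>s * \<epsilon> / 2\<close>.\<close>
  define s where "s = nat \<lceil>4 * (real t + 1) / \<epsilon>\<rceil>"
  have s: "4 * real t \<le> real s * \<epsilon>" "s > 0"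
  proof -
    have *: "4 * (real t + 1) / \<epsilon> \<le> real s"
      unfolding s_def by linarith
    then show "4 * real t \<le> real s * \<epsilon>"
      using Suc.prems by (simp add: field_simps)
    have "0 < 4 * (real t + 1) / \<epsilon>"
      using Suc.prems by simp
    with * show "s > 0"
      by linarith
  qed
  \<comment> \<open>\<open>W\<close> will have density \<open>\<epsilon> / 4\<close> among the
    tails, and \<open>2 ^ s\<close> is the number of possible values of
    \<open>com w\<close>.\<close>
  define \<delta> where "\<delta> = \<epsilon> / 4 / 2 ^ s"
  have "\<delta> > 0" using Suc.prems by (simp add: \<delta>_def)
  from Suc.IH[OF this] obtain N where N: "\<And>S R. length S = m \<Longrightarrow>
      (\<forall>A\<in>set S. finite A \<and> N \<le> card A) \<Longrightarrow> R \<subseteq> listset S \<Longrightarrow>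
      \<delta> * real (card (listset S)) \<le> real (card R) \<Longrightarrow>
      \<exists>Q. list_all2 (\<lambda>B A. B \<subseteq> A \<and> card B = t) Q S \<and> listset Q \<subseteq> (R::'a list set)"
    by blast
  \<comment> \<open>\<open>N\<close> is for the tails, \<open>1\<close> keeps all sets nonempty, and
    the last bound gives \<open>s \<le> \<epsilon> / 2 * card A\<close>, so that \<open>s\<close>
    dense heads exist.\<close>
  define N' where "N' = max (max N 1) (nat \<lceil>2 * real s / \<epsilon>\<rceil>)"
  show ?case
  proof (intro exI[of _ N'] allI impI)
    fix S :: "'a set list" and R
    assume len: "length S = Suc m" and fin: "\<forall>A\<in>set S. finite A \<and> N' \<le> card A"
      and R: "R \<subseteq> listset S" and dense: "\<epsilon> * real (card (listset S)) \<le> real (card R)"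
    from len obtain A As where S: "S = A # As"
      by (cases S) auto
    define L where "L = listset As"
    define P where "P = real (card L)"
    have finA: "finite A" and finL: "finite L"
      using fin finite_listset[of As] by (auto simp: S L_def)
    have "card L > 0"
      unfolding L_def using fin by (intro listset_card_pos) (auto simp: S N'_def)
    then have P: "P > 0" by (simp add: P_def)
    have "2 * real s / \<epsilon> \<le> real N'"
      unfolding N'_def by linarith
    also have "real N' \<le> real (card A)"
      using fin by (simp add: S)
    finally have cardA: "real s \<le> \<epsilon> / 2 * real (card A)"
      using Suc.prems by (simp add: field_simps)
    define r where "r x = real (card {w\<in>L. x # w \<in> R})" for x
    have r_le: "r x \<le> P" for x
      unfolding r_def P_def using finL by (simp add: card_mono)
    have "real (card R) = (\<Sum>x\<in>A. r x)"
      unfolding r_def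
      by (subst card_eq_sum_heads[OF finA finL]) (use R in \<open>auto simp: S L_def\<close>)
    also have "\<dots> \<le> real (card {x\<in>A. \<epsilon> / 2 * P \<le> r x}) * P + real (card A) * (\<epsilon> / 2 * P)"
      using finA r_le Suc.prems P by (intro sum_le_heavy) auto
    finally have "\<epsilon> * (real (card A) * P) \<le>
        real (card {x\<in>A. \<epsilon> / 2 * P \<le> r x}) * P + real (card A) * (\<epsilon> / 2 * P)"
      using dense by (simp add: S card_set_Cons P_def L_def)
    then have "\<epsilon> / 2 * real (card A) * P \<le> real (card {x\<in>A. \<epsilon> / 2 * P \<le> r x}) * P"
      by (simp add: algebra_simps)
    then have "\<epsilon> / 2 * real (card A) \<le> real (card {x\<in>A. \<epsilon> / 2 * P \<le> r x})"
      using P by (meson mult_right_le_imp_le)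
    with cardA have "s \<le> card {x\<in>A. \<epsilon> / 2 * P \<le> r x}"
      by linarith
    then obtain H where H: "H \<subseteq> {x\<in>A. \<epsilon> / 2 * P \<le> r x}" "card H = s" "finite H"
      by (meson obtain_subset_with_card_n)
    define com where "com w = {x\<in>H. x # w \<in> R}" for w
    define W where "W = {w\<in>L. real t \<le> real (card (com w))}"
    have "real s * (\<epsilon> / 2 * P) \<le> (\<Sum>x\<in>H. r x)"
      using H by (intro sum_bounded_below[of H "\<epsilon> / 2 * P" r, unfolded H(2)]) auto
    also have "\<dots> = (\<Sum>w\<in>L. real (card (com w)))"
      unfolding r_def com_def
      using sum_card_swap[OF \<open>finite H\<close> finL, of "\<lambda>x w. x # w \<in> R"]
      by (simp flip: of_nat_sum)
    also have "\<dots> \<le> real (card W) * real s + P * real t"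
      unfolding W_def P_def
    proof (rule sum_le_heavy[OF finL])
      show "real (card (com w)) \<le> real s" for w
        using H by (auto simp: com_def intro!: card_mono)
    qed simp
    also have "P * real t \<le> P * (real s * \<epsilon> / 4)"
      using s P by (intro mult_left_mono) auto
    finally have "real s * (\<epsilon> / 4 * P) \<le> real s * real (card W)"
      by (simp add: algebra_simps)
    then have W: "\<epsilon> / 4 * P \<le> real (card W)"
      using s by simp
    \<comment> \<open>Pigeonhole over the subsets of \<open>H\<close>: tails with the same
      \<open>com w\<close> share all these heads, so a box of such tails extends by any
      \<open>t\<close> of them.\<close>
    have "\<exists>T\<in>Pow H. \<delta> * P \<le> real (card {w\<in>W. com w = T})"
    proof (rule ccontr)
      assume neg: "\<not> ?thesis"
      have less: "real (card {w\<in>W. com w = T}) < \<delta> * P" if "T \<in> Pow H" for T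
        using neg that by (meson linorder_not_le)
      have "com w \<in> Pow H" for w
        by (auto simp: com_def)
      then have "(\<Union>T\<in>Pow H. {w\<in>W. com w = T}) = W"
        by blast
      moreover have "finite (Pow H)"
        using H by simp
      ultimately have "card W \<le> (\<Sum>T\<in>Pow H. card {w\<in>W. com w = T})"
        using card_UN_le[of "Pow H" "\<lambda>T. {w\<in>W. com w = T}"] by argo
      then have "real (card W) \<le> (\<Sum>T\<in>Pow H. real (card {w\<in>W. com w = T}))"
        by (simp flip: of_nat_sum)
      also have "\<dots> < (\<Sum>T\<in>Pow H. \<delta> * P)"
        using H less by (intro sum_strict_mono) auto
      also have "\<dots> = \<epsilon> / 4 * P"
        using H by (simp add: card_Pow \<delta>_def)
      finally show False
        using W by simp
    qed
    then obtain T where T: "T \<subseteq> H" "\<delta> * P \<le> real (card {w\<in>W. com w = T})"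
      by blast
    have "real (card {w\<in>W. com w = T}) > 0"
      using T(2) \<open>\<delta> > 0\<close> P by (smt (verit) mult_pos_pos)
    then obtain w where "w \<in> W" "com w = T"
      by (cases "{w\<in>W. com w = T} = {}") auto
    then have "t \<le> card T"
      by (auto simp: W_def)
    then obtain T' where T': "T' \<subseteq> T" "card T' = t"
      by (meson obtain_subset_with_card_n)
    obtain Q where Q: "list_all2 (\<lambda>B A. B \<subseteq> A \<and> card B = t) Q As"
        "listset Q \<subseteq> {w\<in>W. com w = T}"
      using N[of As "{w\<in>W. com w = T}"] len fin T(2)
      by (auto simp: S N'_def W_def L_def P_def)
    have "listset (T' # Q) \<subseteq> R"
      using Q(2) T' T(1) by (auto simp: set_Cons_def com_def)
    moreover have "T' \<subseteq> A"
      using T' T(1) H(1) by auto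
    ultimately show "\<exists>Q. list_all2 (\<lambda>B A. B \<subseteq> A \<and> card B = t) Q S \<and> listset Q \<subseteq> R"
      using Q(1) T'(2) by (intro exI[of _ "T' # Q"]) (auto simp: S)
  qed
qed

section \<open>Partitions of graphs with few cliques\<close>

text \<open>Together with the next bound this is a mean value theorem for powers. It converts
  changes of degrees into changes of power sums and back, and is the source of every factor
  \<open>n ^ (r - 1)\<close>.\<close>

lemma power_diff_ge:
  fixes x y :: real
  assumes "0 \<le> y" "y \<le> x" "r \<ge> 1"
  shows "(x - y) * x ^ (r - 1) \<le> x ^ r - y ^ r"
proof -
  obtain s where r: "r = Suc s"
    using assms(3) by (cases r) auto
  have "y * y ^ s \<le> y * x ^ s"
    using assms by (intro mult_left_mono power_mono) auto
  then show ?thesis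
    by (simp add: r algebra_simps)
qed

lemma power_diff_le:
  fixes x y M :: real
  assumes "0 \<le> y" "y \<le> x" "x \<le> M"
  shows "x ^ r - y ^ r \<le> real r * (x - y) * M ^ (r - 1)"
proof (induction r)
  case (Suc r)
  show ?case
  proof (cases r)
    case [simp]: (Suc s)
    have "x ^ Suc r - y ^ Suc r = (x - y) * x ^ r + y * (x ^ r - y ^ r)"
      by (simp add: algebra_simps)
    also have "\<dots> \<le> (x - y) * M ^ r + M * (real r * (x - y) * M ^ (r - 1))"
      using assms Suc.IH power_mono[of y x r]
      by (intro add_mono mult_left_mono power_mono mult_mono) auto
    also have "\<dots> = real (Suc r) * (x - y) * M ^ (Suc r - 1)"
      by (simp add: algebra_simps)
    finally show ?thesis .
  qed simp
qed simp

text \<open>Lists instead of vertex sets: splitting off the first entry gives a recursion over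
  neighbourhoods, and the lists are tuples to which the box lemma applies.\<close>

definition ordered_cliques :: "('a \<Rightarrow> 'a \<Rightarrow> bool) \<Rightarrow> nat \<Rightarrow> 'a set \<Rightarrow> 'a list set" where
  "ordered_cliques E m U = {xs. length xs = m \<and> set xs \<subseteq> U \<and> sorted_wrt E xs}"

lemma finite_ordered_cliques: "finite U \<Longrightarrow> finite (ordered_cliques E m U)"
  by (rule finite_subset[OF _ finite_lists_length_eq[of U m]]) (auto simp: ordered_cliques_def)

lemma card_ordered_cliques_Suc:
  assumes "finite U"
  shows "card (ordered_cliques E (Suc m) U) = (\<Sum>x\<in>U. card (ordered_cliques E m {y\<in>U. E x y}))"
proof -
  have eq: "ordered_cliques E (Suc m) U =
      (\<lambda>(x, xs). x # xs) ` (SIGMA x:U. ordered_cliques E m {y\<in>U. E x y})" (is "?A = ?B")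
  proof
    show "?A \<subseteq> ?B"
    proof
      fix z assume "z \<in> ?A"
      then obtain x xs where "z = x # xs" "x \<in> U" "xs \<in> ordered_cliques E m {y\<in>U. E x y}"
        by (cases z) (auto simp: ordered_cliques_def)
      then show "z \<in> ?B"
        by (intro image_eqI[of _ _ "(x, xs)"]) auto
    qed
  qed (auto simp: ordered_cliques_def)
  have inj: "inj_on (\<lambda>(x, xs). x # xs) (SIGMA x:U. ordered_cliques E m {y\<in>U. E x y})"
    by (auto simp: inj_on_def)
  show ?thesis
    using card_image[OF inj] eq assms by (simp add: card_SigmaI finite_ordered_cliques)
qed

text \<open>
  As in Erdos's proof of the degree majorisation theorem, the first class consists of the
  non-neighbours of a vertex of maximal degree. Vertices in too many cliques are set aside
  before, so that few cliques remain in the neighbourhood. Bounding forward degrees instead of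
  full degrees also controls the number of edges inside the classes, as observed by Furedi.
\<close>

lemma few_cliques_partition:
  fixes \<eta> :: real
  assumes "\<eta> > 0"
  shows "\<exists>\<delta>>0. \<forall>E U n. finite U \<longrightarrow> n > 0 \<longrightarrow>
           real (card (ordered_cliques E (Suc m) U)) \<le> \<delta> * real n ^ Suc m \<longrightarrow>
           (\<exists>c X. X \<subseteq> U \<and> real (card X) \<le> \<eta> * real n \<and>
                  (\<forall>v\<in>U. c v \<le> m) \<and> (\<forall>v\<in>U - X. c v < m) \<and>
                  (\<forall>v\<in>U - X. card {u\<in>U. E v u \<and> c v \<le> c u} \<le> card {u\<in>U. c v < (c u :: nat)}))"
  using assms
proof (induction m arbitrary: \<eta>)
  case 0
  \<comment> \<open>A clique of one vertex is a vertex, so the hypothesis bounds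
    \<open>card U\<close>, and \<open>\<delta> = \<eta>\<close> lets all of \<open>U\<close> be
    exceptional, in the surplus colour 0.\<close>
  have "card (ordered_cliques E (Suc 0) U) = card U" if "finite U" for E and U :: "'a set"
  proof -
    have "ordered_cliques E 0 A = {[]}" for A
      by (auto simp: ordered_cliques_def)
    then show ?thesis
      using that by (simp add: card_ordered_cliques_Suc)
  qed
  then show ?case
    using 0 by (intro exI[of _ \<eta>] conjI allI impI exI[of _ "\<lambda>_. 0"]) auto
next
  case (Suc m)
  obtain \<delta> where \<delta>: "\<delta> > 0" and IH: "\<And>E (U::'a set) n. finite U \<Longrightarrow> n > 0 \<Longrightarrow>
           real (card (ordered_cliques E (Suc m) U)) \<le> \<delta> * real n ^ Suc m \<Longrightarrow>
           (\<exists>c X. X \<subseteq> U \<and> real (card X) \<le> (\<eta> / 2) * real n \<and>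
                  (\<forall>v\<in>U. c v \<le> m) \<and> (\<forall>v\<in>U - X. c v < m) \<and>
                  (\<forall>v\<in>U - X. card {u\<in>U. E v u \<and> c v \<le> c u} \<le> card {u\<in>U. c v < (c u :: nat)}))"
    using Suc.IH[of "\<eta> / 2"] Suc.prems by auto
  show ?case
  proof (intro exI[of _ "\<delta> * \<eta> / 2"] conjI allI impI)
    show "\<delta> * \<eta> / 2 > 0"
      using \<delta> Suc.prems by simp
  next
    fix E and U :: "'a set" and n :: nat
    assume fin: "finite U" and n: "n > 0"
      and few: "real (card (ordered_cliques E (Suc (Suc m)) U)) \<le> \<delta> * \<eta> / 2 * real n ^ Suc (Suc m)"
    define N where "N v = {y\<in>U. E v y}" for v
    define r where "r v = real (card (ordered_cliques E (Suc m) (N v)))" for v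
    \<comment> \<open>Each vertex of \<open>Y\<close> starts more than
      \<open>\<delta> * n ^ Suc m\<close> cliques, so double counting bounds \<open>Y\<close> by
      half of the allowance; the other half is left to the induction.\<close>
    define Y where "Y = {v\<in>U. \<delta> * real n ^ Suc m < r v}"
    have Y: "real (card Y) \<le> \<eta> / 2 * real n"
    proof -
      have "real (card Y) * (\<delta> * real n ^ Suc m) \<le> (\<Sum>v\<in>Y. r v)"
        by (intro sum_bounded_below) (auto simp: Y_def)
      also have "\<dots> \<le> (\<Sum>v\<in>U. r v)"
        using fin by (intro sum_mono2) (auto simp: Y_def r_def)
      also have "\<dots> = real (card (ordered_cliques E (Suc (Suc m)) U))"
        using fin by (simp add: card_ordered_cliques_Suc[of U E "Suc m"] r_def N_def)
      also note few
      finally have "real (card Y) * (\<delta> * real n ^ Suc m) \<le> \<eta> / 2 * real n * (\<delta> * real n ^ Suc m)"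
        by (simp add: algebra_simps)
      then show ?thesis
        by (rule mult_right_le_imp_le) (use \<delta> n in simp)
    qed
    show "\<exists>c X. X \<subseteq> U \<and> real (card X) \<le> \<eta> * real n \<and>
                  (\<forall>v\<in>U. c v \<le> Suc m) \<and> (\<forall>v\<in>U - X. c v < Suc m) \<and>
                  (\<forall>v\<in>U - X. card {u\<in>U. E v u \<and> c v \<le> c u} \<le> card {u\<in>U. c v < (c u :: nat)})"
    proof (cases "U - Y = {}")
      case True
      have "\<eta> / 2 * real n \<le> \<eta> * real n"
        using Suc.prems by simp
      moreover have "U \<subseteq> Y"
        using True by blast
      then have "card U \<le> card Y"
        using fin by (intro card_mono) (auto simp: Y_def)
      ultimately have "real (card U) \<le> \<eta> * real n"
        using Y by linarith
      then show ?thesis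
        by (intro exI[of _ "\<lambda>_. 0"] exI[of _ U]) auto
    next
      case False
      have "Max ((\<lambda>v. card (N v)) ` (U - Y)) \<in> (\<lambda>v. card (N v)) ` (U - Y)"
        using False fin by (intro Max_in) auto
      then obtain x where x: "x \<in> U - Y" "Max ((\<lambda>v. card (N v)) ` (U - Y)) = card (N x)"
        by auto
      have max: "card (N v) \<le> card (N x)" if "v \<in> U - Y" for v
        unfolding x(2)[symmetric] using that fin by (intro Max_ge) auto
      have finN: "finite (N x)"
        using fin by (simp add: N_def)
      have "real (card (ordered_cliques E (Suc m) (N x))) \<le> \<delta> * real n ^ Suc m"
        using x by (auto simp: Y_def r_def not_less)
      \<comment> \<open>\<open>n\<close> is kept although the vertex set shrinks to
        \<open>N x\<close>, so all thresholds stay relative to the same \<open>n\<close>.\<close>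
      from IH[OF finN n this] obtain c X where cX:
          "X \<subseteq> N x" "real (card X) \<le> \<eta> / 2 * real n"
          "\<And>v. v \<in> N x \<Longrightarrow> c v \<le> m" "\<And>v. v \<in> N x - X \<Longrightarrow> c v < m"
          "\<And>v. v \<in> N x - X \<Longrightarrow> card {u\<in>N x. E v u \<and> c v \<le> c u} \<le> card {u\<in>N x. c v < (c u :: nat)}"
        by blast
      \<comment> \<open>Class 0 holds the non-neighbours of \<open>x\<close>, and the later classes
        exhaust \<open>N x\<close>. A vertex of class 0 outside \<open>Y\<close> has at most
        \<open>card (N x)\<close> neighbours by the choice of \<open>x\<close>; in the later classes
        the inequality is inherited.\<close>
      define c' where "c' v = (if v \<in> N x then Suc (c v) else 0)" for v
      have sub: "N x \<subseteq> U"
        by (auto simp: N_def)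
      have "real (card (X \<union> Y)) \<le> real (card X) + real (card Y)"
        using card_Un_le[of X Y] by linarith
      then have "real (card (X \<union> Y)) \<le> \<eta> * real n"
        using Y cX(2) by linarith
      moreover have "card {u\<in>U. E v u \<and> c' v \<le> c' u} \<le> card {u\<in>U. c' v < c' u}"
        if v: "v \<in> U - (X \<union> Y)" for v
      proof (cases "v \<in> N x")
        case True
        have "{u\<in>U. E v u \<and> c' v \<le> c' u} = {u\<in>N x. E v u \<and> c v \<le> c u}"
             "{u\<in>U. c' v < c' u} = {u\<in>N x. c v < c u}"
          using True sub by (auto simp: c'_def)
        then show ?thesis
          using cX(5)[of v] True v by auto
      next
        case False
        have "{u\<in>U. E v u \<and> c' v \<le> c' u} = N v" "{u\<in>U. c' v < c' u} = N x"
          using False sub by (auto simp: c'_def N_def)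
        then show ?thesis
          using max[of v] v by auto
      qed
      ultimately show ?thesis
        using cX sub
        by (intro exI[of _ c'] exI[of _ "X \<union> Y"]) (auto simp: c'_def Y_def le_SucI)
    qed
  qed
qed

section \<open>Near-optimal partitions\<close>

definition vdeg :: "(nat \<Rightarrow> nat \<Rightarrow> bool) \<Rightarrow> nat \<Rightarrow> nat \<Rightarrow> nat" where
  "vdeg E n v = card {u\<in>{..<n}. E v u}"

definition cross :: "nat \<Rightarrow> (nat \<Rightarrow> nat) \<Rightarrow> nat \<Rightarrow> nat" where
  "cross n c v = card {u\<in>{..<n}. c u \<noteq> c v}"

definition part :: "nat \<Rightarrow> (nat \<Rightarrow> nat) \<Rightarrow> nat \<Rightarrow> nat set" where
  "part n c i = {v\<in>{..<n}. c v = i}"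

lemma finite_part [simp]: "finite (part n c i)"
  by (simp add: part_def)

lemma vdeg_le: "vdeg E n v \<le> n"
  unfolding vdeg_def by (rule order.trans[OF card_mono[of "{..<n}"]]) auto

lemma cross_le: "cross n c v \<le> n"
  unfolding cross_def by (rule order.trans[OF card_mono[of "{..<n}"]]) auto

lemma card_filter_split:
  assumes "finite A"
  shows "card {x\<in>A. P x} = card {x\<in>A. P x \<and> Q x} + card {x\<in>A. P x \<and> \<not> Q x}"
  using assms by (subst card_Un_disjoint[symmetric]) (auto intro: arg_cong[where f = card])

lemma cross_eq: "real (cross n c v) = real n - real (card (part n c (c v)))"
  using card_filter_split[of "{..<n}" "\<lambda>_. True" "\<lambda>u. c u = c v"]
  by (simp add: cross_def part_def)

lemma sum_card_parts:
  assumes "\<And>v. v < n \<Longrightarrow> c v < k"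
  shows "(\<Sum>i<k. card (part n c i)) = n"
proof -
  have "(\<Union>i<k. part n c i) = {..<n}"
    using assms by (auto simp: part_def)
  moreover have "card (\<Union>i<k. part n c i) = (\<Sum>i<k. card (part n c i))"
    by (intro card_UN_disjoint) (auto simp: part_def)
  ultimately show ?thesis by simp
qed

lemma sum_if_mem:
  fixes a :: real
  assumes "finite A" "S \<subseteq> A"
  shows "(\<Sum>v\<in>A. if v \<in> S then a else 0) = real (card S) * a"
  using assms by (simp add: sum.If_cases Int_absorb1)

lemma power_add_ge:
  fixes x y :: real
  assumes "0 \<le> x" "0 \<le> y" "r \<ge> 1"
  shows "x ^ r + y ^ r \<le> (x + y) ^ r"
proof -
  have "y ^ r = y * y ^ (r - 1)"
    using assms(3) by (cases r) auto
  also have "\<dots> \<le> y * (x + y) ^ (r - 1)"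
    using assms by (intro mult_left_mono power_mono) auto
  also have "\<dots> \<le> (x + y) ^ r - x ^ r"
    using power_diff_ge[of x "x + y" r] assms by simp
  finally show ?thesis by simp
qed

text \<open>Some part avoids the colour of \<open>v\<close> because there are two of them. Cross
  degrees are therefore linear, which gives the lower bounds from \<open>power_diff_ge\<close> their
  full order.\<close>

lemma cross_ge:
  assumes "k \<ge> 2" "\<And>i. i < k \<Longrightarrow> x \<le> real (card (part n c i))"
  shows "x \<le> real (cross n c v)"
proof -
  define i where "i = (if c v = 0 then 1 else 0 :: nat)"
  have i: "i < k" "i \<noteq> c v"
    using assms(1) by (auto simp: i_def)
  then have "card (part n c i) \<le> cross n c v"
    unfolding cross_def part_def by (intro card_mono) auto
  then show ?thesis
    using assms(2)[OF i(1)] by simp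
qed

text \<open>A tiny class is not optimal: half of a largest class may be moved into it.\<close>

lemma rebalance_tiny_part:
  fixes k r :: nat
  defines "\<kappa> \<equiv> (1 / (4 * real k)) ^ Suc r"
  assumes k: "k \<ge> 1" and r: "r \<ge> 1" and c: "\<And>v. v < n \<Longrightarrow> c v < k" and n: "2 * k \<le> n"
    and j: "j < k" "real (card (part n c j)) \<le> \<kappa> * real n"
  shows "\<exists>c'. (\<forall>v<n. c' v < k) \<and>
           (\<Sum>v<n. real (cross n c v) ^ r) + \<kappa> * real n ^ Suc r \<le> (\<Sum>v<n. real (cross n c' v) ^ r)"
proof -
  have "\<exists>i<k. n \<le> k * card (part n c i)"
  proof (rule ccontr)
    assume "\<not> ?thesis"
    then have "(\<Sum>i<k. k * card (part n c i)) < (\<Sum>i<k. n)"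
      using j(1) by (intro sum_strict_mono) auto
    moreover have "(\<Sum>i<k. k * card (part n c i)) = k * n"
      using sum_card_parts[OF c] by (simp flip: sum_distrib_left)
    ultimately show False by simp
  qed
  then obtain i where i: "i < k" "n \<le> k * card (part n c i)"
    by blast
  define a where "a = card (part n c i)"
  define b where "b = card (part n c j)"
  define h where "h = a div 2"
  \<comment> \<open>\<open>q ^ Suc r\<close> equals \<open>\<kappa> * n ^ Suc r\<close> and is the
    unit of comparison: the gain is at least two units, the loss at most one.\<close>
  define q where "q = real n / (4 * real k)"
  have q: "q > 0" "4 * q \<le> real a"
  proof -
    show "q > 0" using k n by (simp add: q_def)
    have "real n \<le> real k * real a"
      using i(2) unfolding a_def by (metis of_nat_le_iff of_nat_mult)
    then show "4 * q \<le> real a"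
      using k by (simp add: q_def field_simps)
  qed
  have "a \<ge> 2"
  proof -
    have "k * 2 \<le> k * a"
      using i(2) n unfolding a_def by linarith
    then show ?thesis using k by simp
  qed
  have h: "q \<le> real h" "2 * q \<le> real (a - h)" "h \<le> a"
    using q \<open>a \<ge> 2\<close> unfolding h_def by (auto simp: real_of_nat_div field_simps)
  have kap: "\<kappa> * real n ^ Suc r = q ^ Suc r"
    by (simp add: \<kappa>_def q_def power_divide)
  have "\<kappa> \<le> (1 / (4 * real k)) ^ 1"
    unfolding \<kappa>_def using k by (intro power_decreasing) auto
  then have "\<kappa> * real n \<le> q"
    using mult_right_mono[of \<kappa> "1 / (4 * real k)" "real n"] by (simp add: q_def)
  then have b: "real b \<le> q"
    using j(2) by (simp add: b_def)
  have bh: "b + h \<le> a"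
    using b q unfolding h_def by linarith
  have "i \<noteq> j"
    using b q unfolding a_def b_def by auto
  obtain A where A: "A \<subseteq> part n c i" "card A = h"
    using obtain_subset_with_card_n[of h "part n c i"] h(3) by (auto simp: a_def)
  have finA: "finite A"
    using A(1) finite_part by (rule finite_subset)
  define c' where "c' v = (if v \<in> A then j else c v)" for v
  have pi: "part n c' i = part n c i - A" and pj: "part n c' j = part n c j \<union> A"
    and pl: "\<And>l. l \<noteq> i \<Longrightarrow> l \<noteq> j \<Longrightarrow> part n c' l = part n c l"
    using A(1) \<open>i \<noteq> j\<close> by (auto simp: part_def c'_def)
  have card_i: "card (part n c' i) = a - h"
    using A finA by (simp add: pi a_def card_Diff_subset)
  have card_j: "card (part n c' j) = b + h"
    unfolding pj b_def A(2)[symmetric] using A(1) finA \<open>i \<noteq> j\<close>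
    by (intro card_Un_disjoint) (auto simp: part_def)
  \<comment> \<open>A lower bound for the change at \<open>v\<close>: vertices staying in part
    \<open>i\<close> gain at least \<open>h ^ r\<close> by superadditivity, moved vertices lose
    nothing because \<open>b + h \<le> a\<close>, and the few old vertices of part \<open>j\<close>
    lose at most \<open>n ^ r\<close>.\<close>
  define g where "g v = (if v \<in> part n c i - A then real h ^ r else 0)
                        - (if v \<in> part n c j then real n ^ r else 0)" for v
  have "real (cross n c v) ^ r + g v \<le> real (cross n c' v) ^ r" if "v < n" for v
  proof -
    consider "v \<in> part n c i - A" | "v \<in> A" | "v \<in> part n c j" | "c v \<noteq> i" "c v \<noteq> j" "v \<notin> A"
      using \<open>v < n\<close> by (auto simp: part_def)
    then show ?thesis
    proof cases
      case 1
      then have v: "c v = i" "c' v = i"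
        by (auto simp: part_def c'_def)
      have "real (cross n c' v) = real (cross n c v) + real h"
        using h(3) by (simp add: cross_eq v card_i) (simp add: a_def)
      moreover have "g v = real h ^ r"
        using 1 \<open>i \<noteq> j\<close> by (auto simp: g_def part_def)
      ultimately show ?thesis
        using power_add_ge[of "real (cross n c v)" "real h" r] r by simp
    next
      case 2
      then have v: "c v = i" "c' v = j" "v \<notin> part n c j"
        using A(1) \<open>i \<noteq> j\<close> by (auto simp: part_def c'_def)
      have "real (cross n c v) \<le> real (cross n c' v)"
        using bh by (simp add: cross_eq v card_j) (simp add: a_def)
      moreover have "g v = 0"
        using 2 v by (auto simp: g_def)
      ultimately show ?thesis
        by (simp add: power_mono)
    next
      case 3
      then have "g v = - (real n ^ r)"
        using \<open>i \<noteq> j\<close> by (auto simp: g_def part_def)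
      moreover have "real (cross n c v) ^ r \<le> real n ^ r"
        by (intro power_mono) (simp_all add: cross_le)
      ultimately show ?thesis
        by (smt (verit) of_nat_0_le_iff zero_le_power)
    next
      case 4
      then have "g v = 0" "c' v = c v" "part n c' (c v) = part n c (c v)"
        using pl by (auto simp: g_def part_def c'_def)
      then show ?thesis
        by (simp add: cross_eq)
    qed
  qed
  then have "(\<Sum>v<n. real (cross n c v) ^ r + g v) \<le> (\<Sum>v<n. real (cross n c' v) ^ r)"
    by (intro sum_mono) auto
  moreover have "(\<Sum>v<n. g v) = real (a - h) * real h ^ r - real b * real n ^ r"
  proof -
    have "(\<Sum>v<n. if v \<in> part n c i - A then real h ^ r else 0) = real (card (part n c i - A)) * real h ^ r"
      by (intro sum_if_mem) (auto simp: part_def)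
    moreover have "(\<Sum>v<n. if v \<in> part n c j then real n ^ r else 0) = real (card (part n c j)) * real n ^ r"
      by (intro sum_if_mem) (auto simp: part_def)
    ultimately show ?thesis
      using A finA by (simp add: g_def sum_subtractf a_def b_def card_Diff_subset)
  qed
  moreover have "2 * q ^ Suc r \<le> real (a - h) * real h ^ r"
  proof -
    have "2 * q * q ^ r \<le> real (a - h) * real h ^ r"
      using h q by (intro mult_mono power_mono) auto
    then show ?thesis by simp
  qed
  moreover have "real b * real n ^ r \<le> q ^ Suc r"
  proof -
    have "real b * real n ^ r \<le> \<kappa> * real n * real n ^ r"
      using j(2) unfolding b_def by (intro mult_right_mono) auto
    then show ?thesis
      using kap by (simp add: mult.assoc)
  qed
  ultimately have "(\<Sum>v<n. real (cross n c v) ^ r) + \<kappa> * real n ^ Suc r \<le> (\<Sum>v<n. real (cross n c' v) ^ r)"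
    unfolding kap by (simp add: sum.distrib)
  moreover have "\<forall>v<n. c' v < k"
    using c j(1) by (auto simp: c'_def)
  ultimately show ?thesis by blast
qed

text \<open>A cross edge is forward only from its end of smaller colour, while the right-hand side
  sees it from both ends.\<close>

lemma sum_forward_eq_half:
  fixes n :: nat and c :: "nat \<Rightarrow> nat"
  assumes sym: "\<And>u v. E u v \<Longrightarrow> E v u"
  shows "2 * (\<Sum>v<n. card {u\<in>{..<n}. E v u \<and> c v < c u}) =
         (\<Sum>v<n. card {u\<in>{..<n}. E v u \<and> c u \<noteq> c v})"
proof -
  have "(\<Sum>v<n. card {u\<in>{..<n}. E v u \<and> c v < c u}) = (\<Sum>u<n. card {v\<in>{..<n}. E v u \<and> c v < c u})"
    by (rule sum_card_swap) auto
  also have "\<dots> = (\<Sum>v<n. card {u\<in>{..<n}. E v u \<and> c u < c v})"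
    using sym by (intro sum.cong refl arg_cong[where f = card]) auto
  finally have eq: "(\<Sum>v<n. card {u\<in>{..<n}. E v u \<and> c v < c u}) = \<dots>" .
  have "card {u\<in>{..<n}. E v u \<and> c u \<noteq> c v} =
      card {u\<in>{..<n}. E v u \<and> c v < c u} + card {u\<in>{..<n}. E v u \<and> c u < c v}" for v
    by (subst card_Un_disjoint[symmetric]) (auto intro!: arg_cong[where f = card])
  then show ?thesis
    using eq by (simp add: sum.distrib)
qed

text \<open>Majorisation gives \<open>d \<le> D + \<eta> * n\<close> off \<open>X\<close>, where
  \<open>d\<close> and \<open>D\<close> are the degrees in \<open>E\<close> and in the complete
  partite graph of \<open>c\<close>; optimality gives the reverse comparison of the power sums. Both
  are thus nearly equal, which excludes tiny parts by rebalancing. Equality of degree sums alone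
  would still allow missing cross edges to be compensated by edges inside parts; the forward form of
  the hypothesis excludes this.\<close>

lemma near_optimal_partition:
  fixes k r :: nat
  assumes k: "k \<ge> 2" and r: "r \<ge> 1"
  shows "\<exists>\<gamma>>0. \<exists>K>0. \<exists>\<eta>0>0. \<forall>\<eta> n E c X.
     0 < \<eta> \<longrightarrow> \<eta> \<le> \<eta>0 \<longrightarrow> 2 * k \<le> n \<longrightarrow> (\<forall>u v. E u v \<longrightarrow> E v u) \<longrightarrow> (\<forall>v<n. c v < k) \<longrightarrow>
     X \<subseteq> {..<n} \<longrightarrow> real (card X) \<le> \<eta> * real n \<longrightarrow>
     (\<forall>v\<in>{..<n} - X. real (card {u\<in>{..<n}. E v u \<and> c v \<le> c u})
                        \<le> real (card {u\<in>{..<n}. c v < c u}) + \<eta> * real n) \<longrightarrow>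
     (\<forall>c'. (\<forall>v<n. c' v < k) \<longrightarrow>
        (\<Sum>v<n. real (cross n c' v) ^ r) \<le> (\<Sum>v<n. real (vdeg E n v) ^ r)) \<longrightarrow>
     (\<forall>i<k. \<gamma> * real n \<le> real (card (part n c i))) \<and>
     real (\<Sum>v<n. card {u\<in>{..<n}. c u \<noteq> c v \<and> \<not> E v u}) \<le> K * \<eta> * (real n)\<^sup>2"
proof -
  \<comment> \<open>\<open>\<gamma>\<close> is the threshold of \<open>rebalance_tiny_part\<close>.
    In \<open>C\<close>, the first term pays for passing from \<open>D\<close> to \<open>D'\<close>
    and the summand 1 for the vertices of \<open>X\<close>.\<close>
  define \<gamma> where "\<gamma> = (1 / (4 * real k)) ^ Suc r"
  define C where "C = real r * 2 ^ (r - 1) + 1"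
  define S where "S = C / \<gamma> ^ (r - 1) + 1"
  define K where "K = 2 * S + 4"
  \<comment> \<open>The bound 1 keeps \<open>D' \<le> 2 * n\<close>; the other one makes the error
    \<open>C * e\<close> at most half of the gain from rebalancing.\<close>
  define \<eta>0 where "\<eta>0 = min 1 (\<gamma> / (2 * C))"
  have \<gamma>: "\<gamma> > 0" using k by (simp add: \<gamma>_def)
  have C: "C > 0" by (simp add: C_def add_nonneg_pos)
  have S: "S > 0" using \<gamma> C by (simp add: S_def add_pos_pos)
  have pos: "\<eta>0 > 0" "K > 0" using \<gamma> C S by (simp_all add: \<eta>0_def K_def)
  have main: "(\<forall>i<k. \<gamma> * real n \<le> real (card (part n c i))) \<and>
     real (\<Sum>v<n. card {u\<in>{..<n}. c u \<noteq> c v \<and> \<not> E v u}) \<le> K * \<eta> * (real n)\<^sup>2"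
    if \<eta>: "0 < \<eta>" "\<eta> \<le> \<eta>0" and n: "2 * k \<le> n" and sym: "\<forall>u v. E u v \<longrightarrow> E v u"
      and c: "\<forall>v<n. c v < k" and X: "X \<subseteq> {..<n}" "real (card X) \<le> \<eta> * real n"
      and fwd: "\<forall>v\<in>{..<n} - X. real (card {u\<in>{..<n}. E v u \<and> c v \<le> c u})
                        \<le> real (card {u\<in>{..<n}. c v < c u}) + \<eta> * real n"
      and opt: "\<forall>c'. (\<forall>v<n. c' v < k) \<longrightarrow>
        (\<Sum>v<n. real (cross n c' v) ^ r) \<le> (\<Sum>v<n. real (vdeg E n v) ^ r)"
    for \<eta> n E c X
  proof -
    define d where "d v = real (vdeg E n v)" for v
    define D where "D v = real (cross n c v)" for v
    define D' where "D' v = D v + \<eta> * real n" for v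
    define e where "e = \<eta> * real n ^ Suc r"
    have n0: "real n > 0" using n k by simp
    have finX: "finite X" using X(1) finite_subset by blast
    have \<eta>1: "\<eta> \<le> 1" using \<eta> by (simp add: \<eta>0_def)
    have d_le: "d v \<le> real n" and D_le: "D v \<le> real n" and d0: "d v \<ge> 0" and D0: "D v \<ge> 0" for v
      by (simp_all add: d_def D_def vdeg_le cross_le)
    have dD: "d v \<le> D' v" if v: "v \<in> {..<n} - X" for v
    proof -
      \<comment> \<open>Neighbours of smaller colour are bounded by the whole smaller classes. The
        hypothesis handles the rest, including the neighbours in the class of
        \<open>v\<close>.\<close>
      have "vdeg E n v \<le> card ({u\<in>{..<n}. c u < c v} \<union> {u\<in>{..<n}. E v u \<and> c v \<le> c u})"
        unfolding vdeg_def by (intro card_mono) auto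
      also have "\<dots> \<le> card {u\<in>{..<n}. c u < c v} + card {u\<in>{..<n}. E v u \<and> c v \<le> c u}"
        by (rule card_Un_le)
      finally have "d v \<le> real (card {u\<in>{..<n}. c u < c v}) + real (card {u\<in>{..<n}. E v u \<and> c v \<le> c u})"
        by (simp add: d_def flip: of_nat_add)
      moreover have "cross n c v = card {u\<in>{..<n}. c u < c v} + card {u\<in>{..<n}. c v < c u}"
        unfolding cross_def
        by (subst card_Un_disjoint[symmetric]) (auto intro!: arg_cong[where f = card])
      ultimately show ?thesis
        using bspec[OF fwd v] by (simp add: D'_def D_def)
    qed
    have D'_pow: "D' v ^ r \<le> D v ^ r + real r * 2 ^ (r - 1) * (\<eta> * real n ^ r)" for v
    proof -
      have "\<eta> * real n \<le> 1 * real n"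
        using \<eta>1 by (intro mult_right_mono) auto
      then have "D' v \<le> 2 * real n"
        using D_le[of v] by (simp add: D'_def)
      then have "D' v ^ r - D v ^ r \<le> real r * (D' v - D v) * (2 * real n) ^ (r - 1)"
        using D0 \<eta> by (intro power_diff_le) (auto simp: D'_def)
      also have "\<dots> = real r * 2 ^ (r - 1) * (\<eta> * (real n * real n ^ (r - 1)))"
        by (simp add: D'_def power_mult_distrib)
      also have "real n * real n ^ (r - 1) = real n ^ r"
        using r by (cases r) auto
      finally show ?thesis by simp
    qed
    have sumD'D: "(\<Sum>v\<in>{..<n} - X. D' v ^ r) \<le> (\<Sum>v\<in>{..<n} - X. D v ^ r) + real r * 2 ^ (r - 1) * e"
    proof -
      have "(\<Sum>v\<in>{..<n} - X. D' v ^ r) \<le> (\<Sum>v\<in>{..<n} - X. D v ^ r + real r * 2 ^ (r - 1) * (\<eta> * real n ^ r))"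
        using D'_pow by (intro sum_mono) auto
      also have "\<dots> = (\<Sum>v\<in>{..<n} - X. D v ^ r) + real (card ({..<n} - X)) * (real r * 2 ^ (r - 1) * (\<eta> * real n ^ r))"
        by (simp add: sum.distrib)
      also have "card ({..<n} - X) \<le> n"
        using card_mono[of "{..<n}" "{..<n} - X"] by auto
      then have "real (card ({..<n} - X)) * (real r * 2 ^ (r - 1) * (\<eta> * real n ^ r)) \<le>
                 real n * (real r * 2 ^ (r - 1) * (\<eta> * real n ^ r))"
        using \<eta> by (intro mult_right_mono) auto
      finally show ?thesis
        by (simp add: e_def algebra_simps)
    qed
    have sumX: "(\<Sum>v\<in>X. d v ^ r) \<le> e"
    proof -
      have "(\<Sum>v\<in>X. d v ^ r) \<le> real (card X) * real n ^ r"
        using d_le d0 by (intro sum_bounded_above power_mono) auto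
      also have "\<dots> \<le> \<eta> * real n * real n ^ r"
        using X(2) by (intro mult_right_mono) auto
      finally show ?thesis by (simp add: e_def mult_ac)
    qed
    have split: "(\<Sum>v<n. f v) = (\<Sum>v\<in>{..<n} - X. f v) + (\<Sum>v\<in>X. f v)" for f :: "nat \<Rightarrow> real"
      using X(1) by (simp add: sum.subset_diff)
    have dDsum: "(\<Sum>v<n. D v ^ r) \<le> (\<Sum>v<n. d v ^ r)"
      using opt c by (simp add: d_def D_def)
    have parts: "\<gamma> * real n \<le> real (card (part n c i))" if "i < k" for i
    proof (rule ccontr)
      assume "\<not> ?thesis"
      then obtain c' where c': "\<forall>v<n. c' v < k"
        "(\<Sum>v<n. real (cross n c v) ^ r) + \<gamma> * real n ^ Suc r \<le> (\<Sum>v<n. real (cross n c' v) ^ r)"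
        using rebalance_tiny_part[of k r n c i] k r c n \<open>i < k\<close> unfolding \<gamma>_def by auto
      \<comment> \<open>Rebalancing would raise the power sum of \<open>c\<close> by
        \<open>\<gamma> * n ^ Suc r\<close>, and \<open>E\<close> dominates the rebalanced graph;
        but \<open>E\<close> exceeds \<open>c\<close> by at most half of that.\<close>
      have "(\<Sum>v<n. D v ^ r) + \<gamma> * real n ^ Suc r \<le> (\<Sum>v<n. d v ^ r)"
        using c'(2) mp[OF spec[OF opt, of c'] c'(1)] unfolding D_def d_def by linarith
      also have "\<dots> \<le> (\<Sum>v\<in>{..<n} - X. D' v ^ r) + e"
        unfolding split using dD d0 sumX by (intro add_mono sum_mono power_mono) auto
      also have "\<dots> \<le> (\<Sum>v\<in>{..<n} - X. D v ^ r) + C * e"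
        using sumD'D by (simp add: C_def algebra_simps)
      also have "(\<Sum>v\<in>{..<n} - X. D v ^ r) \<le> (\<Sum>v<n. D v ^ r)"
        using D0 by (intro sum_mono2) auto
      also have "C * e \<le> C * (\<gamma> / (2 * C) * real n ^ Suc r)"
        using C \<eta> unfolding e_def \<eta>0_def by (intro mult_left_mono mult_right_mono) auto
      also have "\<dots> = \<gamma> / 2 * real n ^ Suc r"
        using C by simp
      finally show False
        using \<gamma> n0 by (simp add: field_simps)
    qed
    have D_ge: "\<gamma> * real n \<le> D v" for v
      unfolding D_def using cross_ge[OF k parts] .
    \<comment> \<open>Off \<open>X\<close> the difference \<open>D' v - d v\<close> is nonnegative,
      and each unit of it costs at least \<open>(\<gamma> * n) ^ (r - 1)\<close> in the power
      sum.\<close>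
    have deficit: "(\<Sum>v<n. D v - d v) \<le> S * \<eta> * (real n)\<^sup>2"
    proof -
      have "(\<Sum>v\<in>{..<n} - X. D' v - d v) * (\<gamma> * real n) ^ (r - 1) =
          (\<Sum>v\<in>{..<n} - X. (D' v - d v) * (\<gamma> * real n) ^ (r - 1))"
        by (simp add: sum_distrib_right)
      also have "\<dots> \<le> (\<Sum>v\<in>{..<n} - X. D' v ^ r - d v ^ r)"
      proof (rule sum_mono)
        fix v assume v: "v \<in> {..<n} - X"
        have "\<gamma> * real n \<le> D' v"
          using D_ge[of v] \<eta> by (simp add: D'_def add_increasing2)
        then have "(D' v - d v) * (\<gamma> * real n) ^ (r - 1) \<le> (D' v - d v) * D' v ^ (r - 1)"
          using dD[OF v] \<gamma> by (intro mult_left_mono power_mono) auto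
        also have "\<dots> \<le> D' v ^ r - d v ^ r"
          using dD[OF v] d0 r by (intro power_diff_ge) auto
        finally show "(D' v - d v) * (\<gamma> * real n) ^ (r - 1) \<le> D' v ^ r - d v ^ r" .
      qed
      also have "\<dots> \<le> (\<Sum>v\<in>{..<n} - X. D v ^ r) + real r * 2 ^ (r - 1) * e - (\<Sum>v\<in>{..<n} - X. d v ^ r)"
        using sumD'D by (simp add: sum_subtractf)
      also have "\<dots> \<le> C * e"
      proof -
        have "(\<Sum>v\<in>X. D v ^ r) \<ge> 0" using D0 by (intro sum_nonneg) auto
        then show ?thesis
          using dDsum sumX unfolding split by (simp add: C_def algebra_simps)
      qed
      finally have "(\<Sum>v\<in>{..<n} - X. D' v - d v) * (\<gamma> * real n) ^ (r - 1) \<le> C * e" .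
      also have "C * e = C / \<gamma> ^ (r - 1) * \<eta> * (real n)\<^sup>2 * (\<gamma> * real n) ^ (r - 1)"
        using r \<gamma> by (cases r) (auto simp: e_def power2_eq_square power_mult_distrib)
      finally have 1: "(\<Sum>v\<in>{..<n} - X. D' v - d v) \<le> C / \<gamma> ^ (r - 1) * \<eta> * (real n)\<^sup>2"
        by (rule mult_right_le_imp_le) (use \<gamma> n0 in simp)
      have "(\<Sum>v\<in>X. D v - d v) \<le> real (card X) * real n"
        using D_le d0 by (intro sum_bounded_above) (smt (verit))
      also have "\<dots> \<le> \<eta> * real n * real n"
        using X(2) by (intro mult_right_mono) auto
      finally have 2: "(\<Sum>v\<in>X. D v - d v) \<le> \<eta> * (real n)\<^sup>2"
        by (simp add: power2_eq_square)
      have "(\<Sum>v\<in>{..<n} - X. D v - d v) \<le> (\<Sum>v\<in>{..<n} - X. D' v - d v)"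
        using \<eta> by (intro sum_mono) (simp add: D'_def)
      then show ?thesis
        using 1 2 unfolding split by (simp add: S_def algebra_simps)
    qed
    define ins where "ins v = real (card {u\<in>{..<n}. E v u \<and> c u = c v})" for v
    define xs where "xs v = real (card {u\<in>{..<n}. E v u \<and> c u \<noteq> c v})" for v
    define ms where "ms v = real (card {u\<in>{..<n}. c u \<noteq> c v \<and> \<not> E v u})" for v
    define F where "F v = real (card {u\<in>{..<n}. E v u \<and> c v < c u})" for v
    define G where "G v = real (card {u\<in>{..<n}. c v < c u})" for v
    have d_eq: "d v = xs v + ins v" for v
      using card_filter_split[of "{..<n}" "E v" "\<lambda>u. c u = c v"]
      by (simp add: d_def vdeg_def xs_def ins_def)
    have D_eq: "D v = xs v + ms v" for v
      using card_filter_split[of "{..<n}" "\<lambda>u. c u \<noteq> c v" "E v"]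
      by (simp add: D_def cross_def xs_def ms_def conj_commute)
    have FX: "2 * (\<Sum>v<n. F v) = (\<Sum>v<n. xs v)"
      using sum_forward_eq_half[of E n c] sym unfolding F_def xs_def
      by (simp flip: of_nat_sum)
    have GD: "2 * (\<Sum>v<n. G v) = (\<Sum>v<n. D v)"
      using sum_forward_eq_half[of "\<lambda>_ _. True" n c] unfolding G_def D_def cross_def
      by (simp flip: of_nat_sum)
    have "F v + ins v \<le> G v + \<eta> * real n + (if v \<in> X then real n else 0)" if "v < n" for v
    proof -
      have "{u\<in>{..<n}. E v u \<and> c v \<le> c u} =
          {u\<in>{..<n}. E v u \<and> c v < c u} \<union> {u\<in>{..<n}. E v u \<and> c u = c v}"
        by auto
      then have *: "real (card {u\<in>{..<n}. E v u \<and> c v \<le> c u}) = F v + ins v"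
        unfolding F_def ins_def by (simp add: card_Un_disjoint disjoint_iff)
      show ?thesis
      proof (cases "v \<in> X")
        case True
        have "card {u\<in>{..<n}. E v u \<and> c v \<le> c u} \<le> card {..<n}"
          by (intro card_mono) auto
        then have "F v + ins v \<le> real n"
          unfolding *[symmetric] by simp
        moreover have "G v \<ge> 0" "\<eta> * real n \<ge> 0"
          using \<eta> by (simp_all add: G_def)
        ultimately show ?thesis
          using True by simp
      next
        case False
        then show ?thesis
          using bspec[OF fwd, of v] that * by (simp add: G_def)
      qed
    qed
    then have "(\<Sum>v<n. F v + ins v) \<le> (\<Sum>v<n. G v + \<eta> * real n + (if v \<in> X then real n else 0))"
      by (intro sum_mono) auto
    also have "\<dots> = (\<Sum>v<n. G v) + \<eta> * (real n)\<^sup>2 + real (card X) * real n"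
      using X(1) by (simp add: sum.distrib sum_if_mem power2_eq_square)
    also have "real (card X) * real n \<le> \<eta> * real n * real n"
      using X(2) by (intro mult_right_mono) auto
    finally have "(\<Sum>v<n. F v) + (\<Sum>v<n. ins v) \<le> (\<Sum>v<n. G v) + 2 * \<eta> * (real n)\<^sup>2"
      by (simp add: sum.distrib power2_eq_square)
    moreover have "(\<Sum>v<n. D v) = (\<Sum>v<n. xs v) + (\<Sum>v<n. ms v)"
      by (simp add: D_eq sum.distrib)
    moreover have "(\<Sum>v<n. D v - d v) = (\<Sum>v<n. ms v) - (\<Sum>v<n. ins v)"
      by (simp add: D_eq d_eq sum_subtractf)
    \<comment> \<open>The forward inequality and the two halving identities give
      \<open>ins \<le> ms / 2 + 2 * \<eta> * n\<^sup>2\<close> in total, while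
      \<open>deficit\<close> bounds \<open>ms - ins\<close>. Adding the two leaves half of
      \<open>ms\<close> on the left.\<close>
    ultimately have "(\<Sum>v<n. ms v) \<le> 2 * (S * \<eta> * (real n)\<^sup>2) + 4 * \<eta> * (real n)\<^sup>2"
      using deficit FX GD by argo
    then have "(\<Sum>v<n. ms v) \<le> K * \<eta> * (real n)\<^sup>2"
      by (simp add: K_def algebra_simps)
    then show ?thesis
      using parts by (simp add: ms_def)
  qed
  show ?thesis
  proof (rule exI[of _ \<gamma>], rule conjI[OF \<gamma>], rule exI[of _ K], rule conjI[OF pos(2)],
      rule exI[of _ \<eta>0], rule conjI[OF pos(1)], intro allI impI, goal_cases)
    case (1 \<eta> n E c X)
    then show ?case
      by (rule main)
  qed
qed

section \<open>Stability of extremal graphs\<close>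

definition colouring :: "'a set \<Rightarrow> ('a \<Rightarrow> 'a \<Rightarrow> bool) \<Rightarrow> nat \<Rightarrow> ('a \<Rightarrow> nat) \<Rightarrow> bool" where
  "colouring W A k p \<longleftrightarrow> (\<forall>x\<in>W. p x < k) \<and> (\<forall>x\<in>W. \<forall>y\<in>W. A x y \<longrightarrow> p x \<noteq> p y)"

definition embeds :: "'a set \<Rightarrow> ('a \<Rightarrow> 'a \<Rightarrow> bool) \<Rightarrow> (nat \<Rightarrow> nat \<Rightarrow> bool) \<Rightarrow> nat \<Rightarrow> bool" where
  "embeds W A E n \<longleftrightarrow>
     (\<exists>f. inj_on f W \<and> f ` W \<subseteq> {..<n} \<and> (\<forall>x\<in>W. \<forall>y\<in>W. A x y \<longrightarrow> E (f x) (f y)))"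

text \<open>Relations replace edge sets until the final section, so degrees count neighbours
  directly and degree sums are twice the number of edges. Restricting \<open>E\<close> to
  \<open>{..<n}\<close> makes the relation determined by the graph.\<close>

definition graph_rel :: "nat \<Rightarrow> (nat \<Rightarrow> nat \<Rightarrow> bool) \<Rightarrow> bool" where
  "graph_rel n E \<longleftrightarrow> (\<forall>u v. E u v \<longrightarrow> E v u \<and> u < n \<and> v < n \<and> u \<noteq> v)"

lemma graph_relD:
  assumes "graph_rel n E" "E u v"
  shows "E v u" "u < n" "v < n" "u \<noteq> v"
  using assms by (auto simp: graph_rel_def)

definition multipartite :: "nat \<Rightarrow> (nat \<Rightarrow> nat) \<Rightarrow> nat \<Rightarrow> nat \<Rightarrow> bool" where
  "multipartite n c u v \<longleftrightarrow> u < n \<and> v < n \<and> c u \<noteq> c v"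

lemma graph_rel_multipartite: "graph_rel n (multipartite n c)"
  by (auto simp: graph_rel_def multipartite_def)

lemma vdeg_multipartite: "v < n \<Longrightarrow> vdeg (multipartite n c) n v = cross n c v"
  unfolding vdeg_def cross_def multipartite_def by (intro arg_cong[where f = card]) auto

lemma in_listset_iff: "xs \<in> listset S \<longleftrightarrow> list_all2 (\<in>) xs S"
proof (induction S arbitrary: xs)
  case (Cons A S)
  then show ?case
    by (cases xs) (auto simp: set_Cons_def)
qed simp

text \<open>The two colourability assumptions say that the chromatic number is \<open>k + 1\<close>,
  and \<open>k \<ge> 2\<close> expresses that F is not bipartite.\<close>

locale forbidden_graph =
  fixes VF :: "'a set" and A :: "'a \<Rightarrow> 'a \<Rightarrow> bool" and k :: nat
  assumes finite_VF: "finite VF"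
    and A_sym: "A x y \<Longrightarrow> A y x"
    and A_irrefl: "\<not> A x x"
    and k_ge_2: "k \<ge> 2"
    and Suc_k_colourable: "\<exists>p. colouring VF A (Suc k) p"
    and not_k_colourable: "\<not> colouring VF A k p"
begin

definition free :: "nat \<Rightarrow> (nat \<Rightarrow> nat \<Rightarrow> bool) \<Rightarrow> bool" where
  "free n E \<longleftrightarrow> graph_rel n E \<and> \<not> embeds VF A E n"

definition extremal :: "nat \<Rightarrow> nat \<Rightarrow> (nat \<Rightarrow> nat \<Rightarrow> bool) \<Rightarrow> bool" where
  "extremal r n E \<longleftrightarrow> free n E \<and>
     (\<forall>E'. free n E' \<longrightarrow> (\<Sum>v<n. real (vdeg E' n v) ^ r) \<le> (\<Sum>v<n. real (vdeg E n v) ^ r))"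

lemma card_VF_pos: "card VF > 0"
proof -
  have "VF \<noteq> {}"
    using not_k_colourable[of "\<lambda>_. 0"] by (auto simp: colouring_def)
  then show ?thesis
    using finite_VF by (simp add: card_gt_0_iff)
qed

lemma free_multipartite:
  assumes "\<And>v. v < n \<Longrightarrow> c v < k"
  shows "free n (multipartite n c)"
  unfolding free_def
proof (intro conjI notI graph_rel_multipartite)
  assume "embeds VF A (multipartite n c) n"
  then obtain f where "f ` VF \<subseteq> {..<n}" "\<forall>x\<in>VF. \<forall>y\<in>VF. A x y \<longrightarrow> multipartite n c (f x) (f y)"
    by (auto simp: embeds_def)
  then have "colouring VF A k (c \<circ> f)"
    using assms by (auto simp: colouring_def multipartite_def)
  then show False
    using not_k_colourable by blast
qed

text \<open>A box of ordered cliques is a complete \<open>(k + 1)\<close>-partite graph with parts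
  of size \<open>card VF\<close>, which receives F along a proper colouring. Disjointness of the
  parts is not assumed: it follows from irreflexivity of \<open>E\<close>.\<close>

lemma box_embeds:
  assumes E: "graph_rel n E"
    and len: "length Q = Suc k"
    and Q: "\<And>i. i < Suc k \<Longrightarrow> Q ! i \<subseteq> {..<n} \<and> card (Q ! i) = card VF"
    and cl: "\<And>xs. xs \<in> listset Q \<Longrightarrow> sorted_wrt E xs"
  shows "embeds VF A E n"
proof -
  obtain p where p: "colouring VF A (Suc k) p"
    using Suc_k_colourable by blast
  have adj: "E a b" if ij: "i < j" "j < Suc k" and ab: "a \<in> Q ! i" "b \<in> Q ! j" for i j a b
  proof -
    \<comment> \<open>Arbitrary entries elsewhere complete \<open>a\<close> and \<open>b\<close> to
      a transversal, so their adjacency follows from \<open>cl\<close>.\<close>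
    define e where "e l = (SOME x. x \<in> Q ! l)" for l
    have e: "e l \<in> Q ! l" if "l < Suc k" for l
    proof -
      have "Q ! l \<noteq> {}"
        using Q[OF that] card_VF_pos by auto
      then show ?thesis
        by (simp add: e_def some_in_eq)
    qed
    define xs where "xs = map (\<lambda>l. if l = i then a else if l = j then b else e l) [0..<Suc k]"
    have nth: "xs ! l = (if l = i then a else if l = j then b else e l)" if "l < Suc k" for l
      using that nth_map[of l "[0..<Suc k]"] nth_upt[of 0 l "Suc k"] by (simp add: xs_def del: upt_Suc)
    have len': "length xs = Suc k"
      by (simp add: xs_def)
    have "xs \<in> listset Q"
      unfolding in_listset_iff list_all2_conv_all_nth
      using len len' ab e nth by auto
    then have "E (xs ! i) (xs ! j)"
      using cl[of xs] ij len' by (auto simp: sorted_wrt_iff_nth_less)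
    then show ?thesis
      using ij nth by simp
  qed
  have "\<exists>g. bij_betw g VF (Q ! i)" if "i < Suc k" for i
    using Q[OF that] finite_VF finite_subset[of "Q ! i" "{..<n}"]
    by (intro finite_same_card_bij) auto
  then obtain g where g: "\<And>i. i < Suc k \<Longrightarrow> bij_betw (g i) VF (Q ! i)"
    by metis
  define f where "f x = g (p x) x" for x
  have px: "p x < Suc k" if "x \<in> VF" for x
    using p that by (auto simp: colouring_def)
  have f: "f x \<in> Q ! p x" if "x \<in> VF" for x
    using g[OF px[OF that]] that by (auto simp: f_def bij_betw_def)
  have fE: "E (f x) (f y)" if "x \<in> VF" "y \<in> VF" "p x \<noteq> p y" for x y
  proof (cases "p x < p y")
    case True
    then show ?thesis
      using adj px f that by blast
  next
    case False
    then have "E (f y) (f x)"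
      using adj[of "p y" "p x"] px f that by auto
    then show ?thesis
      using graph_relD(1)[OF E] by blast
  qed
  have "inj_on f VF"
  proof (rule inj_onI)
    fix x y assume xy: "x \<in> VF" "y \<in> VF" "f x = f y"
    then have "p x = p y"
      using fE[of x y] graph_relD(4)[OF E, of "f x" "f y"] by auto
    then show "x = y"
      using xy g[OF px[of x]] by (auto simp: f_def bij_betw_def inj_on_def)
  qed
  moreover have "f ` VF \<subseteq> {..<n}"
    using f Q px by blast
  moreover have "\<forall>x\<in>VF. \<forall>y\<in>VF. A x y \<longrightarrow> E (f x) (f y)"
    using fE p by (auto simp: colouring_def)
  ultimately show ?thesis
    unfolding embeds_def by blast
qed

text \<open>Supersaturation for prescribed host sets. These may overlap, and each of them only has
  to exceed a constant; for rich vertices one host set is of bounded size.\<close>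

lemma dense_cliques_embed:
  fixes \<epsilon> :: real
  assumes "\<epsilon> > 0"
  shows "\<exists>N. \<forall>n E S. graph_rel n E \<longrightarrow> length S = Suc k \<longrightarrow>
           (\<forall>B\<in>set S. B \<subseteq> {..<n} \<and> N \<le> card B) \<longrightarrow>
           \<epsilon> * real (card (listset S)) \<le> real (card {xs\<in>listset S. sorted_wrt E xs}) \<longrightarrow>
           embeds VF A E n"
proof -
  obtain N where N: "\<forall>S. length S = Suc k \<longrightarrow> (\<forall>B\<in>set S. finite B \<and> N \<le> card B) \<longrightarrow>
      (\<forall>R\<subseteq>listset S. \<epsilon> * real (card (listset S)) \<le> real (card R) \<longrightarrow>
         (\<exists>Q. list_all2 (\<lambda>B C. B \<subseteq> C \<and> card B = card VF) Q S \<and> listset Q \<subseteq> (R :: nat list set)))"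
    using dense_relation_contains_box[OF assms, of "Suc k" "card VF"] by (rule exE)
  show ?thesis
  proof (intro exI[of _ N] allI impI)
    fix n E S
    assume *: "graph_rel n E" "length S = Suc k" "\<forall>B\<in>set S. B \<subseteq> {..<n} \<and> N \<le> card B"
      "\<epsilon> * real (card (listset S)) \<le> real (card {xs\<in>listset S. sorted_wrt E xs})"
    have fin: "\<forall>B\<in>set S. finite B \<and> N \<le> card B"
      using *(3) by (auto intro: finite_subset[OF _ finite_lessThan])
    have "{xs\<in>listset S. sorted_wrt E xs} \<subseteq> listset S"
      by blast
    from mp[OF spec[OF mp[OF mp[OF spec[OF N, of S] *(2)] fin]] this] *(4)
    obtain Q where Q: "list_all2 (\<lambda>B C. B \<subseteq> C \<and> card B = card VF) Q S"
        "listset Q \<subseteq> {xs\<in>listset S. sorted_wrt E xs}"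
      by blast
    show "embeds VF A E n"
    proof (rule box_embeds[OF *(1)])
      show "length Q = Suc k"
        using Q(1) *(2) by (simp add: list_all2_lengthD)
      show "Q ! i \<subseteq> {..<n} \<and> card (Q ! i) = card VF" if "i < Suc k" for i
      proof -
        have "Q ! i \<subseteq> S ! i" "card (Q ! i) = card VF"
          using list_all2_nthD2[OF Q(1), of i] that *(2) by auto
        moreover have "S ! i \<subseteq> {..<n}"
          using *(3) that *(2) nth_mem[of i S] by auto
        ultimately show ?thesis by blast
      qed
      show "sorted_wrt E xs" if "xs \<in> listset Q" for xs
        using Q(2) that by blast
    qed
  qed
qed

lemma free_few_cliques:
  fixes \<delta> :: real
  assumes "\<delta> > 0"
  shows "\<exists>N. \<forall>n\<ge>N. \<forall>E. free n E \<longrightarrow>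
           real (card (ordered_cliques E (Suc k) {..<n})) \<le> \<delta> * real n ^ Suc k"
proof -
  obtain N where N: "\<forall>n E S. graph_rel n E \<longrightarrow> length S = Suc k \<longrightarrow>
           (\<forall>B\<in>set S. B \<subseteq> {..<n} \<and> N \<le> card B) \<longrightarrow>
           \<delta> * real (card (listset S)) \<le> real (card {xs\<in>listset S. sorted_wrt E xs}) \<longrightarrow>
           embeds VF A E n"
    using dense_cliques_embed[OF assms] by (rule exE)
  show ?thesis
  proof (intro exI[of _ N] allI impI)
    fix n E
    assume n: "N \<le> n" and E: "free n E"
    define S where "S = replicate (Suc k) {..<n}"
    have "xs \<in> listset S \<longleftrightarrow> length xs = Suc k \<and> set xs \<subseteq> {..<n}" for xs
      unfolding in_listset_iff S_def list_all2_conv_all_nth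
      by (auto simp: set_conv_nth simp del: replicate_Suc)
    then have eq: "{xs\<in>listset S. sorted_wrt E xs} = ordered_cliques E (Suc k) {..<n}"
      by (auto simp: ordered_cliques_def)
    have card: "card (listset (replicate m {..<n})) = n ^ m" for m
      by (induction m) (auto simp: card_set_Cons)
    have "length S = Suc k" "\<forall>B\<in>set S. B \<subseteq> {..<n} \<and> N \<le> card B"
      using n by (auto simp: S_def)
    then have "\<not> \<delta> * real (card (listset S)) \<le> real (card {xs\<in>listset S. sorted_wrt E xs})"
      using spec[OF spec[OF spec[OF N, of n], of E], of S] E unfolding free_def by argo
    then show "real (card (ordered_cliques E (Suc k) {..<n})) \<le> \<delta> * real n ^ Suc k"
      unfolding eq card[of "Suc k", folded S_def] by simp
  qed
qed

text \<open>\<open>\<gamma>\<close> is chosen before \<open>\<epsilon>\<close>, since the part sizes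
  must not degrade when the tolerance shrinks.\<close>

lemma extremal_stability:
  assumes r: "r \<ge> 1"
  shows "\<exists>\<gamma>>0. \<forall>\<epsilon>>0. \<exists>N. \<forall>n\<ge>N. \<forall>E. extremal r n E \<longrightarrow>
           (\<exists>c X. (\<forall>v<n. c v < k) \<and> (\<forall>i<k. \<gamma> * real n \<le> real (card (part n c i))) \<and>
                  X \<subseteq> {..<n} \<and> real (card X) \<le> \<epsilon> * real n \<and>
                  (\<forall>v\<in>{..<n} - X. real (card {u\<in>{..<n}. c u \<noteq> c v \<and> \<not> E v u}) \<le> \<epsilon> * real n))"
proof -
  obtain \<gamma> K \<eta>0 where pos: "\<gamma> > 0" "K > 0" "\<eta>0 > 0" and stab:
    "\<And>\<eta> n E c X. 0 < \<eta> \<Longrightarrow> \<eta> \<le> \<eta>0 \<Longrightarrow> 2 * k \<le> n \<Longrightarrow> \<forall>u v. E u v \<longrightarrow> E v u \<Longrightarrow> \<forall>v<n. c v < k \<Longrightarrow>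
     X \<subseteq> {..<n} \<Longrightarrow> real (card X) \<le> \<eta> * real n \<Longrightarrow>
     \<forall>v\<in>{..<n} - X. real (card {u\<in>{..<n}. E v u \<and> c v \<le> c u})
                        \<le> real (card {u\<in>{..<n}. c v < c u}) + \<eta> * real n \<Longrightarrow>
     \<forall>c'. (\<forall>v<n. c' v < k) \<longrightarrow>
        (\<Sum>v<n. real (cross n c' v) ^ r) \<le> (\<Sum>v<n. real (vdeg E n v) ^ r) \<Longrightarrow>
     (\<forall>i<k. \<gamma> * real n \<le> real (card (part n c i))) \<and>
     real (\<Sum>v<n. card {u\<in>{..<n}. c u \<noteq> c v \<and> \<not> E v u}) \<le> K * \<eta> * (real n)\<^sup>2"
    using near_optimal_partition[OF k_ge_2 r] by (elim exE conjE) blast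
  show ?thesis
  proof (rule exI[of _ \<gamma>], rule conjI[OF pos(1)], intro allI impI)
    fix \<epsilon> :: real assume \<epsilon>: "\<epsilon> > 0"
    \<comment> \<open>With \<open>K * \<eta> \<le> \<epsilon>\<^sup>2\<close>, at most
      \<open>\<epsilon> * n\<close> vertices can miss more than \<open>\<epsilon> * n\<close> cross
      neighbours each.\<close>
    define \<eta> where "\<eta> = min \<eta>0 (\<epsilon>\<^sup>2 / K)"
    have \<eta>: "\<eta> > 0" "\<eta> \<le> \<eta>0" "K * \<eta> \<le> \<epsilon>\<^sup>2"
    proof -
      show "\<eta> > 0" "\<eta> \<le> \<eta>0"
        using pos \<epsilon> by (auto simp: \<eta>_def)
      have "\<eta> \<le> \<epsilon>\<^sup>2 / K" by (simp add: \<eta>_def)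
      then show "K * \<eta> \<le> \<epsilon>\<^sup>2"
        using pos by (simp add: field_simps)
    qed
    obtain \<delta> where \<delta>: "\<delta> > 0" and cliq: "\<And>E U n. finite U \<Longrightarrow> n > 0 \<Longrightarrow>
           real (card (ordered_cliques E (Suc k) U)) \<le> \<delta> * real n ^ Suc k \<Longrightarrow>
           (\<exists>c X. X \<subseteq> U \<and> real (card X) \<le> \<eta> * real n \<and>
                  (\<forall>v\<in>U. c v \<le> k) \<and> (\<forall>v\<in>U - X. c v < k) \<and>
                  (\<forall>v\<in>U - X. card {u\<in>U. E v u \<and> c v \<le> c u} \<le> card {u\<in>(U::nat set). c v < (c u :: nat)}))"
      using few_cliques_partition[OF \<eta>(1), of k] by (elim exE conjE) blast
    obtain N where N: "\<And>n E. n \<ge> N \<Longrightarrow> free n E \<Longrightarrow>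
           real (card (ordered_cliques E (Suc k) {..<n})) \<le> \<delta> * real n ^ Suc k"
      using free_few_cliques[OF \<delta>] by blast
    show "\<exists>N. \<forall>n\<ge>N. \<forall>E. extremal r n E \<longrightarrow>
           (\<exists>c X. (\<forall>v<n. c v < k) \<and> (\<forall>i<k. \<gamma> * real n \<le> real (card (part n c i))) \<and>
                  X \<subseteq> {..<n} \<and> real (card X) \<le> \<epsilon> * real n \<and>
                  (\<forall>v\<in>{..<n} - X. real (card {u\<in>{..<n}. c u \<noteq> c v \<and> \<not> E v u}) \<le> \<epsilon> * real n))"
    proof (intro exI[of _ "max N (2 * k)"] allI impI)
      fix n E assume n: "max N (2 * k) \<le> n" and E: "extremal r n E"
      have free: "free n E" and g: "graph_rel n E"
        using E by (auto simp: extremal_def free_def)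
      have n0: "n > 0" using n k_ge_2 by simp
      have nN: "N \<le> n" using n by simp
      obtain c0 X0 where X0: "X0 \<subseteq> {..<n}" "real (card X0) \<le> \<eta> * real n"
        and c0: "\<forall>v\<in>{..<n}. c0 v \<le> k" "\<forall>v\<in>{..<n} - X0. c0 v < k"
          "\<forall>v\<in>{..<n} - X0. card {u\<in>{..<n}. E v u \<and> c0 v \<le> c0 u} \<le> card {u\<in>{..<n}. c0 v < (c0 u :: nat)}"
        using cliq[OF finite_lessThan n0 N[OF nN free]] by (elim exE conjE) (rule that)
      \<comment> \<open>The surplus colour \<open>k\<close> occurs only on \<open>X0\<close> and is
        merged into the last class. Forward classes lose at most \<open>X0\<close> by this, which is
        the slack \<open>\<eta> * n\<close> in \<open>near_optimal_partition\<close>.\<close>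
      define c where "c v = min (c0 v) (k - 1)" for v
      define ms where "ms v = card {u\<in>{..<n}. c u \<noteq> c v \<and> \<not> E v u}" for v
      have ck: "\<forall>v<n. c v < k"
        using k_ge_2 by (auto simp: c_def)
      have finX0: "finite X0" using X0(1) finite_subset by blast
      have fwd: "real (card {u\<in>{..<n}. E v u \<and> c v \<le> c u}) \<le> real (card {u\<in>{..<n}. c v < c u}) + \<eta> * real n"
        if v: "v \<in> {..<n} - X0" for v
      proof -
        have "c0 v < k" using c0(2) v by blast
        then have "{u\<in>{..<n}. E v u \<and> c v \<le> c u} = {u\<in>{..<n}. E v u \<and> c0 v \<le> c0 u}"
          by (auto simp: c_def)
        moreover have "{u\<in>{..<n}. c0 v < c0 u} \<subseteq> {u\<in>{..<n}. c v < c u} \<union> X0"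
        proof
          fix u assume u: "u \<in> {u\<in>{..<n}. c0 v < c0 u}"
          show "u \<in> {u\<in>{..<n}. c v < c u} \<union> X0"
          proof (cases "u \<in> X0")
            case False
            then have "c0 u < k" using c0(2) u by blast
            then show ?thesis using u by (auto simp: c_def)
          qed simp
        qed
        then have "card {u\<in>{..<n}. c0 v < c0 u} \<le> card ({u\<in>{..<n}. c v < c u} \<union> X0)"
          using finX0 by (intro card_mono) auto
        moreover have "card ({u\<in>{..<n}. c v < c u} \<union> X0) \<le> card {u\<in>{..<n}. c v < c u} + card X0"
          by (rule card_Un_le)
        ultimately have "card {u\<in>{..<n}. E v u \<and> c v \<le> c u} \<le> card {u\<in>{..<n}. c v < c u} + card X0"
          using bspec[OF c0(3) v] by simp
        then have "real (card {u\<in>{..<n}. E v u \<and> c v \<le> c u}) \<le> real (card {u\<in>{..<n}. c v < c u}) + real (card X0)"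
          by (simp flip: of_nat_add)
        then show ?thesis using X0(2) by linarith
      qed
      have opt: "(\<Sum>v<n. real (cross n c' v) ^ r) \<le> (\<Sum>v<n. real (vdeg E n v) ^ r)"
        if "\<forall>v<n. c' v < k" for c'
      proof -
        have "(\<Sum>v<n. real (vdeg (multipartite n c') n v) ^ r) \<le> (\<Sum>v<n. real (vdeg E n v) ^ r)"
          using E free_multipartite[of n c'] that unfolding extremal_def by blast
        then show ?thesis by (simp add: vdeg_multipartite)
      qed
      have "(\<forall>i<k. \<gamma> * real n \<le> real (card (part n c i))) \<and> real (\<Sum>v<n. ms v) \<le> K * \<eta> * (real n)\<^sup>2"
        unfolding ms_def
        by (rule stab[where X = X0]) (use \<eta> n g X0 fwd opt ck in \<open>auto simp: graph_rel_def\<close>)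
      then have parts: "\<forall>i<k. \<gamma> * real n \<le> real (card (part n c i))"
        and ms: "(\<Sum>v<n. real (ms v)) \<le> K * \<eta> * (real n)\<^sup>2"
        by simp_all
      define X where "X = {v\<in>{..<n}. \<epsilon> * real n < real (ms v)}"
      have "real (card X) * (\<epsilon> * real n) \<le> (\<Sum>v\<in>X. real (ms v))"
        by (intro sum_bounded_below) (auto simp: X_def)
      also have "\<dots> \<le> (\<Sum>v<n. real (ms v))"
        by (intro sum_mono2) (auto simp: X_def)
      also have "\<dots> \<le> \<epsilon>\<^sup>2 * (real n)\<^sup>2"
        using ms mult_right_mono[OF \<eta>(3), of "(real n)\<^sup>2"] by simp
      also have "\<dots> = \<epsilon> * real n * (\<epsilon> * real n)"
        by (simp add: power2_eq_square)
      finally have "real (card X) \<le> \<epsilon> * real n"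
        by (rule mult_right_le_imp_le) (use \<epsilon> n0 in simp)
      moreover have "\<forall>v\<in>{..<n} - X. real (ms v) \<le> \<epsilon> * real n"
        by (auto simp: X_def)
      ultimately show "\<exists>c X. (\<forall>v<n. c v < k) \<and> (\<forall>i<k. \<gamma> * real n \<le> real (card (part n c i))) \<and>
                  X \<subseteq> {..<n} \<and> real (card X) \<le> \<epsilon> * real n \<and>
                  (\<forall>v\<in>{..<n} - X. real (card {u\<in>{..<n}. c u \<noteq> c v \<and> \<not> E v u}) \<le> \<epsilon> * real n)"
        using ck parts unfolding ms_def by (intro exI[of _ c] exI[of _ X]) (auto simp: X_def)
    qed
  qed
qed

end

section \<open>Replacing the neighbourhood of a vertex\<close>

lemma embedsI:
  assumes "inj_on f W" "\<And>x. x \<in> W \<Longrightarrow> f x < n"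
    and "\<And>x y. x \<in> W \<Longrightarrow> y \<in> W \<Longrightarrow> A x y \<Longrightarrow> E (f x) (f y)"
  shows "embeds W A E n"
  unfolding embeds_def using assms by (intro exI[of _ f]) auto

lemma embedsE:
  assumes "embeds W A E n"
  obtains f where "inj_on f W" "\<And>x. x \<in> W \<Longrightarrow> f x < n"
    "\<And>x y. x \<in> W \<Longrightarrow> y \<in> W \<Longrightarrow> A x y \<Longrightarrow> E (f x) (f y)"
proof -
  from assms obtain f where f: "inj_on f W \<and> f ` W \<subseteq> {..<n} \<and> (\<forall>x\<in>W. \<forall>y\<in>W. A x y \<longrightarrow> E (f x) (f y))"
    unfolding embeds_def by (rule exE)
  show thesis
    by (rule that[of f]) (use f in auto)
qed

context forbidden_graph
begin

text \<open>A copy of \<open>F\<close> through the modified vertex \<open>v\<close> can be rerouted through an unused vertex of \<open>W\<close>.\<close>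

lemma free_replace_vertex:
  assumes E: "free n E" and v: "v < n" and W: "W \<subseteq> {..<n}" "v \<notin> W" "card VF \<le> card W"
    and M: "M \<subseteq> {..<n} - {v}" "\<And>u w. u \<in> M \<Longrightarrow> w \<in> W \<Longrightarrow> E w u"
  shows "free n (\<lambda>a b. (a \<noteq> v \<and> b \<noteq> v \<and> E a b) \<or> (a = v \<and> b \<in> M) \<or> (b = v \<and> a \<in> M))"
    (is "free n ?E")
  unfolding free_def
proof (intro conjI notI)
  have g: "graph_rel n E"
    using E by (simp add: free_def)
  show "graph_rel n ?E"
    unfolding graph_rel_def
  proof (intro allI impI)
    fix a b assume "?E a b"
    then show "?E b a \<and> a < n \<and> b < n \<and> a \<noteq> b"
      using graph_relD[OF g, of a b] M(1) v by auto
  qed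
  assume "embeds VF A ?E n"
  then obtain f where f: "inj_on f VF" "\<And>x. x \<in> VF \<Longrightarrow> f x < n"
      "\<And>x y. x \<in> VF \<Longrightarrow> y \<in> VF \<Longrightarrow> A x y \<Longrightarrow> ?E (f x) (f y)"
    by (rule embedsE) (rule that)
  have "embeds VF A E n"
  proof (cases "v \<in> f ` VF")
    case False
    then have "E (f x) (f y)" if "x \<in> VF" "y \<in> VF" "A x y" for x y
      using f(3)[OF that] that by auto
    with f(1,2) show ?thesis
      by (rule embedsI)
  next
    case True
    then obtain y0 where y0: "y0 \<in> VF" "f y0 = v"
      by auto
    have "card (f ` (VF - {y0})) \<le> card (VF - {y0})"
      using finite_VF by (intro card_image_le) auto
    also have "\<dots> < card VF"
      using finite_VF y0(1) by (intro psubset_card_mono) auto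
    finally have "card (f ` (VF - {y0})) < card W"
      using W(3) by simp
    then have "\<not> W \<subseteq> f ` (VF - {y0})"
      using finite_VF card_mono[of "f ` (VF - {y0})" W] by auto
    then obtain w where w: "w \<in> W" "w \<notin> f ` (VF - {y0})"
      by blast
    define h where "h = f(y0 := w)"
    have "inj_on h VF"
      unfolding h_def using w(2) f(1) by (auto simp: inj_on_def)
    moreover have "h x < n" if "x \<in> VF" for x
      using f(2)[OF that] w(1) W(1) by (auto simp: h_def)
    moreover have "E (h x) (h y)" if xy: "x \<in> VF" "y \<in> VF" "A x y" for x y
    proof -
      have "x \<noteq> y" using A_irrefl xy(3) by auto
      have other: "f z \<noteq> v" if "z \<in> VF" "z \<noteq> y0" for z
        using f(1) y0 that by (auto simp: inj_on_def)
      consider "x = y0" "y \<noteq> y0" | "y = y0" "x \<noteq> y0" | "x \<noteq> y0" "y \<noteq> y0"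
        using \<open>x \<noteq> y\<close> by auto
      then show ?thesis
      proof cases
        case 1
        then have "f y \<in> M"
          using f(3)[OF xy] other[OF xy(2)] y0(2) M(1) by auto
        then show ?thesis
          using M(2) w(1) 1 by (simp add: h_def)
      next
        case 2
        then have "f x \<in> M"
          using f(3)[OF xy] other[OF xy(1)] y0(2) M(1) by auto
        then have "E w (f x)"
          using M(2) w(1) by simp
        then show ?thesis
          using graph_relD(1)[OF g] 2 by (simp add: h_def)
      next
        case 3
        then show ?thesis
          using f(3)[OF xy] other xy by (auto simp: h_def)
      qed
    qed
    ultimately show ?thesis
      by (rule embedsI)
  qed
  then show False
    using E by (simp add: free_def)
qed

text \<open>The modified graph is again free, so extremality compares the two power sums.
  \<open>g u\<close> is the value of the single edge from \<open>u\<close> to \<open>v\<close> at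
  the end \<open>u\<close>; its two bounds are all that is needed of it later.\<close>

lemma extremal_exchange:
  assumes E: "extremal r n E" and r: "r \<ge> 1" and v: "v < n"
    and W: "W \<subseteq> {..<n}" "v \<notin> W" "card VF \<le> card W"
    and M: "M \<subseteq> {..<n} - {v}" "\<And>u w. u \<in> M \<Longrightarrow> w \<in> W \<Longrightarrow> E w u"
  shows "\<exists>g. (\<forall>u<n. real (vdeg E n u) ^ (r - 1) \<le> g u \<and> g u \<le> real r * real n ^ (r - 1)) \<and>
           real (card M) ^ r + (\<Sum>u\<in>M. g u) \<le>
           real (vdeg E n v) ^ r + (\<Sum>u | u \<in> {..<n} \<and> E v u. g u)"
proof -
  define E' where "E' a b \<longleftrightarrow> (a \<noteq> v \<and> b \<noteq> v \<and> E a b) \<or> (a = v \<and> b \<in> M) \<or> (b = v \<and> a \<in> M)" for a b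
  have free: "free n E" and gr: "graph_rel n E"
    using E by (auto simp: extremal_def free_def)
  have "free n E'"
    using free_replace_vertex[OF free v W M] unfolding E'_def by simp
  then have le: "(\<Sum>u<n. real (vdeg E' n u) ^ r) \<le> (\<Sum>u<n. real (vdeg E n u) ^ r)"
    using E by (simp add: extremal_def)
  \<comment> \<open>The degree without \<open>v\<close>, which is the same in both graphs for
    \<open>u \<noteq> v\<close>; \<open>g\<close> is then the increment caused by one more
    neighbour.\<close>
  define d where "d u = card {w\<in>{..<n}. w \<noteq> v \<and> E u w}" for u
  define g where "g u = real (d u + 1) ^ r - real (d u) ^ r" for u
  have d_less: "d u + 1 \<le> n" for u
  proof -
    have "d u \<le> card ({..<n} - {v})"
      unfolding d_def by (intro card_mono) auto
    then show ?thesis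
      using v by simp
  qed
  have degE: "vdeg E n u = d u + (if E v u then 1 else 0)" for u
  proof -
    have "{w\<in>{..<n}. E u w} = {w\<in>{..<n}. w \<noteq> v \<and> E u w} \<union> (if E v u then {v} else {})"
      using v graph_relD(1)[OF gr] by auto
    then show ?thesis
      unfolding vdeg_def d_def by (auto simp: card_Un_disjoint)
  qed
  have degE': "vdeg E' n u = d u + (if u \<in> M then 1 else 0)" if "u \<noteq> v" for u
  proof -
    have "{w\<in>{..<n}. E' u w} = {w\<in>{..<n}. w \<noteq> v \<and> E u w} \<union> (if u \<in> M then {v} else {})"
      using v that by (auto simp: E'_def)
    then show ?thesis
      unfolding vdeg_def d_def by (auto simp: card_Un_disjoint)
  qed
  have "{w\<in>{..<n}. E' v w} = M"
    using M(1) by (auto simp: E'_def)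
  then have degv: "vdeg E' n v = card M"
    by (simp add: vdeg_def)
  have split: "(\<Sum>u<n. F u) = F v + (\<Sum>u\<in>{..<n} - {v}. F u)" for F :: "nat \<Rightarrow> real"
    using v by (simp add: sum.remove)
  have pow: "real (d u + (if P then 1 else 0)) ^ r = real (d u) ^ r + (if P then g u else 0)" for u P
    by (simp add: g_def add.commute)
  have "(\<Sum>u\<in>{..<n} - {v}. real (vdeg E' n u) ^ r) =
      (\<Sum>u\<in>{..<n} - {v}. real (d u) ^ r + (if u \<in> M then g u else 0))"
  proof (intro sum.cong refl)
    fix u assume "u \<in> {..<n} - {v}"
    then have "u \<noteq> v" by simp
    show "real (vdeg E' n u) ^ r = real (d u) ^ r + (if u \<in> M then g u else 0)"
      unfolding degE'[OF \<open>u \<noteq> v\<close>] pow ..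
  qed
  also have "\<dots> = (\<Sum>u\<in>{..<n} - {v}. real (d u) ^ r) + (\<Sum>u\<in>M. g u)"
    using M(1) by (simp add: sum.distrib sum.If_cases Int_absorb1)
  finally have E'sum: "(\<Sum>u\<in>{..<n} - {v}. real (vdeg E' n u) ^ r) = \<dots>" .
  have nb: "({..<n} - {v}) \<inter> {u. E v u} = {u. u \<in> {..<n} \<and> E v u}"
    using graph_relD(4)[OF gr] by auto
  have "(\<Sum>u\<in>{..<n} - {v}. real (vdeg E n u) ^ r) =
      (\<Sum>u\<in>{..<n} - {v}. real (d u) ^ r + (if E v u then g u else 0))"
    by (intro sum.cong refl) (simp only: degE pow)
  also have "\<dots> = (\<Sum>u\<in>{..<n} - {v}. real (d u) ^ r) + (\<Sum>u | u \<in> {..<n} \<and> E v u. g u)"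
    by (simp only: sum.distrib sum.If_cases[OF finite_Diff[OF finite_lessThan]] nb) simp
  finally have "real (card M) ^ r + (\<Sum>u\<in>M. g u) \<le>
      real (vdeg E n v) ^ r + (\<Sum>u | u \<in> {..<n} \<and> E v u. g u)"
    using le E'sum unfolding split degv by linarith
  moreover have "real (vdeg E n u) ^ (r - 1) \<le> g u" for u
  proof -
    have "real (vdeg E n u) ^ (r - 1) \<le> real (d u + 1) ^ (r - 1)"
      by (intro power_mono) (auto simp: degE)
    then show ?thesis
      using power_diff_ge[of "real (d u)" "real (d u + 1)" r] r by (simp add: g_def)
  qed
  moreover have "g u \<le> real r * real n ^ (r - 1)" for u
  proof -
    have "real (d u + 1) \<le> real n"
      using d_less[of u] by (simp only: of_nat_le_iff)
    then show ?thesis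
      using power_diff_le[of "real (d u)" "real (d u + 1)" "real n" r] by (simp add: g_def)
  qed
  ultimately show ?thesis
    by (intro exI[of _ g]) auto
qed

section \<open>Typical partitions and sparse parts\<close>

definition typical_partition where
  "typical_partition \<gamma> \<epsilon> n E c X \<longleftrightarrow>
     (\<forall>v<n. c v < k) \<and> (\<forall>i<k. \<gamma> * real n \<le> real (card (part n c i))) \<and>
     X \<subseteq> {..<n} \<and> real (card X) \<le> \<epsilon> * real n \<and>
     (\<forall>v\<in>{..<n} - X. real (card {u\<in>{..<n}. c u \<noteq> c v \<and> \<not> E v u}) \<le> \<epsilon> * real n)"

lemma card_part_minus_exceptional:
  assumes "typical_partition \<gamma> \<epsilon> n E c X" "i < k"
  shows "(\<gamma> - \<epsilon>) * real n \<le> real (card (part n c i - X))"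
proof -
  have "finite X"
    using assms(1) finite_subset[of X "{..<n}"] by (auto simp: typical_partition_def)
  then have "card (part n c i) - card X \<le> card (part n c i - X)"
    by (intro diff_card_le_card_Diff)
  then have "real (card (part n c i)) - real (card X) \<le> real (card (part n c i - X))"
    by linarith
  moreover have "\<gamma> * real n \<le> real (card (part n c i))" "real (card X) \<le> \<epsilon> * real n"
    using assms by (auto simp: typical_partition_def)
  ultimately show ?thesis
    by (simp add: algebra_simps)
qed

text \<open>Exchange the neighbourhood of \<open>v\<close> for the common neighbourhood
  \<open>M\<close> of \<open>card VF\<close> typical vertices of part \<open>j\<close>. Since
  \<open>v\<close> has few neighbours in part \<open>j\<close> and \<open>M\<close> covers almost
  everything outside it, the exchange loses only \<open>O(\<epsilon>1 * n ^ r)\<close>. Every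
  typical vertex of \<open>M\<close> not adjacent to \<open>v\<close> would gain order
  \<open>n ^ (r - 1)\<close>, so by extremality there are only \<open>O(\<epsilon>1 * n)\<close> of
  them. Nothing is assumed about the part in which \<open>v\<close> itself lies.\<close>

lemma missing_outside_sparse_part:
  fixes \<gamma> \<epsilon> \<epsilon>1 :: real and r n :: nat
  defines "K \<equiv> real (card VF) + 2 + real r * (2 * real (card VF) + 4) * (2 / \<gamma>) ^ (r - 1)"
  assumes E: "extremal r n E" and r: "r \<ge> 1" and tp: "typical_partition \<gamma> \<epsilon> n E c X"
    and \<gamma>: "\<gamma> > 0" and \<epsilon>: "\<epsilon> \<le> \<epsilon>1" "2 * \<epsilon> \<le> \<gamma>" and n: "1 \<le> \<epsilon>1 * real n" "real (card VF) + 1 \<le> \<gamma> / 2 * real n"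
    and v: "v < n" and j: "j < k" and sparse: "real (card {u\<in>part n c j. E v u}) \<le> \<epsilon>1 * real n"
  shows "real (card {u\<in>{..<n}. c u \<noteq> j \<and> \<not> E v u}) \<le> K * \<epsilon>1 * real n"
proof -
  define f where "f = card VF"
  have X: "X \<subseteq> {..<n}" "finite X" "real (card X) \<le> \<epsilon> * real n"
    and miss: "\<And>w. w < n \<Longrightarrow> w \<notin> X \<Longrightarrow> real (card {u\<in>{..<n}. c u \<noteq> c w \<and> \<not> E w u}) \<le> \<epsilon> * real n"
    and parts: "\<And>i. i < k \<Longrightarrow> \<gamma> * real n \<le> real (card (part n c i))"
    using tp finite_subset[of X "{..<n}"] by (auto simp: typical_partition_def)
  have n0: "real n > 0"
    using v by simp
  have \<epsilon>n: "\<epsilon> * real n \<le> \<epsilon>1 * real n" "\<epsilon> * real n \<le> \<gamma> / 2 * real n"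
    using \<epsilon> n0 by auto
  have gr: "graph_rel n E"
    using E by (auto simp: extremal_def free_def)
  have "card (part n c j - X) - card {v} \<le> card (part n c j - X - {v})"
    by (intro diff_card_le_card_Diff) auto
  then have "real (card (part n c j - X)) - 1 \<le> real (card (part n c j - X - {v}))"
    by simp
  moreover have "\<gamma> / 2 * real n \<le> (\<gamma> - \<epsilon>) * real n"
    using \<epsilon>n by (simp add: left_diff_distrib)
  ultimately have "real f \<le> real (card (part n c j - X - {v}))"
    using card_part_minus_exceptional[OF tp j] n(2) unfolding f_def by linarith
  then obtain W where W: "W \<subseteq> part n c j - X - {v}" "card W = f" "finite W"
    by (meson obtain_subset_with_card_n of_nat_le_iff)
  \<comment> \<open>\<open>P\<close> and \<open>Q\<close> are the neighbours of \<open>v\<close>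
    outside and inside part \<open>j\<close>; \<open>M - P\<close> is what the exchange adds,
    \<open>P - M\<close> and \<open>Q\<close> what it gives up.\<close>
  define Z where "Z = {u\<in>{..<n}. c u \<noteq> j}"
  define M where "M = {u\<in>Z. u \<noteq> v \<and> (\<forall>w\<in>W. E w u)}"
  define P where "P = {u\<in>Z. E v u}"
  define Q where "Q = {u\<in>part n c j. E v u}"
  have fin: "finite Z" "finite M" "finite P" "finite Q"
    by (auto simp: Z_def M_def P_def Q_def)
  have ZM: "real (card (Z - M)) \<le> (real f + 1) * (\<epsilon>1 * real n)"
  proof -
    have "Z - M \<subseteq> {v} \<union> (\<Union>w\<in>W. {u\<in>{..<n}. c u \<noteq> c w \<and> \<not> E w u})"
      using W(1) by (auto simp: Z_def M_def part_def)
    then have "card (Z - M) \<le> card ({v} \<union> (\<Union>w\<in>W. {u\<in>{..<n}. c u \<noteq> c w \<and> \<not> E w u}))"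
      using W(3) by (intro card_mono) auto
    also have "\<dots> \<le> card {v} + card (\<Union>w\<in>W. {u\<in>{..<n}. c u \<noteq> c w \<and> \<not> E w u})"
      by (rule card_Un_le)
    also have "card (\<Union>w\<in>W. {u\<in>{..<n}. c u \<noteq> c w \<and> \<not> E w u}) \<le>
        (\<Sum>w\<in>W. card {u\<in>{..<n}. c u \<noteq> c w \<and> \<not> E w u})"
      using W(3) by (rule card_UN_le)
    finally have "real (card (Z - M)) \<le> 1 + (\<Sum>w\<in>W. real (card {u\<in>{..<n}. c u \<noteq> c w \<and> \<not> E w u}))"
      by (simp flip: of_nat_sum)
    also have "(\<Sum>w\<in>W. real (card {u\<in>{..<n}. c u \<noteq> c w \<and> \<not> E w u})) \<le> real f * (\<epsilon> * real n)"
      unfolding W(2)[symmetric]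
      using W(1) miss by (intro sum_bounded_above) (auto simp: part_def)
    also have "\<dots> \<le> real f * (\<epsilon>1 * real n)"
      using \<epsilon>n by (intro mult_left_mono) auto
    finally show ?thesis
      using n(1) by (simp add: algebra_simps)
  qed
  have "W \<subseteq> {..<n}" "v \<notin> W" "card VF \<le> card W"
    using W by (auto simp: part_def f_def)
  moreover have "M \<subseteq> {..<n} - {v}" "\<And>u w. u \<in> M \<Longrightarrow> w \<in> W \<Longrightarrow> E w u"
    by (auto simp: M_def Z_def)
  ultimately obtain g where g: "\<forall>u<n. real (vdeg E n u) ^ (r - 1) \<le> g u \<and> g u \<le> real r * real n ^ (r - 1)"
    and gain: "real (card M) ^ r + (\<Sum>u\<in>M. g u) \<le>
           real (vdeg E n v) ^ r + (\<Sum>u | u \<in> {..<n} \<and> E v u. g u)"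
    using extremal_exchange[OF E r v] by blast
  have nbh: "{u. u \<in> {..<n} \<and> E v u} = P \<union> Q" "P \<inter> Q = {}"
    by (auto simp: P_def Q_def Z_def part_def)
  have g_le: "(\<Sum>u\<in>S. g u) \<le> t * real n * (real r * real n ^ (r - 1))"
    if S: "S \<subseteq> {..<n}" "real (card S) \<le> t * real n" for S t
  proof -
    have "(\<Sum>u\<in>S. g u) \<le> real (card S) * (real r * real n ^ (r - 1))"
      using g S(1) by (intro sum_bounded_above) auto
    also have "\<dots> \<le> t * real n * (real r * real n ^ (r - 1))"
      using S(2) by (intro mult_right_mono) auto
    finally show ?thesis .
  qed
  have ZM': "real (card (P - M)) \<le> ((real f + 1) * \<epsilon>1) * real n"
  proof -
    have "card (P - M) \<le> card (Z - M)"
      using fin by (intro card_mono) (auto simp: P_def)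
    then show ?thesis
      using ZM by (simp add: mult.assoc)
  qed
  define p where "p = real r * real n ^ (r - 1) * real n"
  have PM: "(\<Sum>u\<in>P - M. g u) \<le> (real f + 1) * \<epsilon>1 * p"
    using g_le[of "P - M" "(real f + 1) * \<epsilon>1"] ZM' by (auto simp: P_def Z_def p_def mult_ac)
  have Qg: "(\<Sum>u\<in>Q. g u) \<le> \<epsilon>1 * p"
    using g_le[of Q \<epsilon>1] sparse by (auto simp: Q_def part_def p_def mult_ac)
  have dpow: "real (vdeg E n v) ^ r - real (card M) ^ r \<le> (real f + 2) * \<epsilon>1 * p"
  proof (cases "card M \<le> vdeg E n v")
    case True
    have "card P \<le> card (M \<union> (Z - M))"
      using fin by (intro card_mono) (auto simp: P_def)
    also have "\<dots> \<le> card M + card (Z - M)"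
      by (rule card_Un_le)
    finally have "real (card P) \<le> real (card M) + real (card (Z - M))"
      by simp
    moreover have "vdeg E n v = card P + card Q"
      unfolding vdeg_def using nbh fin by (simp add: card_Un_disjoint)
    ultimately have "real (vdeg E n v) - real (card M) \<le> (real f + 2) * \<epsilon>1 * real n"
      using ZM sparse unfolding Q_def by (simp add: algebra_simps)
    have "real (vdeg E n v) ^ r - real (card M) ^ r \<le>
        real r * (real (vdeg E n v) - real (card M)) * real n ^ (r - 1)"
      using True vdeg_le by (intro power_diff_le) auto
    also have "\<dots> \<le> real r * ((real f + 2) * \<epsilon>1 * real n) * real n ^ (r - 1)"
      using \<open>real (vdeg E n v) - real (card M) \<le> _\<close>
      by (intro mult_right_mono mult_left_mono) auto
    finally show ?thesis
      by (simp add: p_def mult_ac)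
  next
    case False
    then have "real (vdeg E n v) ^ r \<le> real (card M) ^ r"
      by (intro power_mono) auto
    moreover have "\<epsilon>1 > 0"
      using n n0 by (smt (verit) mult_nonpos_nonneg)
    then have "(real f + 2) * \<epsilon>1 * p \<ge> 0"
      by (simp add: p_def)
    ultimately show ?thesis by linarith
  qed
  have "(\<Sum>u\<in>M. g u) = (\<Sum>u\<in>M - P. g u) + (\<Sum>u\<in>M \<inter> P. g u)"
    "(\<Sum>u\<in>P. g u) = (\<Sum>u\<in>P - M. g u) + (\<Sum>u\<in>M \<inter> P. g u)"
    using sum.Int_Diff[OF fin(2), of g P] sum.Int_Diff[OF fin(3), of g M]
    by (simp_all add: Int_commute)
  moreover have "(\<Sum>u | u \<in> {..<n} \<and> E v u. g u) = (\<Sum>u\<in>P. g u) + (\<Sum>u\<in>Q. g u)"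
    unfolding nbh(1) using fin nbh(2) by (intro sum.union_disjoint) auto
  \<comment> \<open>The three terms are the loss at \<open>v\<close> itself, at its neighbours
    outside part \<open>j\<close> that are not in \<open>M\<close>, and at its neighbours inside
    part \<open>j\<close>.\<close>
  ultimately have "(\<Sum>u\<in>M - P. g u) \<le> (real f + 2) * \<epsilon>1 * p + (real f + 1) * \<epsilon>1 * p + \<epsilon>1 * p"
    using gain dpow PM Qg by linarith
  then have MP: "(\<Sum>u\<in>M - P. g u) \<le> (2 * real f + 4) * \<epsilon>1 * p"
    by (simp add: algebra_simps)
  have g0: "g u \<ge> 0" if "u < n" for u
    using g that by (meson of_nat_0_le_iff order_trans zero_le_power)
  \<comment> \<open>Typical vertices have linear degree, so \<open>g\<close> has order
    \<open>n ^ (r - 1)\<close> on them; the vertices of \<open>X\<close> are counted separately in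
    the end.\<close>
  have deg_ge: "\<gamma> / 2 * real n \<le> real (vdeg E n u)" if u: "u < n" "u \<notin> X" for u
  proof -
    have "cross n c u \<le> vdeg E n u + card {w\<in>{..<n}. c w \<noteq> c u \<and> \<not> E u w}"
      unfolding cross_def vdeg_def
      by (rule order.trans[OF _ card_Un_le]) (auto intro!: card_mono)
    then have "real (cross n c u) \<le> real (vdeg E n u) + real (card {w\<in>{..<n}. c w \<noteq> c u \<and> \<not> E u w})"
      by (simp flip: of_nat_add)
    moreover have "\<gamma> * real n \<le> real (cross n c u)"
      using cross_ge[OF k_ge_2 parts] by simp
    ultimately show ?thesis
      using miss[OF u] \<epsilon>n(2) by (simp add: field_simps)
  qed
  have "real (card (M - P - X)) * (\<gamma> / 2 * real n) ^ (r - 1) \<le> (\<Sum>u\<in>M - P - X. g u)"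
  proof (rule sum_bounded_below)
    fix u assume "u \<in> M - P - X"
    then have u: "u < n" "u \<notin> X"
      by (auto simp: M_def Z_def)
    have "(\<gamma> / 2 * real n) ^ (r - 1) \<le> real (vdeg E n u) ^ (r - 1)"
      using deg_ge[OF u] \<gamma> by (intro power_mono) auto
    then show "(\<gamma> / 2 * real n) ^ (r - 1) \<le> g u"
      using g u by force
  qed
  also have "\<dots> \<le> (\<Sum>u\<in>M - P. g u)"
    using fin g0 by (intro sum_mono2) (auto simp: M_def Z_def)
  also note MP
  also have "(2 * real f + 4) * \<epsilon>1 * p =
      real r * (2 * real f + 4) * (2 / \<gamma>) ^ (r - 1) * \<epsilon>1 * real n * (\<gamma> / 2 * real n) ^ (r - 1)"
    using \<gamma> by (simp add: p_def power_mult_distrib power_divide)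
  finally have MPX: "real (card (M - P - X)) \<le> real r * (2 * real f + 4) * (2 / \<gamma>) ^ (r - 1) * \<epsilon>1 * real n"
    by (rule mult_right_le_imp_le) (use \<gamma> n0 in simp)
  have "card {u\<in>{..<n}. c u \<noteq> j \<and> \<not> E v u} \<le> card ((Z - M) \<union> (M - P - X) \<union> X)"
    using fin X(2) by (intro card_mono) (auto simp: Z_def P_def)
  also have "\<dots> \<le> card (Z - M) + card (M - P - X) + card X"
    by (rule order.trans[OF card_Un_le add_right_mono[OF card_Un_le]])
  finally have "real (card {u\<in>{..<n}. c u \<noteq> j \<and> \<not> E v u}) \<le>
      real (card (Z - M)) + real (card (M - P - X)) + real (card X)"
    by (simp flip: of_nat_add)
  also have "\<dots> \<le> (real f + 1) * (\<epsilon>1 * real n)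
      + real r * (2 * real f + 4) * (2 / \<gamma>) ^ (r - 1) * \<epsilon>1 * real n + \<epsilon>1 * real n"
    using ZM MPX X(3) \<epsilon>n(1) by linarith
  also have "\<dots> = K * \<epsilon>1 * real n"
    by (simp add: K_def f_def algebra_simps)
  finally show ?thesis .
qed

end

section \<open>Greedy embedding and rich vertices\<close>

text \<open>Choosing an entry and restricting the later sets to its neighbours costs at most
  \<open>\<mu>\<close> elements per set. The reserve \<open>m * \<mu>\<close> leaves at least
  \<open>L\<close> choices at each of the \<open>m\<close> steps.\<close>

lemma greedy_clique_count:
  fixes L \<mu> :: real
  assumes "0 \<le> L" "0 \<le> \<mu>" and "length S = m" and "\<And>B. B \<in> set S \<Longrightarrow> finite B"
    and "\<And>B. B \<in> set S \<Longrightarrow> L + real m * \<mu> \<le> real (card B)"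
    and "sorted_wrt (\<lambda>B C. \<forall>x\<in>B. real (card {u\<in>C. \<not> E x u}) \<le> \<mu>) S"
  shows "L ^ m \<le> real (card {xs\<in>listset S. sorted_wrt E xs})"
  using assms(3-)
proof (induction m arbitrary: S)
  case 0
  then have "{xs\<in>listset S. sorted_wrt E xs} = {[]}"
    by auto
  then show ?case by simp
next
  case (Suc m)
  then obtain B T where S: "S = B # T" "length T = m"
    by (cases S) auto
  define N where "N x = map (\<lambda>C. {u\<in>C. E x u}) T" for x
  define R where "R = {xs\<in>listset S. sorted_wrt E xs}"
  have fin: "finite B" "\<And>C. C \<in> set T \<Longrightarrow> finite C" "finite (listset T)"
    using Suc.prems(2) by (auto simp: S intro!: finite_listset)
  have IH: "L ^ m \<le> real (card {xs\<in>listset T. x # xs \<in> R})" if x: "x \<in> B" for x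
  proof -
    have "L ^ m \<le> real (card {xs\<in>listset (N x). sorted_wrt E xs})"
    proof (rule Suc.IH)
      show "length (N x) = m"
        by (simp add: N_def S)
      show "finite C" if "C \<in> set (N x)" for C
        using that fin(2) by (auto simp: N_def)
      show "L + real m * \<mu> \<le> real (card C')" if C': "C' \<in> set (N x)" for C'
      proof -
        obtain C where C: "C \<in> set T" "C' = {u\<in>C. E x u}"
          using C' by (auto simp: N_def)
        have "card C = card {u\<in>C. E x u} + card {u\<in>C. \<not> E x u}"
          using card_filter_split[of C "\<lambda>_. True" "E x"] C(1) fin(2) by simp
        moreover have "real (card {u\<in>C. \<not> E x u}) \<le> \<mu>"
          using Suc.prems(4) C(1) x by (simp add: S)
        moreover have "L + (real m + 1) * \<mu> \<le> real (card C)"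
          using Suc.prems(3)[of C] C(1) by (simp add: S add.commute)
        ultimately show ?thesis
          by (simp add: C(2) algebra_simps)
      qed
      have "sorted_wrt (\<lambda>B C. \<forall>x\<in>B. real (card {u\<in>C. \<not> E x u}) \<le> \<mu>) T"
        using Suc.prems(4) by (simp add: S)
      then show "sorted_wrt (\<lambda>B C. \<forall>x\<in>B. real (card {u\<in>C. \<not> E x u}) \<le> \<mu>) (N x)"
        unfolding N_def sorted_wrt_map
      proof (rule sorted_wrt_mono_rel[rotated], intro ballI)
        fix B' C y
        assume *: "C \<in> set T" "\<forall>x\<in>B'. real (card {u\<in>C. \<not> E x u}) \<le> \<mu>" "y \<in> {u\<in>B'. E x u}"
        have "card {u\<in>{u\<in>C. E x u}. \<not> E y u} \<le> card {u\<in>C. \<not> E y u}"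
          using fin(2)[OF *(1)] by (intro card_mono) auto
        then have "real (card {u\<in>{u\<in>C. E x u}. \<not> E y u}) \<le> real (card {u\<in>C. \<not> E y u})"
          by simp
        also have "\<dots> \<le> \<mu>"
          using * by simp
        finally show "real (card {u\<in>{u\<in>C. E x u}. \<not> E y u}) \<le> \<mu>" .
      qed
    qed
    moreover have "{xs\<in>listset (N x). sorted_wrt E xs} \<subseteq> {xs\<in>listset T. x # xs \<in> R}"
    proof
      fix xs assume "xs \<in> {xs\<in>listset (N x). sorted_wrt E xs}"
      then have xs: "list_all2 (\<in>) xs (N x)" "sorted_wrt E xs"
        by (auto simp: in_listset_iff)
      have "list_all2 (\<in>) xs T"
        using xs(1) unfolding N_def list_all2_map2 by (rule list_all2_mono) auto
      moreover have "E x y" if "y \<in> set xs" for y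
      proof -
        obtain i where "i < length xs" "y = xs ! i"
          using \<open>y \<in> set xs\<close> by (auto simp: in_set_conv_nth)
        then show ?thesis
          using list_all2_nthD[OF xs(1), of i] list_all2_lengthD[OF xs(1)] by (auto simp: N_def)
      qed
      ultimately show "xs \<in> {xs\<in>listset T. x # xs \<in> R}"
        using xs(2) x by (auto simp: R_def S in_listset_iff simp del: listset.simps)
    qed
    then have "card {xs\<in>listset (N x). sorted_wrt E xs} \<le> card {xs\<in>listset T. x # xs \<in> R}"
      using fin(3) by (intro card_mono) auto
    ultimately show ?thesis
      by linarith
  qed
  have "L \<le> L + real (Suc m) * \<mu>"
    using assms(2) by simp
  also have "\<dots> \<le> real (card B)"
    using Suc.prems(3)[of B] by (simp add: S)
  finally have "L * L ^ m \<le> real (card B) * L ^ m"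
    using assms(1) by (intro mult_right_mono) auto
  also have "\<dots> \<le> (\<Sum>x\<in>B. real (card {xs\<in>listset T. x # xs \<in> R}))"
    using IH by (rule sum_bounded_below)
  also have "\<dots> = real (card R)"
    using card_eq_sum_heads[OF fin(1,3), of R] by (simp add: R_def S)
  finally show ?case
    by (simp add: R_def)
qed

text \<open>Applied to an optimal colouring it shows that members of the decomposition family have
  edges; applied after deletion of one vertex it deals with stars.\<close>

lemma merge_colour_classes:
  assumes p: "colouring W A (Suc k) p" and ij: "i < Suc k" "j < Suc k" "i \<noteq> j"
    and no_edge: "\<And>x y. x \<in> W \<Longrightarrow> y \<in> W \<Longrightarrow> p x = i \<or> p x = j \<Longrightarrow> p y = i \<or> p y = j \<Longrightarrow> \<not> A x y"
  shows "\<exists>q. colouring W A k q"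
proof -
  \<comment> \<open>\<open>h\<close> moves class \<open>j\<close> into class \<open>i\<close>, and
    \<open>g\<close> reuses the vacant colour \<open>j\<close> for the last class
    \<open>k\<close>.\<close>
  define h where "h m = (if m = j then i else m)" for m
  define g where "g m = (if m = k then j else m)" for m
  have g: "g a < k" "g a = g b \<longleftrightarrow> a = b" if "a < Suc k" "b < Suc k" "a \<noteq> j" "b \<noteq> j" for a b
    using that ij by (auto simp: g_def)
  have "colouring W A k (\<lambda>x. g (h (p x)))"
    unfolding colouring_def
  proof (intro conjI ballI impI)
    fix x assume "x \<in> W"
    then show "g (h (p x)) < k"
      using p ij by (intro g(1)[of _ "h (p x)"]) (auto simp: h_def colouring_def)
  next
    fix x y assume xy: "x \<in> W" "y \<in> W" "A x y"
    then have "p x < Suc k" "p y < Suc k" "p x \<noteq> p y"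
      using p by (auto simp: colouring_def)
    moreover have "h (p x) \<noteq> h (p y)"
      using no_edge[OF xy(1,2)] xy(3) calculation by (auto simp: h_def split: if_splits)
    ultimately show "g (h (p x)) \<noteq> g (h (p y))"
      using g(2)[of "h (p x)" "h (p y)"] ij by (auto simp: h_def)
  qed
  then show ?thesis by blast
qed

context forbidden_graph
begin

text \<open>Each placed vertex rules out at most \<open>\<mu>\<close> candidates as non-neighbours
  and one more as already used, and fewer than \<open>card VF\<close> vertices are placed before
  each choice. The candidate sets may overlap.\<close>

lemma greedy_embedding:
  fixes \<mu> :: real
  assumes E: "graph_rel n E" and Z: "Z \<subseteq> VF"
    and e: "inj_on e Z" "\<And>z. z \<in> Z \<Longrightarrow> e z < n"
      "\<And>x y. x \<in> Z \<Longrightarrow> y \<in> Z \<Longrightarrow> A x y \<Longrightarrow> E (e x) (e y)"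
    and S: "\<And>y. y \<in> VF - Z \<Longrightarrow> S y \<subseteq> {..<n}"
      "\<And>y. y \<in> VF - Z \<Longrightarrow> real (card VF) * (\<mu> + 1) \<le> real (card (S y))"
    and \<mu>: "0 \<le> \<mu>"
    and old: "\<And>z y. z \<in> Z \<Longrightarrow> y \<in> VF - Z \<Longrightarrow> A z y \<Longrightarrow> real (card {u\<in>S y. \<not> E (e z) u}) \<le> \<mu>"
    and new: "\<And>x y w. x \<in> VF - Z \<Longrightarrow> y \<in> VF - Z \<Longrightarrow> A x y \<Longrightarrow> w \<in> S x \<Longrightarrow>
        real (card {u\<in>S y. \<not> E w u}) \<le> \<mu>"
  shows "embeds VF A E n"
proof -
  have finD: "finite (VF - Z)" using finite_VF by simp
  have "\<exists>f. inj_on f (Z \<union> D) \<and> (\<forall>z\<in>Z. f z = e z) \<and> (\<forall>y\<in>D. f y \<in> S y) \<and>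
        (\<forall>x\<in>Z \<union> D. \<forall>y\<in>Z \<union> D. A x y \<longrightarrow> E (f x) (f y))"
    if "D \<subseteq> VF - Z" for D
    using finite_subset[OF that finD] that
  proof (induction D rule: finite_induct)
    case empty
    then show ?case
      using e by (intro exI[of _ e]) auto
  next
    case (insert y D)
    have D: "D \<subseteq> VF - Z"
      using insert.prems by simp
    from insert.IH[OF D] obtain f where f: "inj_on f (Z \<union> D)" "\<forall>z\<in>Z. f z = e z" "\<forall>y\<in>D. f y \<in> S y"
        "\<forall>x\<in>Z \<union> D. \<forall>y\<in>Z \<union> D. A x y \<longrightarrow> E (f x) (f y)"
      by (elim exE conjE) (rule that)
    have y: "y \<in> VF - Z" "y \<notin> Z \<union> D"
      using insert.prems insert.hyps by auto
    have finZD: "finite (Z \<union> D)"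
      using finite_VF Z D by (meson Diff_subset Un_least finite_subset subset_trans)
    define C where "C = {x\<in>Z \<union> D. A x y}"
    have miss: "real (card {u\<in>S y. \<not> E (f x) u}) \<le> \<mu>" if "x \<in> C" for x
    proof (cases "x \<in> Z")
      case True
      then show ?thesis
        using old[OF True y(1)] f(2) that by (simp add: C_def)
    next
      case False
      then have "x \<in> D" "A x y" using that by (auto simp: C_def)
      then show ?thesis
        using new[of x y "f x"] f(3) y(1) D by auto
    qed
    have finC: "finite C" using finZD by (simp add: C_def)
    define bad where "bad = (\<Union>x\<in>C. {u\<in>S y. \<not> E (f x) u}) \<union> f ` (Z \<union> D)"
    have finS: "finite (S y)"
      using S(1)[OF y(1)] finite_subset by blast
    have "card bad \<le> card (\<Union>x\<in>C. {u\<in>S y. \<not> E (f x) u}) + card (f ` (Z \<union> D))"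
      unfolding bad_def by (rule card_Un_le)
    also have "\<dots> \<le> (\<Sum>x\<in>C. card {u\<in>S y. \<not> E (f x) u}) + card (Z \<union> D)"
      using finC finZD by (intro add_mono card_UN_le card_image_le)
    finally have "real (card bad) \<le> (\<Sum>x\<in>C. real (card {u\<in>S y. \<not> E (f x) u})) + real (card (Z \<union> D))"
      by (simp flip: of_nat_sum of_nat_add)
    also have "(\<Sum>x\<in>C. real (card {u\<in>S y. \<not> E (f x) u})) \<le> real (card C) * \<mu>"
      using miss by (intro sum_bounded_above) auto
    also have "\<dots> \<le> real (card (Z \<union> D)) * \<mu>"
      using finZD \<mu> by (intro mult_right_mono) (auto simp: C_def intro!: card_mono)
    finally have "real (card bad) \<le> real (card (Z \<union> D)) * (\<mu> + 1)"
      by (simp add: algebra_simps)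
    also have "\<dots> < real (card VF) * (\<mu> + 1)"
    proof -
      have "card (Z \<union> D) < card VF"
        using finite_VF y Z D by (intro psubset_card_mono) auto
      then show ?thesis
        using \<mu> by (intro mult_strict_right_mono) auto
    qed
    also have "\<dots> \<le> real (card (S y))"
      using S(2)[OF y(1)] .
    finally have "card bad < card (S y)" by simp
    moreover have "finite bad"
      using finC finZD finS by (auto simp: bad_def)
    ultimately have "\<not> S y \<subseteq> bad"
      using card_mono[of bad "S y"] by auto
    then obtain u where u: "u \<in> S y" "u \<notin> bad"
      by blast
    define h where "h = f(y := u)"
    have h: "h x = f x" if "x \<in> Z \<union> D" for x
      using that y(2) by (auto simp: h_def)
    have hy: "h y = u" by (simp add: h_def)
    have adj: "E (f x) u" if "x \<in> Z \<union> D" "A x y" for x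
      using u that by (auto simp: bad_def C_def)
    have "u \<notin> f ` (Z \<union> D)"
      using u by (auto simp: bad_def)
    then have "inj_on h (insert y (Z \<union> D))"
      using f(1) y(2) unfolding h_def by (auto simp: inj_on_def)
    moreover have "\<forall>z\<in>Z. h z = e z"
      using f(2) h by auto
    moreover have "\<forall>x\<in>insert y D. h x \<in> S x"
      using f(3) h hy u by auto
    moreover have "E (h x1) (h x2)" if x: "x1 \<in> insert y (Z \<union> D)" "x2 \<in> insert y (Z \<union> D)" "A x1 x2" for x1 x2
    proof -
      consider "x1 \<in> Z \<union> D" "x2 \<in> Z \<union> D" | "x1 \<in> Z \<union> D" "x2 = y" | "x1 = y" "x2 \<in> Z \<union> D"
        using x A_irrefl by auto
      then show ?thesis
      proof cases
        case 1
        then show ?thesis using f(4) x(3) h by simp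
      next
        case 2
        then show ?thesis using adj x(3) h hy by simp
      next
        case 3
        then have "E (f x2) u" using adj A_sym x(3) by blast
        then show ?thesis using graph_relD(1)[OF E] 3 h hy by simp
      qed
    qed
    ultimately show ?case
      by (intro exI[of _ h]) auto
  qed
  from this[OF order.refl] obtain f where f: "inj_on f (Z \<union> (VF - Z))" "\<forall>z\<in>Z. f z = e z"
      "\<forall>y\<in>VF - Z. f y \<in> S y"
      "\<forall>x\<in>Z \<union> (VF - Z). \<forall>y\<in>Z \<union> (VF - Z). A x y \<longrightarrow> E (f x) (f y)"
    by (elim exE conjE) (rule that)
  have ZV: "Z \<union> (VF - Z) = VF"
    using Z by blast
  show ?thesis
  proof (rule embedsI)
    show "inj_on f VF"
      using f(1) unfolding ZV .
    show "f x < n" if "x \<in> VF" for x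
    proof (cases "x \<in> Z")
      case False
      then show ?thesis using f(3) S(1)[of x] that by auto
    qed (use f(2) e(2) in auto)
    show "E (f x) (f y)" if "x \<in> VF" "y \<in> VF" "A x y" for x y
      using f(4) that unfolding ZV by blast
  qed
qed

section \<open>Vertices with many neighbours in every part\<close>

definition rich :: "real \<Rightarrow> nat \<Rightarrow> (nat \<Rightarrow> nat \<Rightarrow> bool) \<Rightarrow> (nat \<Rightarrow> nat) \<Rightarrow> nat set" where
  "rich \<epsilon>1 n E c = {v\<in>{..<n}. \<forall>j<k. \<epsilon>1 * real n < real (card {u\<in>part n c j. E v u})}"

lemma card_nbh_minus_exceptional:
  assumes tp: "typical_partition \<gamma> \<epsilon> n E c X" and v: "v \<in> rich \<epsilon>1 n E c" and j: "j < k"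
  shows "(\<epsilon>1 - \<epsilon>) * real n \<le> real (card ({u\<in>part n c j. E v u} - X))"
proof -
  have "finite X" "real (card X) \<le> \<epsilon> * real n"
    using tp finite_subset[of X "{..<n}"] by (auto simp: typical_partition_def)
  then have "card {u\<in>part n c j. E v u} - card X \<le> card ({u\<in>part n c j. E v u} - X)"
    by (intro diff_card_le_card_Diff)
  then have "real (card {u\<in>part n c j. E v u}) - real (card X) \<le> real (card ({u\<in>part n c j. E v u} - X))"
    by linarith
  moreover have "\<epsilon>1 * real n < real (card {u\<in>part n c j. E v u})"
    using v j by (auto simp: rich_def)
  ultimately show ?thesis
    using \<open>real (card X) \<le> \<epsilon> * real n\<close> by (simp add: algebra_simps)
qed

lemma typical_miss:
  assumes tp: "typical_partition \<gamma> \<epsilon> n E c X" and w: "w < n" "w \<notin> X" and S: "S \<subseteq> {u\<in>{..<n}. c u \<noteq> c w}"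
  shows "real (card {u\<in>S. \<not> E w u}) \<le> \<epsilon> * real n"
proof -
  have "card {u\<in>S. \<not> E w u} \<le> card {u\<in>{..<n}. c u \<noteq> c w \<and> \<not> E w u}"
    using S by (intro card_mono) auto
  then have "real (card {u\<in>S. \<not> E w u}) \<le> real (card {u\<in>{..<n}. c u \<noteq> c w \<and> \<not> E w u})"
    by simp
  also have "\<dots> \<le> \<epsilon> * real n"
    using tp w by (auto simp: typical_partition_def)
  finally show ?thesis .
qed

text \<open>A rich vertex can play the role of \<open>s\<close>, and the \<open>k\<close> colour
  classes of the rest of F are embedded greedily into its neighbourhoods in the \<open>k\<close>
  parts.\<close>

lemma rich_empty:
  assumes E: "free n E" and tp: "typical_partition \<gamma> \<epsilon> n E c X" and \<epsilon>: "\<epsilon> \<ge> 0"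
    and s: "s \<in> VF" "colouring (VF - {s}) A k p"
    and n: "real (card VF) * (\<epsilon> * real n + 1) \<le> (\<epsilon>1 - \<epsilon>) * real n"
  shows "rich \<epsilon>1 n E c = {}"
proof (rule ccontr)
  assume "rich \<epsilon>1 n E c \<noteq> {}"
  then obtain v where v: "v \<in> rich \<epsilon>1 n E c"
    by blast
  have g: "graph_rel n E"
    using E by (simp add: free_def)
  have p: "p y < k" if "y \<in> VF - {s}" for y
    using s(2) that by (auto simp: colouring_def)
  have "embeds VF A E n"
  proof (rule greedy_embedding[OF g, where Z = "{s}" and \<mu> = "\<epsilon> * real n" and e = "\<lambda>_. v"
        and S = "\<lambda>y. {u\<in>part n c (p y). E v u} - X"])
    show "real (card VF) * (\<epsilon> * real n + 1) \<le> real (card ({u\<in>part n c (p y). E v u} - X))"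
      if "y \<in> VF - {s}" for y
      using n card_nbh_minus_exceptional[OF tp v p[OF that]] by linarith
    show "real (card {u\<in>{u\<in>part n c (p y). E v u} - X. \<not> E w u}) \<le> \<epsilon> * real n"
      if "x \<in> VF - {s}" "y \<in> VF - {s}" "A x y" "w \<in> {u\<in>part n c (p x). E v u} - X" for x y w
    proof (rule typical_miss[OF tp])
      have "p x \<noteq> p y" using s(2) that by (auto simp: colouring_def)
      then show "{u\<in>part n c (p y). E v u} - X \<subseteq> {u\<in>{..<n}. c u \<noteq> c w}"
        using that(4) by (auto simp: part_def)
    qed (use that(4) in \<open>auto simp: part_def\<close>)
    \<comment> \<open>The candidates are already neighbours of \<open>v\<close>, so the image of
      \<open>s\<close> excludes none of them.\<close>
    show "real (card {u\<in>{u\<in>part n c (p y). E v u} - X. \<not> E v u}) \<le> \<epsilon> * real n" for y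
    proof -
      have "{u\<in>{u\<in>part n c (p y). E v u} - X. \<not> E v u} = {}" by auto
      then show ?thesis using \<epsilon> by (simp only: card.empty) simp
    qed
  qed (use s v \<epsilon> A_irrefl in \<open>auto simp: rich_def part_def\<close>)
  then show False
    using E by (simp add: free_def)
qed

text \<open>Every rich vertex extends to at least \<open>(\<epsilon>1 / 2 * n) ^ k\<close> cliques
  with one further vertex in each part, out of at most \<open>n ^ k\<close> tuples. Constantly many
  rich vertices therefore form, with the \<open>k\<close> parts, host sets of positive clique
  density and create F. The bound is uniform in the partition and its tolerances.\<close>

lemma rich_bounded:
  assumes \<epsilon>1: "\<epsilon>1 > 0"
  shows "\<exists>N. \<forall>n\<ge>N. \<forall>E \<gamma> \<epsilon> c X. free n E \<longrightarrow> typical_partition \<gamma> \<epsilon> n E c X \<longrightarrow> 0 \<le> \<epsilon> \<longrightarrow>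
           2 * (real k + 1) * \<epsilon> \<le> \<epsilon>1 \<longrightarrow> card (rich \<epsilon>1 n E c) \<le> N"
proof -
  have dens: "(\<epsilon>1 / 2) ^ k > 0"
    using \<epsilon>1 by simp
  obtain N where N: "\<forall>n E S. graph_rel n E \<longrightarrow> length S = Suc k \<longrightarrow>
           (\<forall>B\<in>set S. B \<subseteq> {..<n} \<and> N \<le> card B) \<longrightarrow>
           (\<epsilon>1 / 2) ^ k * real (card (listset S)) \<le> real (card {xs\<in>listset S. sorted_wrt E xs}) \<longrightarrow>
           embeds VF A E n"
    using dense_cliques_embed[OF dens] by (rule exE)
  \<comment> \<open>\<open>n \<ge> N'\<close> gives \<open>\<epsilon>1 * n \<ge> N\<close>, so each
    part has at least \<open>N\<close> vertices once a rich vertex exists. The set of rich vertices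
    only has to exceed the constant \<open>N\<close>.\<close>
  define N' where "N' = max N (nat \<lceil>real N / \<epsilon>1\<rceil>)"
  show ?thesis
  proof (intro exI[of _ N'] allI impI)
    fix n E \<gamma> \<epsilon> c X
    assume n: "N' \<le> n" and E: "free n E" and tp: "typical_partition \<gamma> \<epsilon> n E c X"
      and \<epsilon>: "0 \<le> \<epsilon>" "2 * (real k + 1) * \<epsilon> \<le> \<epsilon>1"
    have g: "graph_rel n E" and notE: "\<not> embeds VF A E n"
      using E by (auto simp: free_def)
    define B where "B = rich \<epsilon>1 n E c"
    have finB: "finite B" by (simp add: B_def rich_def)
    show "card (rich \<epsilon>1 n E c) \<le> N'"
    proof (rule ccontr)
      assume "\<not> ?thesis"
      then have cardB: "N \<le> card B" "card B > 0"
        by (auto simp: B_def N'_def)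
      define P where "P = map (part n c) [0..<k]"
      have finP: "finite (listset P)"
        by (intro finite_listset) (auto simp: P_def)
      have "real N / \<epsilon>1 \<le> real N'"
        unfolding N'_def by linarith
      also have "\<dots> \<le> real n" using n by simp
      finally have N\<epsilon>: "real N \<le> \<epsilon>1 * real n"
        using \<epsilon>1 by (simp add: field_simps)
      have "N \<le> card (part n c j)" if "j < k" for j
      proof -
        obtain v where "v \<in> B" using cardB(2) by (metis card_gt_0_iff ex_in_conv)
        then have "\<epsilon>1 * real n < real (card {u\<in>part n c j. E v u})"
          using that by (auto simp: B_def rich_def)
        also have "\<dots> \<le> real (card (part n c j))"
          by (auto intro!: card_mono)
        finally show ?thesis using N\<epsilon> by linarith
      qed
      then have sets: "\<forall>C\<in>set (B # P). C \<subseteq> {..<n} \<and> N \<le> card C"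
        using cardB by (auto simp: P_def B_def rich_def part_def)
      define R where "R = {xs\<in>listset (B # P). sorted_wrt E xs}"
      have each: "(\<epsilon>1 / 2 * real n) ^ k \<le> real (card {xs\<in>listset P. b # xs \<in> R})" if b: "b \<in> B" for b
      proof -
        \<comment> \<open>Removing \<open>X\<close> leaves typical vertices, which miss few vertices
          in the other parts.\<close>
        define T where "T = map (\<lambda>j. {u\<in>part n c j. E b u} - X) [0..<k]"
        have "(\<epsilon>1 / 2 * real n) ^ k \<le> real (card {xs\<in>listset T. sorted_wrt E xs})"
        proof (rule greedy_clique_count[where \<mu> = "\<epsilon> * real n"])
          show "\<epsilon>1 / 2 * real n + real k * (\<epsilon> * real n) \<le> real (card C)" if C: "C \<in> set T" for C
          proof -
            obtain j where j: "j < k" "C = {u\<in>part n c j. E b u} - X"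
              using C by (auto simp: T_def)
            have "(\<epsilon>1 / 2 + real k * \<epsilon>) * real n \<le> (\<epsilon>1 - \<epsilon>) * real n"
              using \<epsilon>(2) by (intro mult_right_mono) (auto simp: algebra_simps)
            then show ?thesis
              using card_nbh_minus_exceptional[OF tp b[unfolded B_def] j(1)] j(2)
              by (simp add: algebra_simps)
          qed
          show "sorted_wrt (\<lambda>B C. \<forall>x\<in>B. real (card {u\<in>C. \<not> E x u}) \<le> \<epsilon> * real n) T"
            unfolding sorted_wrt_iff_nth_less
          proof (intro allI impI ballI)
            fix i j x assume ij: "i < j" "j < length T" and x: "x \<in> T ! i"
            then have T: "T ! i = {u\<in>part n c i. E b u} - X" "T ! j = {u\<in>part n c j. E b u} - X"
              by (auto simp: T_def)
            show "real (card {u\<in>T ! j. \<not> E x u}) \<le> \<epsilon> * real n"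
              by (rule typical_miss[OF tp]) (use x ij in \<open>auto simp: T part_def\<close>)
          qed
        qed (use \<epsilon> \<epsilon>1 in \<open>auto simp: T_def\<close>)
        also have "card {xs\<in>listset T. sorted_wrt E xs} \<le> card {xs\<in>listset P. b # xs \<in> R}"
        proof (intro card_mono subsetI)
          fix xs assume "xs \<in> {xs\<in>listset T. sorted_wrt E xs}"
          then have xs: "list_all2 (\<in>) xs T" "sorted_wrt E xs"
            by (auto simp: in_listset_iff)
          have mem: "xs ! j \<in> {u\<in>part n c j. E b u} - X" if "j < k" for j
            using list_all2_nthD2[OF xs(1), of j] that by (simp add: T_def)
          have len: "length xs = k"
            using list_all2_lengthD[OF xs(1)] by (simp add: T_def)
          have "list_all2 (\<in>) xs P"
            unfolding list_all2_conv_all_nth using mem len by (auto simp: P_def)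
          moreover have "\<forall>y\<in>set xs. E b y"
            using mem len by (auto simp: in_set_conv_nth)
          ultimately show "xs \<in> {xs\<in>listset P. b # xs \<in> R}"
            using xs(2) b by (auto simp: R_def in_listset_iff simp del: listset.simps)
        qed (use finP in auto)
        finally show ?thesis by simp
      qed
      have "real (card (listset P)) \<le> real n ^ k"
      proof -
        have "card (listset Q) \<le> n ^ length Q" if "\<forall>C\<in>set Q. C \<subseteq> {..<n}" for Q
          using that
        proof (induction Q)
          case (Cons C Q)
          then have "card C \<le> n"
            using card_mono[of "{..<n}" C] by auto
          then show ?case
            using Cons by (simp add: card_set_Cons mult_le_mono)
        qed simp
        from this[of P] have "card (listset P) \<le> n ^ k"
          using sets by (simp add: P_def)
        then show ?thesis
          by (simp flip: of_nat_power)
      qed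
      then have "(\<epsilon>1 / 2) ^ k * real (card (listset (B # P))) \<le> (\<epsilon>1 / 2) ^ k * (real (card B) * real n ^ k)"
        using \<epsilon>1 by (intro mult_left_mono) (auto simp: card_set_Cons intro!: mult_left_mono)
      also have "\<dots> = real (card B) * (\<epsilon>1 / 2 * real n) ^ k"
        by (simp only: power_mult_distrib mult_ac)
      also have "\<dots> \<le> (\<Sum>b\<in>B. real (card {xs\<in>listset P. b # xs \<in> R}))"
        using each by (rule sum_bounded_below)
      also have "\<dots> = real (card R)"
        using card_eq_sum_heads[OF finB finP, of R] by (simp add: R_def)
      finally have "embeds VF A E n"
        using spec[OF spec[OF spec[OF N, of n], of E], of "B # P"] g sets
        unfolding R_def by (simp add: P_def)
      then show False using notE by simp
    qed
  qed
qed

end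

section \<open>The upper bound\<close>

lemma bij_between_complements:
  assumes "finite A" "finite B" "a \<subseteq> A" "b \<subseteq> B" "card A - card a = card B - card b"
  shows "\<exists>g. bij_betw g (A - a) (B - b)"
  using assms by (intro finite_same_card_bij) (auto simp: card_Diff_subset finite_subset)

context forbidden_graph
begin

definition decomp_free :: "nat \<Rightarrow> (nat \<Rightarrow> nat \<Rightarrow> bool) \<Rightarrow> bool" where
  "decomp_free n E \<longleftrightarrow> graph_rel n E \<and>
     (\<forall>p i j. colouring VF A (Suc k) p \<longrightarrow> i < Suc k \<longrightarrow> j < Suc k \<longrightarrow> i \<noteq> j \<longrightarrow>
        \<not> embeds {x\<in>VF. p x = i \<or> p x = j} A E n)"

text \<open>
  Vertices isolated in the member of the decomposition family are re-embedded together with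
  the remaining colour classes, since their images need not lie in \<open>U\<close>.
\<close>

lemma inside_part_decomp_free:
  assumes E: "free n E" and tp: "typical_partition \<gamma> \<epsilon> n E c X" and j: "j < k"
    and \<mu>: "0 \<le> \<mu>" "\<epsilon> * real n \<le> \<mu>" "real (card VF) * (\<mu> + 1) \<le> (\<gamma> - \<epsilon>) * real n"
    and U: "U \<subseteq> {..<n}"
      "\<And>v. v \<in> U \<Longrightarrow> real (card {u\<in>{..<n}. c u \<noteq> j \<and> \<not> E v u}) \<le> \<mu>"
  shows "decomp_free n (\<lambda>u v. E u v \<and> u \<in> U \<and> v \<in> U)"
  unfolding decomp_free_def
proof (intro conjI allI impI notI)
  have g: "graph_rel n E"
    using E by (simp add: free_def)
  then show "graph_rel n (\<lambda>u v. E u v \<and> u \<in> U \<and> v \<in> U)"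
    unfolding graph_rel_def by blast
  fix p a b
  assume p: "colouring VF A (Suc k) p" and ab: "a < Suc k" "b < Suc k" "a \<noteq> b"
    and emb: "embeds {x\<in>VF. p x = a \<or> p x = b} A (\<lambda>u v. E u v \<and> u \<in> U \<and> v \<in> U) n"
  define D where "D = {x\<in>VF. p x = a \<or> p x = b}"
  obtain f where f: "inj_on f D" "\<And>x. x \<in> D \<Longrightarrow> f x < n"
    "\<And>x y. x \<in> D \<Longrightarrow> y \<in> D \<Longrightarrow> A x y \<Longrightarrow> E (f x) (f y) \<and> f x \<in> U \<and> f y \<in> U"
    using emb unfolding D_def[symmetric] by (rule embedsE) (rule that)
  define Z where "Z = {x\<in>D. \<exists>y\<in>D. A x y}"
  \<comment> \<open>The other \<open>k - 1\<close> colours of F are matched with the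
    \<open>k - 1\<close> parts different from \<open>j\<close>.\<close>
  have "\<exists>g. bij_betw g ({..<Suc k} - {a, b}) ({..<k} - {j})"
    using ab j by (intro bij_between_complements) auto
  then obtain h where h: "bij_betw h ({..<Suc k} - {a, b}) ({..<k} - {j})"
    by blast
  have h_in: "h m \<in> {..<k} - {j}" if "m < Suc k" "m \<noteq> a" "m \<noteq> b" for m
    using h that unfolding bij_betw_def by blast
  have h_inj: "h m \<noteq> h m'" if "m < Suc k" "m \<noteq> a" "m \<noteq> b" "m' < Suc k" "m' \<noteq> a" "m' \<noteq> b" "m \<noteq> m'" for m m'
    using h that unfolding bij_betw_def inj_on_def by blast
  \<comment> \<open>The part prescribed for \<open>x\<close>. Vertices of \<open>D\<close> outside
    \<open>Z\<close> also go to part \<open>j\<close>, where they need no neighbours.\<close>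
  define q where "q x = (if x \<in> D then j else h (p x))" for x
  have px: "p x < Suc k" if "x \<in> VF" for x
    using p that by (auto simp: colouring_def)
  have notD: "p x \<noteq> a" "p x \<noteq> b" if "x \<in> VF" "x \<notin> D" for x
    using that by (auto simp: D_def)
  have q_out: "q x \<in> {..<k} - {j}" if "x \<in> VF" "x \<notin> D" for x
    using h_in[OF px notD] that by (simp add: q_def)
  have qk: "q x < k" if "x \<in> VF" for x
    using q_out[OF that] j by (cases "x \<in> D") (auto simp: q_def)
  have DVF: "D \<subseteq> VF" by (auto simp: D_def)
  have "embeds VF A E n"
  proof (rule greedy_embedding[OF g, where Z = Z and e = f and \<mu> = \<mu> and S = "\<lambda>x. part n c (q x) - X"])
    show "Z \<subseteq> VF" using DVF by (auto simp: Z_def)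
    show "inj_on f Z"
      using f(1) by (rule inj_on_subset) (auto simp: Z_def)
    show "f z < n" if "z \<in> Z" for z
      using that f(2) by (simp add: Z_def)
    show "E (f x) (f y)" if "x \<in> Z" "y \<in> Z" "A x y" for x y
      using f(3)[of x y] that by (simp add: Z_def)
    show "part n c (q y) - X \<subseteq> {..<n}" for y
      by (auto simp: part_def)
    show "real (card VF) * (\<mu> + 1) \<le> real (card (part n c (q y) - X))" if "y \<in> VF - Z" for y
      using \<mu>(3) card_part_minus_exceptional[OF tp qk, of y] that by auto
    show "0 \<le> \<mu>" by (rule \<mu>(1))
  next
    fix z y assume zy: "z \<in> Z" "y \<in> VF - Z" "A z y"
    have fz: "f z \<in> U"
      using zy(1) f(3) by (auto simp: Z_def)
    have "y \<notin> D"
      using zy A_sym[OF zy(3)] by (auto simp: Z_def)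
    then have "q y \<noteq> j"
      using q_out[of y] zy(2) by auto
    then have "card {u\<in>part n c (q y) - X. \<not> E (f z) u} \<le> card {u\<in>{..<n}. c u \<noteq> j \<and> \<not> E (f z) u}"
      by (intro card_mono) (auto simp: part_def)
    then show "real (card {u\<in>part n c (q y) - X. \<not> E (f z) u}) \<le> \<mu>"
      using U(2)[OF fz] by linarith
  next
    fix x y w assume xy: "x \<in> VF - Z" "y \<in> VF - Z" "A x y" and w: "w \<in> part n c (q x) - X"
    have "\<not> (x \<in> D \<and> y \<in> D)"
      using xy by (auto simp: Z_def)
    moreover have "p x \<noteq> p y"
      using p xy by (auto simp: colouring_def)
    ultimately have "q x \<noteq> q y"
      using q_out[of x] q_out[of y] h_inj[OF px[of x] notD[of x] px[of y] notD[of y]] xy(1,2)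
      by (cases "x \<in> D"; cases "y \<in> D") (auto simp: q_def)
    then have "real (card {u\<in>part n c (q y) - X. \<not> E w u}) \<le> \<epsilon> * real n"
      by (intro typical_miss[OF tp]) (use w in \<open>auto simp: part_def\<close>)
    then show "real (card {u\<in>part n c (q y) - X. \<not> E w u}) \<le> \<mu>"
      using \<mu>(2) by linarith
  qed
  then show False
    using E by (simp add: free_def)
qed

section \<open>Stars and the decomposition family\<close>

definition star :: "nat \<Rightarrow> nat \<Rightarrow> nat \<Rightarrow> bool" where
  "star n u v \<longleftrightarrow> u < n \<and> v < n \<and> u \<noteq> v \<and> (u = 0 \<or> v = 0)"

text \<open>If two colour classes of F embed into a star, deleting the vertex sent to the centre
  leaves no edge between them. Merging them yields a \<open>k\<close>-colouring of F minus a
  vertex.\<close>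

lemma star_decomp_free:
  assumes crit: "\<And>s p. s \<in> VF \<Longrightarrow> \<not> colouring (VF - {s}) A k p"
  shows "decomp_free n (star n)"
  unfolding decomp_free_def
proof (intro conjI allI impI notI)
  show "graph_rel n (star n)"
    by (auto simp: graph_rel_def star_def)
  fix p a b
  assume p: "colouring VF A (Suc k) p" and ab: "a < Suc k" "b < Suc k" "a \<noteq> b"
    and emb: "embeds {x\<in>VF. p x = a \<or> p x = b} A (star n) n"
  define D where "D = {x\<in>VF. p x = a \<or> p x = b}"
  obtain f where f: "inj_on f D" "\<And>x. x \<in> D \<Longrightarrow> f x < n"
    "\<And>x y. x \<in> D \<Longrightarrow> y \<in> D \<Longrightarrow> A x y \<Longrightarrow> star n (f x) (f y)"
    using emb unfolding D_def[symmetric] by (rule embedsE) (rule that)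
  have "\<exists>s\<in>VF. \<forall>x\<in>D. x \<noteq> s \<longrightarrow> f x \<noteq> 0"
  proof (cases "\<exists>s\<in>D. f s = 0")
    case True
    then obtain s where "s \<in> D" "f s = 0" by blast
    then have "\<forall>x\<in>D. x \<noteq> s \<longrightarrow> f x \<noteq> 0"
      using f(1) by (metis inj_onD)
    moreover have "s \<in> VF"
      using \<open>s \<in> D\<close> by (simp add: D_def)
    ultimately show ?thesis by blast
  next
    case False
    \<comment> \<open>If nothing in \<open>D\<close> is sent to the centre, any vertex of F can be
      deleted.\<close>
    have "VF \<noteq> {}" using card_VF_pos by auto
    then show ?thesis using False by auto
  qed
  then obtain s where s: "s \<in> VF" "\<And>x. x \<in> D \<Longrightarrow> x \<noteq> s \<Longrightarrow> f x \<noteq> 0"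
    by blast
  have "\<exists>q. colouring (VF - {s}) A k q"
  proof (rule merge_colour_classes[OF _ ab])
    show "colouring (VF - {s}) A (Suc k) p"
      using p by (auto simp: colouring_def)
    show "\<not> A x y" if "x \<in> VF - {s}" "y \<in> VF - {s}" "p x = a \<or> p x = b" "p y = a \<or> p y = b" for x y
    proof
      assume "A x y"
      have "x \<in> D" "y \<in> D" using that by (auto simp: D_def)
      then have "f x = 0 \<or> f y = 0"
        using f(3)[OF _ _ \<open>A x y\<close>] by (auto simp: star_def)
      then show False
        using s(2)[of x] s(2)[of y] that \<open>x \<in> D\<close> \<open>y \<in> D\<close> by auto
    qed
  qed
  then show False
    using crit[OF s(1)] by blast
qed

lemma sum_vdeg_star:
  assumes "n \<ge> 2"
  shows "n \<le> (\<Sum>v<n. vdeg (star n) n v)"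
proof -
  have "1 \<le> vdeg (star n) n v" if "v < n" for v
  proof -
    have "{if v = 0 then 1 else 0} \<subseteq> {u\<in>{..<n}. star n v u}"
      using that assms by (auto simp: star_def)
    from card_mono[OF _ this] show ?thesis
      by (simp add: vdeg_def)
  qed
  then have "(\<Sum>v<n. 1) \<le> (\<Sum>v<n. vdeg (star n) n v)"
    by (intro sum_mono) auto
  then show ?thesis by simp
qed

text \<open>\<open>\<beta>\<close> is exported because the lower bound needs linear parts for the
  same \<open>c\<close>. The number \<open>b\<close> stands for \<open>biex(n, F)\<close>; the
  factor 2 comes from measuring edges by degree sums.\<close>

lemma upper_bound:
  assumes r: "r \<ge> 1"
  shows "\<exists>\<beta>>0. \<exists>C>0. \<exists>N. \<forall>n\<ge>N. \<forall>E b. extremal r n E \<longrightarrow>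
           (\<forall>E'. decomp_free n E' \<longrightarrow> (\<Sum>v<n. vdeg E' n v) \<le> 2 * b) \<longrightarrow>
           (\<exists>c. (\<forall>v<n. c v < k) \<and> (\<forall>i<k. \<beta> * real n \<le> real (card (part n c i))) \<and>
                (\<Sum>v<n. real (vdeg E n v) ^ r) \<le>
                  (\<Sum>v<n. real (cross n c v) ^ r) + C * real b * real n ^ (r - 1))"
proof -
  obtain \<gamma> where \<gamma>: "\<gamma> > 0" and stab: "\<forall>\<epsilon>>0. \<exists>N. \<forall>n\<ge>N. \<forall>E. extremal r n E \<longrightarrow>
           (\<exists>c X. typical_partition \<gamma> \<epsilon> n E c X)"
    using extremal_stability[OF r] unfolding typical_partition_def by blast
  define f where "f = real (card VF)"
  define K where "K = real (card VF) + 2 + real r * (2 * real (card VF) + 4) * (2 / \<gamma>) ^ (r - 1)"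
  \<comment> \<open>Vertices miss at most \<open>K * \<epsilon>1 * n\<close> neighbours outside
    their sparse part. The choice gives \<open>f * (K * \<epsilon>1) = \<gamma> / 4\<close>, so
    greedy embedding into parts without \<open>X\<close> has room.\<close>
  define \<epsilon>1 where "\<epsilon>1 = \<gamma> / (4 * f * K)"
  \<comment> \<open>Small against \<open>\<epsilon>1\<close> even after multiplication by
    \<open>f\<close> or \<open>k + 1\<close>, as embeddings into the neighbourhoods of rich vertices
    require.\<close>
  define \<epsilon> where "\<epsilon> = \<epsilon>1 / (4 * (f + real k + 1))"
  have f: "f \<ge> 1" using card_VF_pos by (simp add: f_def)
  have K: "K \<ge> 2" using \<gamma> by (simp add: K_def add_increasing2)
  have fK: "f * K \<ge> 1" using mult_mono[of 1 f 1 K] f K by simp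
  have \<epsilon>1: "\<epsilon>1 > 0" "\<epsilon>1 \<le> \<gamma> / 4" "f * (K * \<epsilon>1) = \<gamma> / 4"
  proof -
    show "\<epsilon>1 > 0" using \<gamma> f K by (simp add: \<epsilon>1_def)
    have "\<gamma> / (4 * (f * K)) \<le> \<gamma> / (4 * 1)"
      using \<gamma> fK by (intro divide_left_mono) auto
    then show "\<epsilon>1 \<le> \<gamma> / 4" by (simp add: \<epsilon>1_def mult.assoc)
    show "f * (K * \<epsilon>1) = \<gamma> / 4" using f K by (simp add: \<epsilon>1_def)
  qed
  have \<epsilon>: "\<epsilon> > 0" "\<epsilon> \<le> \<epsilon>1 / 4" "f * \<epsilon> \<le> \<epsilon>1 / 4" "2 * (real k + 1) * \<epsilon> \<le> \<epsilon>1"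
  proof -
    have q: "\<epsilon> * (4 * (f + real k + 1)) = \<epsilon>1"
      using f by (simp add: \<epsilon>_def)
    show pos: "\<epsilon> > 0" using \<epsilon>1 f by (simp add: \<epsilon>_def)
    have "f * \<epsilon> \<ge> 0" "real k * \<epsilon> \<ge> 0" using pos f by auto
    moreover have "\<epsilon>1 = 4 * (f * \<epsilon>) + 4 * (real k * \<epsilon>) + 4 * \<epsilon>"
      unfolding q[symmetric] by (simp add: algebra_simps)
    ultimately show "\<epsilon> \<le> \<epsilon>1 / 4" "f * \<epsilon> \<le> \<epsilon>1 / 4" "2 * (real k + 1) * \<epsilon> \<le> \<epsilon>1"
      using pos by (simp_all add: algebra_simps)
  qed
  obtain N1 where N1: "\<forall>n\<ge>N1. \<forall>E. extremal r n E \<longrightarrow> (\<exists>c X. typical_partition \<gamma> \<epsilon> n E c X)"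
    using stab \<epsilon>(1) by blast
  obtain N2 where N2: "\<forall>n\<ge>N2. \<forall>E \<gamma> \<epsilon> c X. free n E \<longrightarrow> typical_partition \<gamma> \<epsilon> n E c X \<longrightarrow> 0 \<le> \<epsilon> \<longrightarrow>
           2 * (real k + 1) * \<epsilon> \<le> \<epsilon>1 \<longrightarrow> card (rich \<epsilon>1 n E c) \<le> N2"
    using rich_bounded[OF \<epsilon>1(1)] by (rule exE)
  \<comment> \<open>Each of the \<open>k\<close> graphs inside parts has degree sum at most
    \<open>2 * b\<close> and weight \<open>r\<close>. A rich vertex costs
    \<open>(r + 1) * n ^ r\<close>, and \<open>n \<le> 2 * b\<close> whenever rich vertices can
    occur.\<close>
  define C where "C = 2 * real r * real k + 2 * (real r + 1) * real N2 + 1"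
  define N3 where "N3 = nat \<lceil>(4 * f + 4) / \<epsilon>1\<rceil>"
  have C: "C > 0" by (simp add: C_def add_nonneg_pos)
  have main: "\<exists>c. (\<forall>v<n. c v < k) \<and> (\<forall>i<k. \<gamma> / 2 * real n \<le> real (card (part n c i))) \<and>
                (\<Sum>v<n. real (vdeg E n v) ^ r) \<le>
                  (\<Sum>v<n. real (cross n c v) ^ r) + C * real b * real n ^ (r - 1)"
    if n: "n \<ge> Max {N1, N2, N3, 2}" and E: "extremal r n E"
      and b: "\<forall>E'. decomp_free n E' \<longrightarrow> (\<Sum>v<n. vdeg E' n v) \<le> 2 * b" for n E b
  proof -
    have n': "n \<ge> N1" "n \<ge> N2" "n \<ge> N3" "n \<ge> 2" using n by auto
    have free: "free n E" using E by (simp add: extremal_def)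
    have n0: "real n > 0" using n' by simp
    have n_large: "4 * f + 4 \<le> \<epsilon>1 * real n"
    proof -
      have "(4 * f + 4) / \<epsilon>1 \<le> real N3" unfolding N3_def by linarith
      also have "\<dots> \<le> real n" using n' by simp
      finally show ?thesis using \<epsilon>1 by (simp add: field_simps)
    qed
    have sc: "\<epsilon>1 * real n \<le> \<gamma> / 4 * real n" "\<epsilon> * real n \<le> \<epsilon>1 / 4 * real n" "f * \<epsilon> * real n \<le> \<epsilon>1 / 4 * real n"
      using \<epsilon>1 \<epsilon> n0 by (auto intro!: mult_right_mono)
    define G H where "G = \<gamma> * real n / 4" and "H = \<epsilon>1 * real n"
    have GH: "\<gamma> / 4 * real n = G" "\<gamma> / 2 * real n = 2 * G" "\<epsilon>1 * real n = H"
      "\<epsilon>1 / 4 * real n = H / 4" "\<epsilon>1 / 2 * real n = H / 2"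
      by (simp_all add: G_def H_def)
    obtain c X where tp: "typical_partition \<gamma> \<epsilon> n E c X"
      using N1 n'(1) E by blast
    have X: "X \<subseteq> {..<n}" and ck: "\<And>v. v < n \<Longrightarrow> c v < k"
      and parts: "\<And>i. i < k \<Longrightarrow> \<gamma> * real n \<le> real (card (part n c i))"
      using tp by (auto simp: typical_partition_def)
    define B where "B = rich \<epsilon>1 n E c"
    have finB: "finite B" and B: "B \<subseteq> {..<n}" by (auto simp: B_def rich_def)
    \<comment> \<open>A vertex that is not rich has a sparse part and is moved there; rich vertices
      stay where they are.\<close>
    define c' where "c' v = (if v \<in> B then c v else SOME j. j < k \<and> real (card {u\<in>part n c j. E v u}) \<le> \<epsilon>1 * real n)" for v
    have c': "c' v < k" "real (card {u\<in>part n c (c' v). E v u}) \<le> \<epsilon>1 * real n" if "v < n" "v \<notin> B" for v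
    proof -
      have "\<exists>j. j < k \<and> real (card {u\<in>part n c j. E v u}) \<le> \<epsilon>1 * real n"
        using that by (auto simp: B_def rich_def not_less)
      from someI_ex[OF this] show "c' v < k" "real (card {u\<in>part n c (c' v). E v u}) \<le> \<epsilon>1 * real n"
        using that by (auto simp: c'_def)
    qed
    have c'k: "c' v < k" if "v < n" for v
      using c'(1)[OF that] ck[OF that] by (cases "v \<in> B") (auto simp: c'_def)
    \<comment> \<open>A typical vertex is joined to almost all of every other part, so only its own
      part can be sparse. Hence only vertices of \<open>X\<close> move, and the parts stay
      linear.\<close>
    have c'_typical: "c' v = c v" if v: "v < n" "v \<notin> X" for v
    proof (rule ccontr)
      assume ne: "c' v \<noteq> c v"
      then have "v \<notin> B" by (auto simp: c'_def)
      note sparse = c'[OF v(1) this]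
      have "real (card {u\<in>part n c (c' v). \<not> E v u}) \<le> \<epsilon> * real n"
        by (rule typical_miss[OF tp v]) (use ne in \<open>auto simp: part_def\<close>)
      moreover have "card (part n c (c' v)) = card {u\<in>part n c (c' v). E v u} + card {u\<in>part n c (c' v). \<not> E v u}"
        using card_filter_split[of "part n c (c' v)" "\<lambda>_. True" "E v"] by simp
      ultimately have "\<gamma> * real n \<le> \<epsilon>1 * real n + \<epsilon> * real n"
        using parts[OF sparse(1)] sparse(2) by linarith
      also have "\<dots> \<le> \<gamma> / 2 * real n"
        using mult_right_mono[of "\<epsilon>1 + \<epsilon>" "\<gamma> / 2" "real n"] \<epsilon> \<epsilon>1 by (simp add: distrib_right)
      finally show False
        using \<gamma> n0 by (simp add: field_simps)
    qed
    have parts': "\<gamma> / 2 * real n \<le> real (card (part n c' i))" if "i < k" for i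
    proof -
      have "\<gamma> / 2 * real n \<le> (\<gamma> - \<epsilon>) * real n"
        using \<epsilon> \<epsilon>1 \<gamma> n0 by (intro mult_right_mono) auto
      also have "\<dots> \<le> real (card (part n c i - X))"
        using card_part_minus_exceptional[OF tp that] .
      also have "\<dots> \<le> real (card (part n c' i))"
        using c'_typical by (auto simp: part_def intro!: card_mono)
      finally show ?thesis .
    qed
    \<comment> \<open>Rich vertices are left out because \<open>missing_outside_sparse_part\<close>
      needs a sparse part.\<close>
    define U where "U j = {v\<in>{..<n}. v \<notin> B \<and> c' v = j}" for j
    define In where "In j u v \<longleftrightarrow> E u v \<and> u \<in> U j \<and> v \<in> U j" for j u v
    have In_le: "(\<Sum>v<n. vdeg (In j) n v) \<le> 2 * b" if j: "j < k" for j
    proof -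
      have "decomp_free n (\<lambda>u v. E u v \<and> u \<in> U j \<and> v \<in> U j)"
      proof (rule inside_part_decomp_free[OF free tp j, where \<mu> = "K * \<epsilon>1 * real n"])
        show "0 \<le> K * \<epsilon>1 * real n" using K \<epsilon>1 by simp
        have "\<epsilon> \<le> 1 * \<epsilon>1" using \<epsilon> \<epsilon>1 by simp
        also have "\<dots> \<le> K * \<epsilon>1" using K \<epsilon>1 by (intro mult_right_mono) auto
        finally show "\<epsilon> * real n \<le> K * \<epsilon>1 * real n"
          by (intro mult_right_mono) auto
        have "real (card VF) * (K * \<epsilon>1 * real n + 1) = f * (K * \<epsilon>1) * real n + f"
          by (simp add: f_def algebra_simps)
        also have "\<dots> \<le> \<gamma> / 2 * real n"
          using n_large sc(1) f unfolding \<epsilon>1(3) GH by linarith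
        also have "\<dots> \<le> (\<gamma> - \<epsilon>) * real n"
          using \<epsilon> \<epsilon>1 \<gamma> n0 by (intro mult_right_mono) auto
        finally show "real (card VF) * (K * \<epsilon>1 * real n + 1) \<le> (\<gamma> - \<epsilon>) * real n" .
        show "U j \<subseteq> {..<n}" by (auto simp: U_def)
        show "real (card {u\<in>{..<n}. c u \<noteq> j \<and> \<not> E v u}) \<le> K * \<epsilon>1 * real n" if "v \<in> U j" for v
          unfolding K_def
        proof (rule missing_outside_sparse_part[OF E r tp \<gamma>])
          show "\<epsilon> \<le> \<epsilon>1" "2 * \<epsilon> \<le> \<gamma>" using \<epsilon> \<epsilon>1 by auto
          show "1 \<le> \<epsilon>1 * real n" using n_large f by linarith
          show "real (card VF) + 1 \<le> \<gamma> / 2 * real n"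
            using n_large sc(1) f unfolding f_def[symmetric] GH by linarith
        qed (use that c'(2)[of v] j in \<open>auto simp: U_def\<close>)
      qed
      then show ?thesis
        using b unfolding In_def by blast
    qed
    have step: "real (vdeg E n v) ^ r \<le> real (cross n c' v) ^ r
        + real r * real n ^ (r - 1) * (\<Sum>j<k. real (vdeg (In j) n v))
        + real r * real n ^ (r - 1) * real (card B)
        + (if v \<in> B then real n ^ r else 0)" if v: "v < n" for v
    proof (cases "v \<in> B")
      case True
      have "real (vdeg E n v) ^ r \<le> real n ^ r"
        by (intro power_mono) (auto simp: vdeg_le)
      also have "\<dots> \<le> real (cross n c' v) ^ r
        + real r * real n ^ (r - 1) * (\<Sum>j<k. real (vdeg (In j) n v))
        + real r * real n ^ (r - 1) * real (card B) + real n ^ r"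
        by (simp add: sum_nonneg)
      finally show ?thesis using True by simp
    next
      case False
      \<comment> \<open>A neighbour of \<open>v\<close> lies in another part, or in the same part
        and in \<open>U\<close>, or is rich. These are charged to the complete partite graph, to the
        graph \<open>In (c' v)\<close>, and to \<open>card B\<close>.\<close>
      have "{u\<in>{..<n}. E v u} \<subseteq> {u\<in>{..<n}. c' u \<noteq> c' v} \<union> {u\<in>{..<n}. In (c' v) v u} \<union> B"
        using v False by (auto simp: In_def U_def)
      then have "vdeg E n v \<le> card ({u\<in>{..<n}. c' u \<noteq> c' v} \<union> {u\<in>{..<n}. In (c' v) v u} \<union> B)"
        unfolding vdeg_def using finB by (intro card_mono) auto
      also have "\<dots> \<le> cross n c' v + vdeg (In (c' v)) n v + card B"
        unfolding cross_def vdeg_def by (rule order.trans[OF card_Un_le add_right_mono[OF card_Un_le]])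
      finally have "real (vdeg E n v) \<le> real (cross n c' v) + real (vdeg (In (c' v)) n v) + real (card B)"
        by (simp flip: of_nat_add)
      moreover have "real (vdeg (In (c' v)) n v) \<le> (\<Sum>j<k. real (vdeg (In j) n v))"
        using c'k[OF v] by (intro member_le_sum) auto
      ultimately have diff: "real (vdeg E n v) - real (cross n c' v) \<le>
          (\<Sum>j<k. real (vdeg (In j) n v)) + real (card B)"
        by linarith
      have "real (vdeg E n v) ^ r - real (cross n c' v) ^ r \<le>
          real r * ((\<Sum>j<k. real (vdeg (In j) n v)) + real (card B)) * real n ^ (r - 1)"
      proof (cases "cross n c' v \<le> vdeg E n v")
        case True
        then have "real (vdeg E n v) ^ r - real (cross n c' v) ^ r \<le>
            real r * (real (vdeg E n v) - real (cross n c' v)) * real n ^ (r - 1)"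
          by (intro power_diff_le) (auto simp: vdeg_le)
        also have "\<dots> \<le> real r * ((\<Sum>j<k. real (vdeg (In j) n v)) + real (card B)) * real n ^ (r - 1)"
          using diff by (intro mult_right_mono mult_left_mono) auto
        finally show ?thesis .
      next
        case False
        then have "real (vdeg E n v) ^ r \<le> real (cross n c' v) ^ r"
          by (intro power_mono) auto
        moreover have "0 \<le> real r * ((\<Sum>j<k. real (vdeg (In j) n v)) + real (card B)) * real n ^ (r - 1)"
          by (intro mult_nonneg_nonneg add_nonneg_nonneg sum_nonneg) auto
        ultimately show ?thesis by linarith
      qed
      then show ?thesis
        using False by (simp add: algebra_simps)
    qed
    have pown: "real n * real n ^ (r - 1) = real n ^ r"
      using r by (cases r) auto
    have "(\<Sum>v<n. real (vdeg E n v) ^ r) \<le> (\<Sum>v<n. real (cross n c' v) ^ r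
        + real r * real n ^ (r - 1) * (\<Sum>j<k. real (vdeg (In j) n v))
        + real r * real n ^ (r - 1) * real (card B)
        + (if v \<in> B then real n ^ r else 0))"
      using step by (intro sum_mono) auto
    also have "\<dots> = (\<Sum>v<n. real (cross n c' v) ^ r)
        + real r * real n ^ (r - 1) * (\<Sum>v<n. \<Sum>j<k. real (vdeg (In j) n v))
        + real r * real (card B) * real n ^ r + real (card B) * real n ^ r"
      unfolding sum.distrib sum_if_mem[OF finite_lessThan B] pown[symmetric]
      by (simp add: sum_distrib_left)
    finally have total: "(\<Sum>v<n. real (vdeg E n v) ^ r) \<le> (\<Sum>v<n. real (cross n c' v) ^ r)
        + real r * real n ^ (r - 1) * (\<Sum>v<n. \<Sum>j<k. real (vdeg (In j) n v))
        + real r * real (card B) * real n ^ r + real (card B) * real n ^ r" .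
    have "(\<Sum>v<n. \<Sum>j<k. real (vdeg (In j) n v)) = (\<Sum>j<k. real (\<Sum>v<n. vdeg (In j) n v))"
      by (subst sum.swap) simp
    also have "\<dots> \<le> real (card {..<k}) * (2 * real b)"
    proof (rule sum_bounded_above)
      fix j assume "j \<in> {..<k}"
      then have "(\<Sum>v<n. vdeg (In j) n v) \<le> 2 * b"
        using In_le by simp
      then show "real (\<Sum>v<n. vdeg (In j) n v) \<le> 2 * real b"
        by linarith
    qed
    finally have "real r * real n ^ (r - 1) * (\<Sum>v<n. \<Sum>j<k. real (vdeg (In j) n v)) \<le>
        real r * real n ^ (r - 1) * (real k * (2 * real b))"
      by (intro mult_left_mono) auto
    moreover have "real r * real (card B) * real n ^ r + real (card B) * real n ^ r =
        (real r + 1) * (real (card B) * real n ^ r)"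
      by (simp add: algebra_simps)
    moreover have "real r * real n ^ (r - 1) * (real k * (2 * real b)) =
        2 * real r * real k * real b * real n ^ (r - 1)"
      by simp
    ultimately have bound: "(\<Sum>v<n. real (vdeg E n v) ^ r) \<le> (\<Sum>v<n. real (cross n c' v) ^ r)
        + 2 * real r * real k * real b * real n ^ (r - 1) + (real r + 1) * (real (card B) * real n ^ r)"
      using total by linarith
    have "real (card B) * real n ^ r \<le> real N2 * (2 * real b) * real n ^ (r - 1)"
    proof (cases "\<exists>s\<in>VF. \<exists>p. colouring (VF - {s}) A k p")
      case True
      then obtain s p where s: "s \<in> VF" "colouring (VF - {s}) A k p"
        by blast
      have "B = {}"
        unfolding B_def
      proof (rule rich_empty[OF free tp _ s])
        show "0 \<le> \<epsilon>" using \<epsilon> by simp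
        have "f * (\<epsilon> * real n + 1) = f * \<epsilon> * real n + f" by (simp add: algebra_simps)
        also have "\<dots> \<le> \<epsilon>1 / 2 * real n"
          using sc(3) n_large f unfolding GH by linarith
        also have "\<dots> \<le> (\<epsilon>1 - \<epsilon>) * real n"
          using \<epsilon> \<epsilon>1 by (intro mult_right_mono) auto
        finally show "real (card VF) * (\<epsilon> * real n + 1) \<le> (\<epsilon>1 - \<epsilon>) * real n"
          by (simp add: f_def)
      qed
      then show ?thesis by simp
    next
      case False
      \<comment> \<open>The star competes in the definition of \<open>b\<close>, so
        \<open>n \<le> 2 * b\<close>, which trades one factor \<open>n\<close> of
        \<open>card B * n ^ r\<close> for \<open>b\<close>.\<close>
      have "n \<le> (\<Sum>v<n. vdeg (star n) n v)"
        using sum_vdeg_star n'(4) .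
      also have "\<dots> \<le> 2 * b"
        using b star_decomp_free[of n] False by blast
      finally have "real n \<le> 2 * real b" by linarith
      moreover have "card B \<le> N2"
        using N2 n'(2) free tp \<epsilon>(1,4) unfolding B_def by (meson less_imp_le)
      ultimately have "real (card B) * real n * real n ^ (r - 1) \<le> real N2 * (2 * real b) * real n ^ (r - 1)"
        by (intro mult_right_mono mult_mono) auto
      then show ?thesis
        unfolding mult.assoc[of "real (card B)" "real n"] pown .
    qed
    then have "(real r + 1) * (real (card B) * real n ^ r) \<le> (real r + 1) * (real N2 * (2 * real b) * real n ^ (r - 1))"
      by (intro mult_left_mono) auto
    moreover have "0 \<le> real b * real n ^ (r - 1)"
      by simp
    moreover have "C * real b * real n ^ (r - 1) = 2 * real r * real k * real b * real n ^ (r - 1)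
        + (real r + 1) * (real N2 * (2 * real b) * real n ^ (r - 1)) + real b * real n ^ (r - 1)"
      by (simp add: C_def algebra_simps)
    ultimately have "(\<Sum>v<n. real (vdeg E n v) ^ r) \<le>
        (\<Sum>v<n. real (cross n c' v) ^ r) + C * real b * real n ^ (r - 1)"
      using bound by linarith
    then show ?thesis
      using c'k parts' by (intro exI[of _ c']) auto
  qed
  have "\<gamma> / 2 > 0" using \<gamma> by simp
  then show ?thesis
    using C main by blast
qed

end

section \<open>The lower bound\<close>

text \<open>Vertices are added one at a time, each on the side that cuts at least half of the edges
  to its predecessors.\<close>

lemma half_cut:
  assumes sym: "\<And>u v. E u v \<Longrightarrow> E v u" and irr: "\<And>v. \<not> E v v"
  shows "\<exists>s :: nat \<Rightarrow> bool. (\<Sum>v<n. vdeg E n v) \<le> 2 * (\<Sum>v<n. card {u\<in>{..<n}. E v u \<and> s u \<noteq> s v})"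
proof (induction n)
  case 0
  then show ?case by simp
next
  case (Suc n)
  then obtain s :: "nat \<Rightarrow> bool" where s: "(\<Sum>v<n. vdeg E n v) \<le> 2 * (\<Sum>v<n. card {u\<in>{..<n}. E v u \<and> s u \<noteq> s v})"
    by blast
  \<comment> \<open>The number of edges to earlier vertices that are cut when \<open>n\<close> is
    put on side \<open>b\<close>.\<close>
  define N where "N b = card {u\<in>{..<n}. E n u \<and> s u \<noteq> b}" for b
  have rec: "(\<Sum>v<Suc n. card {u\<in>{..<Suc n}. E v u \<and> P u v}) =
      (\<Sum>v<n. card {u\<in>{..<n}. E v u \<and> P u v}) + 2 * card {u\<in>{..<n}. E n u \<and> P u n}"
    if P: "\<And>u v. P u v = P v u" for P
  proof -
    have 1: "card {u\<in>{..<Suc n}. E v u \<and> P u v} =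
        card {u\<in>{..<n}. E v u \<and> P u v} + (if E n v \<and> P v n then 1 else 0)" for v
    proof -
      have "{u\<in>{..<Suc n}. E v u \<and> P u v} =
          {u\<in>{..<n}. E v u \<and> P u v} \<union> (if E n v \<and> P v n then {n} else {})"
        using sym P by (auto simp: less_Suc_eq)
      then show ?thesis
        by (auto simp: card_Un_disjoint)
    qed
    have "(\<Sum>v<n. if E n v \<and> P v n then 1 else 0) = card {u\<in>{..<n}. E n u \<and> P u n}"
      by (simp add: sum.If_cases Int_def)
    then show ?thesis
      unfolding 1 using irr by (simp add: sum.distrib)
  qed
  have "vdeg E n n = N True + N False"
    unfolding vdeg_def N_def using card_filter_split[of "{..<n}" "E n" "\<lambda>u. s u \<noteq> True"] by simp
  then have "vdeg E n n \<le> 2 * N True \<or> vdeg E n n \<le> 2 * N False"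
    by linarith
  then obtain b where b: "vdeg E n n \<le> 2 * N b"
    by blast
  define s' where "s' = s(n := b)"
  have "(\<Sum>v<n. card {u\<in>{..<n}. E v u \<and> s' u \<noteq> s' v}) = (\<Sum>v<n. card {u\<in>{..<n}. E v u \<and> s u \<noteq> s v})"
    by (intro sum.cong refl arg_cong[where f = card]) (auto simp: s'_def)
  moreover have "card {u\<in>{..<n}. E n u \<and> s' u \<noteq> s' n} = N b"
    unfolding N_def by (intro arg_cong[where f = card]) (auto simp: s'_def)
  moreover have "(\<Sum>v<Suc n. vdeg E (Suc n) v) = (\<Sum>v<n. vdeg E n v) + 2 * vdeg E n n"
    using rec[of "\<lambda>_ _. True"] by (simp add: vdeg_def)
  moreover have "(\<Sum>v<Suc n. card {u\<in>{..<Suc n}. E v u \<and> s' u \<noteq> s' v}) =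
      (\<Sum>v<n. card {u\<in>{..<n}. E v u \<and> s' u \<noteq> s' v}) + 2 * card {u\<in>{..<n}. E n u \<and> s' u \<noteq> s' n}"
    by (rule rec) auto
  ultimately have "(\<Sum>v<Suc n. vdeg E (Suc n) v) \<le>
      2 * (\<Sum>v<Suc n. card {u\<in>{..<Suc n}. E v u \<and> s' u \<noteq> s' v})"
    using s b by linarith
  then show ?case by blast
qed

lemma card_eq_sum_fibres:
  assumes "finite B" "\<And>u. u \<in> B \<Longrightarrow> g u < (q :: nat)"
  shows "card B = (\<Sum>w<q. card {u\<in>B. g u = w})"
proof -
  have "(\<Union>w<q. {u\<in>B. g u = w}) = B"
    using assms(2) by auto
  moreover have "card (\<Union>w<q. {u\<in>B. g u = w}) = (\<Sum>w<q. card {u\<in>B. g u = w})"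
    using assms(1) by (intro card_UN_disjoint) auto
  ultimately show ?thesis by simp
qed

text \<open>
  Restricting to the pair of blocks that carries most edges of a large cut gives a dense
  bipartite subgraph on few vertices.
\<close>

lemma bipartite_piece:
  assumes E: "graph_rel n E" and m: "m > 0"
  shows "\<exists>s Y. Y \<subseteq> {..<n} \<and> card Y \<le> 2 * m \<and>
           (\<Sum>v<n. vdeg E n v) \<le> 4 * (n div m + 1)\<^sup>2 *
             (\<Sum>v<n. vdeg (\<lambda>a b. E a b \<and> a \<in> Y \<and> b \<in> Y \<and> s a \<noteq> (s b :: bool)) n v)"
proof -
  have sym: "E v u" if "E u v" for u v
    using graph_relD(1)[OF E that] .
  have irr: "\<not> E v v" for v
    using graph_relD(4)[OF E, of v v] by auto
  obtain s where s: "(\<Sum>v<n. vdeg E n v) \<le> 2 * (\<Sum>v<n. card {u\<in>{..<n}. E v u \<and> s u \<noteq> (s v :: bool)})"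
    using half_cut[of E n, OF sym irr] by blast
  define c where "c v = (if s v then 0 else 1 :: nat)" for v
  have cs: "c u \<noteq> c v \<longleftrightarrow> s u \<noteq> s v" for u v
    by (simp add: c_def)
  have half: "(\<Sum>v<n. card {u\<in>{..<n}. E v u \<and> s u \<noteq> s v}) = 2 * (\<Sum>v<n. card {u\<in>{..<n}. E v u \<and> c v < c u})"
    using sum_forward_eq_half[of E n c, OF sym] unfolding cs by simp
  define q where "q = n div m + 1"
  \<comment> \<open>\<open>q\<close> blocks of length \<open>m\<close> cover the vertices, and
    \<open>w\<close> encodes an ordered pair of blocks as a number below \<open>q * q\<close>,
    decoded by \<open>div\<close> and \<open>mod\<close>. The final factor 4 is 2 for the cut times
    2 for orienting its edges.\<close>
  define w where "w v u = (v div m) * q + u div m" for v u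
  have q: "v div m < q" if "v < n" for v
    using that by (simp add: q_def less_Suc_eq_le div_le_mono)
  have wq: "w v u < q * q" if "v < n" "u < n" for v u
  proof -
    have "w v u < (v div m) * q + q" unfolding w_def using q that by simp
    also have "\<dots> = (v div m + 1) * q" by simp
    also have "\<dots> \<le> q * q" using q[OF that(1)] by (intro mult_le_mono1) simp
    finally show ?thesis .
  qed
  have wdiv: "w v u div q = v div m" "w v u mod q = u div m" if "u < n" for v u
    using q[OF that] by (auto simp: w_def)
  define y where "y t = (\<Sum>v<n. card {u\<in>{u\<in>{..<n}. E v u \<and> c v < c u}. w v u = t})" for t
  have "(\<Sum>v<n. card {u\<in>{..<n}. E v u \<and> c v < c u}) =
      (\<Sum>v<n. \<Sum>t<q * q. card {u\<in>{u\<in>{..<n}. E v u \<and> c v < c u}. w v u = t})"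
    using wq by (intro sum.cong refl card_eq_sum_fibres) auto
  also have "\<dots> = (\<Sum>t<q * q. y t)"
    unfolding y_def by (rule sum.swap)
  finally have sum_y: "(\<Sum>v<n. card {u\<in>{..<n}. E v u \<and> c v < c u}) = (\<Sum>t<q * q. y t)" .
  have "\<exists>t<q * q. (\<Sum>t<q * q. y t) \<le> q * q * y t"
  proof (rule ccontr)
    assume neg: "\<not> ?thesis"
    have "0 \<in> {..<q * q}" by (simp add: q_def)
    then have "(\<Sum>t<q * q. q * q * y t) < (\<Sum>t<q * q. \<Sum>t<q * q. y t)"
      using neg by (intro sum_strict_mono) (blast, blast, force)
    then show False
      by (simp add: sum_distrib_left[symmetric])
  qed
  then obtain t where t: "(\<Sum>t<q * q. y t) \<le> q * q * y t"
    by blast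
  \<comment> \<open>Forward edges run from the side \<open>s\<close> to the other side, so one side
    of each block suffices.\<close>
  define Y where "Y = {v\<in>{..<n}. v div m = t div q \<and> s v} \<union> {u\<in>{..<n}. u div m = t mod q \<and> \<not> s u}"
  have block: "card {v\<in>{..<n}. v div m = a \<and> P v} \<le> m" for a P
  proof -
    have "{v\<in>{..<n}. v div m = a \<and> P v} \<subseteq> {a * m..<a * m + m}"
    proof
      fix v assume "v \<in> {v\<in>{..<n}. v div m = a \<and> P v}"
      then have "v = a * m + v mod m"
        using div_mult_mod_eq[of v m] by simp
      moreover have "v mod m < m" using m by simp
      ultimately show "v \<in> {a * m..<a * m + m}" by auto
    qed
    then have "card {v\<in>{..<n}. v div m = a \<and> P v} \<le> card {a * m..<a * m + m}"
      by (intro card_mono) auto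
    then show ?thesis by simp
  qed
  have "card Y \<le> card {v\<in>{..<n}. v div m = t div q \<and> s v} + card {u\<in>{..<n}. u div m = t mod q \<and> \<not> s u}"
    unfolding Y_def by (rule card_Un_le)
  then have Y: "Y \<subseteq> {..<n}" "card Y \<le> 2 * m"
    using block[of "t div q" s] block[of "t mod q" "\<lambda>u. \<not> s u"] by (auto simp: Y_def)
  define H where "H a b \<longleftrightarrow> E a b \<and> a \<in> Y \<and> b \<in> Y \<and> s a \<noteq> s b" for a b
  have "y t \<le> (\<Sum>v<n. vdeg H n v)"
    unfolding y_def vdeg_def
  proof (intro sum_mono card_mono subsetI)
    fix v u assume "v \<in> {..<n}" "u \<in> {u\<in>{u\<in>{..<n}. E v u \<and> c v < c u}. w v u = t}"
    then show "u \<in> {u\<in>{..<n}. H v u}"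
      using wdiv[of u v] by (auto simp: H_def Y_def c_def split: if_splits)
  qed auto
  then have "q * q * y t \<le> q * q * (\<Sum>v<n. vdeg H n v)"
    by (rule mult_le_mono2)
  then have "(\<Sum>v<n. vdeg E n v) \<le> 4 * (q * q * (\<Sum>v<n. vdeg H n v))"
    using s half sum_y t by linarith
  then have "(\<Sum>v<n. vdeg E n v) \<le> 4 * q\<^sup>2 * (\<Sum>v<n. vdeg H n v)"
    by (simp add: power2_eq_square mult.assoc)
  then show ?thesis
    using Y unfolding H_def q_def by blast
qed

text \<open>A permutation of all vertices, rather than an injection of \<open>Y\<close>, lets the
  planted graph be a pullback whose degree sum is unchanged by reindexing.\<close>

lemma permutation_into:
  assumes "Y \<subseteq> {..<n}" "W \<subseteq> {..<n}" "card Y \<le> card W"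
  shows "\<exists>\<sigma>. bij_betw \<sigma> {..<n} {..<(n::nat)} \<and> (\<forall>v<n. \<sigma> v \<in> Y \<longrightarrow> v \<in> W)"
proof -
  obtain V where V: "V \<subseteq> W" "card V = card Y"
    using obtain_subset_with_card_n[OF assms(3)] by blast
  have sub: "V \<subseteq> {..<n}" using V(1) assms(2) by blast
  have fin: "finite V" "finite Y" using sub assms(1) finite_subset by blast+
  obtain f where f: "bij_betw f V Y"
    using finite_same_card_bij[OF fin V(2)] by blast
  obtain g where g: "bij_betw g ({..<n} - V) ({..<n} - Y)"
    using bij_between_complements[of "{..<n}" "{..<n}" V Y] V(2) sub assms(1) by auto
  define h where "h v = (if v \<in> V then f v else g v)" for v
  have hf: "bij_betw h V Y"
    using f by (simp add: h_def cong: bij_betw_cong)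
  have hg: "bij_betw h ({..<n} - V) ({..<n} - Y)"
    using g by (subst bij_betw_cong[of _ h g]) (auto simp: h_def)
  have "bij_betw h (V \<union> ({..<n} - V)) (Y \<union> ({..<n} - Y))"
    using hf hg by (intro bij_betw_combine) auto
  moreover have "V \<union> ({..<n} - V) = {..<n}" "Y \<union> ({..<n} - Y) = {..<n}"
    using sub assms(1) by auto
  ultimately have "bij_betw h {..<n} {..<n}" by simp
  moreover have "\<forall>v<n. h v \<in> Y \<longrightarrow> v \<in> W"
  proof (intro allI impI)
    fix v assume v: "v < n" "h v \<in> Y"
    show "v \<in> W"
    proof (rule ccontr)
      assume "v \<notin> W"
      then have "v \<in> {..<n} - V" using v V by auto
      then have "h v \<in> {..<n} - Y" using hg by (auto simp: bij_betw_def)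
      then show False using v by simp
    qed
  qed
  ultimately show ?thesis by blast
qed

context forbidden_graph
begin

text \<open>A copy of F would be properly coloured by the parts with part 0 split along
  \<open>s\<close>; the added edges respect the split because they run between its sides. The two
  colours from part 0 would then span a member of the decomposition family inside
  \<open>E0\<close>.\<close>

lemma free_add_bipartite:
  assumes c: "\<And>v. v < n \<Longrightarrow> c v < k" and E0: "decomp_free n E0"
    and \<sigma>: "bij_betw \<sigma> {..<n} {..<n}" "\<And>v. v < n \<Longrightarrow> \<sigma> v \<in> Y \<Longrightarrow> c v = 0"
  shows "free n (\<lambda>a b. multipartite n c a b \<or>
     (a < n \<and> b < n \<and> E0 (\<sigma> a) (\<sigma> b) \<and> \<sigma> a \<in> Y \<and> \<sigma> b \<in> Y \<and> s (\<sigma> a) \<noteq> (s (\<sigma> b) :: bool)))"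
    (is "free n ?E")
  unfolding free_def
proof (intro conjI notI)
  have g0: "graph_rel n E0"
    using E0 by (simp add: decomp_free_def)
  show "graph_rel n ?E"
    unfolding graph_rel_def
  proof (intro allI impI)
    fix a b assume "?E a b"
    then show "?E b a \<and> a < n \<and> b < n \<and> a \<noteq> b"
      using graph_relD(1)[OF g0, of "\<sigma> a" "\<sigma> b"] by (auto simp: multipartite_def)
  qed
  assume "embeds VF A ?E n"
  then obtain f where f: "inj_on f VF" "\<And>x. x \<in> VF \<Longrightarrow> f x < n"
      "\<And>x y. x \<in> VF \<Longrightarrow> y \<in> VF \<Longrightarrow> A x y \<Longrightarrow> ?E (f x) (f y)"
    by (rule embedsE) (rule that)
  \<comment> \<open>One side of part 0 receives the new colour \<open>k\<close>, the other side
    keeps 0.\<close>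
  define p where "p x = (if c (f x) = 0 \<and> s (\<sigma> (f x)) then k else c (f x))" for x
  have p: "colouring VF A (Suc k) p"
    unfolding colouring_def
  proof (intro conjI ballI impI)
    fix x assume "x \<in> VF"
    then show "p x < Suc k"
      using c[OF f(2)[of x]] by (simp add: p_def less_Suc_eq)
  next
    fix x y assume xy: "x \<in> VF" "y \<in> VF" "A x y"
    have lt: "c (f x) < k" "c (f y) < k" using c f(2) xy by auto
    from f(3)[OF xy] consider "c (f x) \<noteq> c (f y)"
      | "c (f x) = 0" "c (f y) = 0" "s (\<sigma> (f x)) \<noteq> s (\<sigma> (f y))"
      using \<sigma>(2) by (auto simp: multipartite_def)
    then show "p x \<noteq> p y"
      using lt k_ge_2 by cases (auto simp: p_def)
  qed
  define D where "D = {x\<in>VF. p x = 0 \<or> p x = k}"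
  have D: "c (f x) = 0" if "x \<in> D" for x
    using that c[OF f(2)[of x]] by (auto simp: D_def p_def split: if_splits)
  have "embeds D A E0 n"
  proof (rule embedsI[where f = "\<sigma> \<circ> f"])
    show "inj_on (\<sigma> \<circ> f) D"
    proof (rule comp_inj_on)
      show "inj_on f D"
        using f(1) by (rule inj_on_subset) (auto simp: D_def)
      show "inj_on \<sigma> (f ` D)"
        using bij_betw_imp_inj_on[OF \<sigma>(1)] by (rule inj_on_subset) (use f(2) in \<open>auto simp: D_def\<close>)
    qed
    show "(\<sigma> \<circ> f) x < n" if "x \<in> D" for x
      using f(2)[of x] bij_betwE[OF \<sigma>(1)] that by (auto simp: D_def)
    show "E0 ((\<sigma> \<circ> f) x) ((\<sigma> \<circ> f) y)" if "x \<in> D" "y \<in> D" "A x y" for x y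
      using f(3)[of x y] D[OF that(1)] D[OF that(2)] that by (auto simp: D_def multipartite_def)
  qed
  then show False
    using E0 p k_ge_2 unfolding decomp_free_def D_def by auto
qed

text \<open>The partition is arbitrary apart from its linear parts, so the one produced by the upper
  bound can be inserted.\<close>

lemma lower_bound:
  assumes r: "r \<ge> 1" and \<beta>: "\<beta> > 0"
  shows "\<exists>\<delta>>0. \<exists>N. \<forall>n\<ge>N. \<forall>c E0. (\<forall>v<n. c v < k) \<longrightarrow>
           (\<forall>i<k. \<beta> * real n \<le> real (card (part n c i))) \<longrightarrow> decomp_free n E0 \<longrightarrow>
           (\<exists>E. free n E \<and>
              (\<Sum>v<n. real (cross n c v) ^ r) + \<delta> * real (\<Sum>v<n. vdeg E0 n v) * real n ^ (r - 1)
                \<le> (\<Sum>v<n. real (vdeg E n v) ^ r))"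
proof -
  \<comment> \<open>\<open>Q\<close> bounds the number of blocks. In \<open>\<delta>\<close>, the
    factor \<open>4 * Q\<^sup>2\<close> is lost in \<open>bipartite_piece\<close>, and
    \<open>\<beta> ^ (r - 1)\<close> comes from degrees of at least
    \<open>\<beta> * n\<close>.\<close>
  define Q where "Q = 4 / \<beta> + 1"
  define \<delta> where "\<delta> = \<beta> ^ (r - 1) / (4 * Q\<^sup>2)"
  have Q: "Q > 0" using \<beta> by (simp add: Q_def add_pos_pos)
  have \<delta>: "\<delta> > 0" using \<beta> Q by (simp add: \<delta>_def)
  have main: "\<exists>E. free n E \<and>
              (\<Sum>v<n. real (cross n c v) ^ r) + \<delta> * real (\<Sum>v<n. vdeg E0 n v) * real n ^ (r - 1)
                \<le> (\<Sum>v<n. real (vdeg E n v) ^ r)"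
    if n: "n \<ge> nat \<lceil>4 / \<beta>\<rceil>" and c: "\<forall>v<n. c v < k"
      and parts: "\<forall>i<k. \<beta> * real n \<le> real (card (part n c i))" and E0: "decomp_free n E0" for n c E0
  proof -
    have "4 / \<beta> \<le> real n" using n by linarith
    then have n4: "4 \<le> \<beta> * real n" using \<beta> by (simp add: field_simps)
    \<comment> \<open>Then \<open>2 * m\<close> vertices fit into part 0, while \<open>m\<close> is
      still at least a fixed proportion of \<open>n\<close>; \<open>n \<ge> 4 / \<beta>\<close>
      keeps it positive.\<close>
    define m where "m = nat \<lfloor>\<beta> * real n / 2\<rfloor>"
    have m: "2 * real m \<le> \<beta> * real n" "\<beta> * real n \<le> 4 * real m" "m > 0"
      using n4 unfolding m_def by linarith+
    have g0: "graph_rel n E0" using E0 by (simp add: decomp_free_def)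
    obtain s Y where Y: "Y \<subseteq> {..<n}" "card Y \<le> 2 * m" and dense:
        "(\<Sum>v<n. vdeg E0 n v) \<le> 4 * (n div m + 1)\<^sup>2 *
             (\<Sum>v<n. vdeg (\<lambda>a b. E0 a b \<and> a \<in> Y \<and> b \<in> Y \<and> s a \<noteq> (s b :: bool)) n v)"
      using bipartite_piece[OF g0 m(3)] by blast
    have "real (card Y) \<le> \<beta> * real n" using Y(2) m(1) by linarith
    also have "\<dots> \<le> real (card (part n c 0))" using parts k_ge_2 by auto
    finally have cardY: "card Y \<le> card (part n c 0)" by simp
    have "part n c 0 \<subseteq> {..<n}" by (auto simp: part_def)
    then obtain \<sigma> where \<sigma>: "bij_betw \<sigma> {..<n} {..<n}" "\<forall>v<n. \<sigma> v \<in> Y \<longrightarrow> v \<in> part n c 0"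
      using permutation_into[OF Y(1) _ cardY] by blast
    have \<sigma>Y: "c v = 0" if "v < n" "\<sigma> v \<in> Y" for v
      using \<sigma>(2) that by (auto simp: part_def)
    define H0 where "H0 a b \<longleftrightarrow> E0 a b \<and> a \<in> Y \<and> b \<in> Y \<and> s a \<noteq> s b" for a b
    define H where "H a b \<longleftrightarrow> a < n \<and> b < n \<and> H0 (\<sigma> a) (\<sigma> b)" for a b
    define E where "E a b \<longleftrightarrow> multipartite n c a b \<or> H a b" for a b
    have "free n E"
      using free_add_bipartite[where c = c and s = s, OF _ E0 \<sigma>(1) \<sigma>Y] c unfolding E_def H_def H0_def by simp
    have vdegH: "vdeg H n v = vdeg H0 n (\<sigma> v)" if "v < n" for v
    proof -
      have "bij_betw \<sigma> {u\<in>{..<n}. H v u} {u\<in>{..<n}. H0 (\<sigma> v) u}"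
      proof (rule bij_betw_imageI)
        show "inj_on \<sigma> {u\<in>{..<n}. H v u}"
          using bij_betw_imp_inj_on[OF \<sigma>(1)] by (rule inj_on_subset) auto
        have img: "\<sigma> ` {..<n} = {..<n}" using \<sigma>(1) by (simp add: bij_betw_def)
        have "{u\<in>{..<n}. H v u} = {u\<in>{..<n}. H0 (\<sigma> v) (\<sigma> u)}"
          using that by (auto simp: H_def)
        moreover have "\<sigma> ` {u\<in>{..<n}. H0 (\<sigma> v) (\<sigma> u)} = {u\<in>\<sigma> ` {..<n}. H0 (\<sigma> v) u}"
          by auto
        ultimately show "\<sigma> ` {u\<in>{..<n}. H v u} = {u\<in>{..<n}. H0 (\<sigma> v) u}"
          unfolding img by simp
      qed
      then show ?thesis unfolding vdeg_def by (rule bij_betw_same_card)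
    qed
    have "(\<Sum>v<n. vdeg H n v) = (\<Sum>v<n. vdeg H0 n (\<sigma> v))"
      using vdegH by (intro sum.cong) auto
    also have "\<dots> = (\<Sum>v<n. vdeg H0 n v)"
      using sum.reindex_bij_betw[OF \<sigma>(1)] .
    finally have sumH: "(\<Sum>v<n. vdeg E0 n v) \<le> 4 * (n div m + 1)\<^sup>2 * (\<Sum>v<n. vdeg H n v)"
      using dense unfolding H0_def by simp
    have vdegE: "vdeg E n v = cross n c v + vdeg H n v" if "v < n" for v
    proof -
      have "{u\<in>{..<n}. E v u} = {u\<in>{..<n}. c u \<noteq> c v} \<union> {u\<in>{..<n}. H v u}"
        using that by (auto simp: E_def multipartite_def)
      moreover have "{u\<in>{..<n}. c u \<noteq> c v} \<inter> {u\<in>{..<n}. H v u} = {}"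
        using that \<sigma>Y by (auto simp: H_def H0_def)
      ultimately show ?thesis
        unfolding vdeg_def cross_def by (simp add: card_Un_disjoint)
    qed
    \<comment> \<open>The degree of \<open>v\<close> in \<open>E\<close> is already at least
      \<open>\<beta> * n\<close> from cross edges, so each edge of \<open>H\<close> at
      \<open>v\<close> adds at least \<open>(\<beta> * n) ^ (r - 1)\<close>.\<close>
    have "real (cross n c v) ^ r + real (vdeg H n v) * (\<beta> * real n) ^ (r - 1) \<le> real (vdeg E n v) ^ r"
      if "v < n" for v
    proof -
      have "\<beta> * real n \<le> real (cross n c v)"
        using cross_ge[OF k_ge_2] parts by simp
      then have "\<beta> * real n \<le> real (vdeg E n v)"
        using vdegE[OF that] by simp
      then have "real (vdeg H n v) * (\<beta> * real n) ^ (r - 1) \<le> real (vdeg H n v) * real (vdeg E n v) ^ (r - 1)"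
        using \<beta> by (intro mult_left_mono power_mono) auto
      also have "\<dots> \<le> real (vdeg E n v) ^ r - real (cross n c v) ^ r"
        using power_diff_ge[of "real (cross n c v)" "real (vdeg E n v)" r] r vdegE[OF that] by simp
      finally show ?thesis by simp
    qed
    then have "(\<Sum>v<n. real (cross n c v) ^ r + real (vdeg H n v) * (\<beta> * real n) ^ (r - 1))
        \<le> (\<Sum>v<n. real (vdeg E n v) ^ r)"
      by (intro sum_mono) auto
    then have gain: "(\<Sum>v<n. real (cross n c v) ^ r) + real (\<Sum>v<n. vdeg H n v) * (\<beta> * real n) ^ (r - 1)
        \<le> (\<Sum>v<n. real (vdeg E n v) ^ r)"
      by (simp add: sum.distrib sum_distrib_right)
    have "real (n div m + 1) \<le> Q"
    proof -
      have "real (n div m) \<le> real n / real m"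
        by (rule of_nat_div_le_of_nat)
      also have "\<dots> \<le> 4 / \<beta>"
        using m \<beta> by (simp add: field_simps)
      finally show ?thesis by (simp add: Q_def)
    qed
    then have "(real (n div m + 1))\<^sup>2 \<le> Q\<^sup>2"
      by (intro power_mono) auto
    then have "4 * (real (n div m + 1))\<^sup>2 * real (\<Sum>v<n. vdeg H n v) \<le> 4 * Q\<^sup>2 * real (\<Sum>v<n. vdeg H n v)"
      by (intro mult_right_mono[OF mult_left_mono] of_nat_0_le_iff) auto
    moreover have "real (\<Sum>v<n. vdeg E0 n v) \<le> real (4 * (n div m + 1)\<^sup>2 * (\<Sum>v<n. vdeg H n v))"
      using sumH by (rule of_nat_mono)
    then have "real (\<Sum>v<n. vdeg E0 n v) \<le> 4 * (real (n div m + 1))\<^sup>2 * real (\<Sum>v<n. vdeg H n v)"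
      by (simp only: of_nat_mult of_nat_power of_nat_numeral)
    ultimately have "real (\<Sum>v<n. vdeg E0 n v) \<le> 4 * Q\<^sup>2 * real (\<Sum>v<n. vdeg H n v)"
      by (rule order_trans[rotated])
    then have "\<delta> * real (\<Sum>v<n. vdeg E0 n v) \<le> \<delta> * (4 * Q\<^sup>2 * real (\<Sum>v<n. vdeg H n v))"
      using \<delta> by (intro mult_left_mono) auto
    also have "\<dots> = \<beta> ^ (r - 1) * real (\<Sum>v<n. vdeg H n v)"
      using Q by (simp add: \<delta>_def)
    finally have "\<delta> * real (\<Sum>v<n. vdeg E0 n v) * real n ^ (r - 1) \<le>
        \<beta> ^ (r - 1) * real (\<Sum>v<n. vdeg H n v) * real n ^ (r - 1)"
      by (intro mult_right_mono) auto
    also have "\<dots> = real (\<Sum>v<n. vdeg H n v) * (\<beta> * real n) ^ (r - 1)"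
      by (simp only: power_mult_distrib mult_ac)
    finally show ?thesis
      using gain \<open>free n E\<close> by (intro exI[of _ E]) linarith
  qed
  show ?thesis
    using \<delta> main by blast
qed

end

section \<open>From relations to graphs\<close>

definition adj :: "'a graph \<Rightarrow> 'a \<Rightarrow> 'a \<Rightarrow> bool" where
  "adj G u v \<longleftrightarrow> {u, v} \<in> edges G"

definition graph_of :: "nat \<Rightarrow> (nat \<Rightarrow> nat \<Rightarrow> bool) \<Rightarrow> nat graph" where
  "graph_of n E = ({..<n}, {{u, v} | u v. E u v})"

lemma adj_sym: "adj G u v \<Longrightarrow> adj G v u"
  by (simp add: adj_def insert_commute)

lemma simple_graph_adj:
  assumes "simple_graph G" "adj G u v"
  shows "u \<in> verts G" "v \<in> verts G" "u \<noteq> v"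
  using assms by (auto simp: simple_graph_def adj_def)

lemma simple_graph_edgeE:
  assumes "simple_graph G" "e \<in> edges G"
  obtains u v where "e = {u, v}" "adj G u v"
proof -
  have "card e = 2" using assms by (auto simp: simple_graph_def)
  then obtain u v where "e = {u, v}" by (auto simp: card_2_iff)
  then show thesis using that assms(2) by (auto simp: adj_def)
qed

lemma adj_graph_of: "graph_rel n E \<Longrightarrow> adj (graph_of n E) u v \<longleftrightarrow> E u v"
  by (auto simp: adj_def graph_of_def doubleton_eq_iff dest: graph_relD(1))

lemma verts_graph_of [simp]: "verts (graph_of n E) = {..<n}"
  by (simp add: graph_of_def)

lemma simple_graph_of: "graph_rel n E \<Longrightarrow> simple_graph (graph_of n E)"
  unfolding simple_graph_def graph_of_def by (auto dest: graph_relD(2-4))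

lemma graph_rel_adj: "simple_graph G \<Longrightarrow> verts G = {..<n} \<Longrightarrow> graph_rel n (adj G)"
  unfolding graph_rel_def using simple_graph_adj[of G] adj_sym[of G] by blast

lemma degree_eq_vdeg:
  assumes G: "simple_graph G" "verts G = {..<n}"
  shows "degree G v = vdeg (adj G) n v"
proof -
  have "{e \<in> edges G. v \<in> e} = (\<lambda>u. {v, u}) ` {u\<in>{..<n}. adj G v u}"
  proof (intro equalityI subsetI)
    fix e assume e: "e \<in> {e \<in> edges G. v \<in> e}"
    then obtain a b where ab: "e = {a, b}" "adj G a b"
      using simple_graph_edgeE[OF G(1)] by blast
    then have "\<exists>u. e = {v, u} \<and> adj G v u"
      using e adj_sym[OF ab(2)] by (auto simp: insert_commute)
    then show "e \<in> (\<lambda>u. {v, u}) ` {u\<in>{..<n}. adj G v u}"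
      using simple_graph_adj(2)[OF G(1)] G(2) by auto
  qed (auto simp: adj_def)
  moreover have "inj_on (\<lambda>u. {v, u}) {u\<in>{..<n}. adj G v u}"
    by (auto simp: inj_on_def doubleton_eq_iff)
  ultimately show ?thesis
    unfolding degree_def vdeg_def by (simp add: card_image)
qed

lemma degree_power_sum_eq:
  assumes "simple_graph G" "verts G = {..<n}"
  shows "degree_power_sum r G = (\<Sum>v<n. vdeg (adj G) n v ^ r)"
  unfolding degree_power_sum_def using assms by (simp add: degree_eq_vdeg)

lemma handshake:
  assumes G: "simple_graph G" "verts G = {..<n}"
  shows "(\<Sum>v<n. vdeg (adj G) n v) = 2 * card (edges G)"
proof -
  have fin: "finite (edges G)"
    by (rule finite_subset[of _ "Pow (verts G)"]) (use G in \<open>auto simp: simple_graph_def\<close>)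
  have "(\<Sum>v<n. vdeg (adj G) n v) = (\<Sum>v<n. card {e\<in>edges G. v \<in> e})"
    using G by (intro sum.cong refl) (simp flip: degree_eq_vdeg add: degree_def)
  also have "\<dots> = (\<Sum>e\<in>edges G. card {v\<in>{..<n}. v \<in> e})"
    using fin by (intro sum_card_swap) auto
  also have "\<dots> = (\<Sum>e\<in>edges G. 2)"
  proof (intro sum.cong refl)
    fix e assume "e \<in> edges G"
    then have "e \<subseteq> {..<n}" "card e = 2" using G by (auto simp: simple_graph_def)
    then show "card {v\<in>{..<n}. v \<in> e} = 2"
      by (simp add: Collect_conj_eq Int_absorb1 lessThan_def[symmetric])
  qed
  finally show ?thesis by simp
qed

lemma contains_copy_iff_embeds:
  assumes G: "simple_graph G" "verts G = {..<n}" and H: "simple_graph H"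
  shows "contains_copy G H \<longleftrightarrow> embeds (verts H) (adj H) (adj G) n"
proof -
  have "(\<forall>e\<in>edges H. f ` e \<in> edges G) \<longleftrightarrow>
      (\<forall>x\<in>verts H. \<forall>y\<in>verts H. adj H x y \<longrightarrow> adj G (f x) (f y))" for f
  proof
    assume "\<forall>e\<in>edges H. f ` e \<in> edges G"
    then show "\<forall>x\<in>verts H. \<forall>y\<in>verts H. adj H x y \<longrightarrow> adj G (f x) (f y)"
      by (fastforce simp: adj_def)
  next
    assume *: "\<forall>x\<in>verts H. \<forall>y\<in>verts H. adj H x y \<longrightarrow> adj G (f x) (f y)"
    show "\<forall>e\<in>edges H. f ` e \<in> edges G"
    proof
      fix e assume "e \<in> edges H"
      then obtain u v where uv: "e = {u, v}" "adj H u v"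
        using simple_graph_edgeE[OF H] by blast
      then have "adj G (f u) (f v)"
        using * simple_graph_adj[OF H uv(2)] by blast
      then show "f ` e \<in> edges G"
        using uv(1) by (simp add: adj_def)
    qed
  qed
  then show ?thesis
    unfolding contains_copy_def embeds_def using G(2) by simp
qed

lemma proper_colouring_iff:
  assumes "simple_graph F"
  shows "proper_colouring F k c \<longleftrightarrow> colouring (verts F) (adj F) k c"
  unfolding proper_colouring_def colouring_def adj_def[symmetric]
  using simple_graph_adj[OF assms] by blast

lemma chromatic_number_colouring:
  assumes "simple_graph F"
  shows "\<exists>c. proper_colouring F (chromatic_number F) c"
proof -
  have "finite (verts F)" using assms by (simp add: simple_graph_def)
  then obtain h where h: "bij_betw h (verts F) {0..<card (verts F)}"
    using ex_bij_betw_finite_nat by blast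
  have "proper_colouring F (card (verts F)) h"
    unfolding proper_colouring_def adj_def[symmetric]
  proof (intro conjI allI impI)
    show "h \<in> verts F \<rightarrow> {..<card (verts F)}"
      using bij_betwE[OF h] by auto
    show "h u \<noteq> h v" if "adj F u v" for u v
      using simple_graph_adj[OF assms that] bij_betw_imp_inj_on[OF h] by (auto simp: inj_on_def)
  qed
  then have "\<exists>k c. proper_colouring F k c" by blast
  then show ?thesis
    unfolding chromatic_number_def by (rule LeastI_ex)
qed

lemma forbidden_graph_of_simple_graph:
  assumes F: "simple_graph F" "\<not> bipartite F"
  shows "forbidden_graph (verts F) (adj F) (chromatic_number F - 1)"
    and "Suc (chromatic_number F - 1) = chromatic_number F"
proof -
  obtain c where c: "proper_colouring F (chromatic_number F) c"
    using chromatic_number_colouring[OF F(1)] by blast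
  have "chromatic_number F \<ge> 3"
  proof (rule ccontr)
    assume "\<not> ?thesis"
    then have "proper_colouring F 2 c"
      using c unfolding proper_colouring_def Pi_def by fastforce
    then show False using F(2) by (auto simp: bipartite_def)
  qed
  then show Suc: "Suc (chromatic_number F - 1) = chromatic_number F" by simp
  show "forbidden_graph (verts F) (adj F) (chromatic_number F - 1)"
  proof
    show "finite (verts F)" using F(1) by (simp add: simple_graph_def)
    show "adj F y x" if "adj F x y" for x y using adj_sym[OF that] .
    show "\<not> adj F x x" for x using simple_graph_adj(3)[OF F(1)] by blast
    show "2 \<le> chromatic_number F - 1" using \<open>chromatic_number F \<ge> 3\<close> by simp
    show "\<exists>p. colouring (verts F) (adj F) (Suc (chromatic_number F - 1)) p"
      unfolding Suc using c proper_colouring_iff[OF F(1)] by blast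
    show "\<not> colouring (verts F) (adj F) (chromatic_number F - 1) p" for p
    proof
      assume "colouring (verts F) (adj F) (chromatic_number F - 1) p"
      then have "\<exists>c. proper_colouring F (chromatic_number F - 1) c"
        using proper_colouring_iff[OF F(1)] by blast
      then have "chromatic_number F \<le> chromatic_number F - 1"
        unfolding chromatic_number_def by (rule Least_le)
      then show False using \<open>chromatic_number F \<ge> 3\<close> by simp
    qed
  qed
qed

lemma finite_graphs: "finite {h G | G :: nat graph. simple_graph G \<and> verts G = {..<n} \<and> P G}"
proof (rule finite_subset)
  show "{h G | G. simple_graph G \<and> verts G = {..<n} \<and> P G} \<subseteq> h ` ({{..<n}} \<times> Pow (Pow {..<n}))"
  proof
    fix x assume "x \<in> {h G | G. simple_graph G \<and> verts G = {..<n} \<and> P G}"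
    then obtain G where G: "x = h G" "simple_graph G" "verts G = {..<n}" by blast
    then have "G \<in> {{..<n}} \<times> Pow (Pow {..<n})"
      by (cases G) (auto simp: simple_graph_def)
    then show "x \<in> h ` ({{..<n}} \<times> Pow (Pow {..<n}))" using G(1) by blast
  qed
qed simp

section \<open>Extremal numbers as attained maxima\<close>

lemma ex_power_attained:
  assumes F: "simple_graph F" "\<not> bipartite F"
  shows "\<exists>E. forbidden_graph.extremal (verts F) (adj F) r n E \<and>
           real (ex_power r n F) = (\<Sum>v<n. real (vdeg E n v) ^ r)"
proof -
  interpret forbidden_graph "verts F" "adj F" "chromatic_number F - 1"
    using forbidden_graph_of_simple_graph(1)[OF F] .
  define S where "S = {degree_power_sum r G | G :: nat graph.
            simple_graph G \<and> verts G = {..<n} \<and> \<not> contains_copy G F}"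
  have S_iff: "x \<in> S \<longleftrightarrow> (\<exists>E. free n E \<and> x = (\<Sum>v<n. vdeg E n v ^ r))" for x
  proof
    assume "x \<in> S"
    then obtain G where G: "x = degree_power_sum r G" "simple_graph G" "verts G = {..<n}"
        "\<not> contains_copy G F"
      by (auto simp: S_def)
    then show "\<exists>E. free n E \<and> x = (\<Sum>v<n. vdeg E n v ^ r)"
      using F(1) graph_rel_adj[OF G(2,3)] contains_copy_iff_embeds[OF G(2,3) F(1)]
      by (intro exI[of _ "adj G"]) (auto simp: free_def degree_power_sum_eq)
  next
    assume "\<exists>E. free n E \<and> x = (\<Sum>v<n. vdeg E n v ^ r)"
    then obtain E where E: "free n E" "x = (\<Sum>v<n. vdeg E n v ^ r)"
      by blast
    have g: "graph_rel n E" using E(1) by (simp add: free_def)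
    note sg = simple_graph_of[OF g] verts_graph_of[of n E]
    have adjE: "adj (graph_of n E) = E"
      using adj_graph_of[OF g] by (intro ext) auto
    have "degree_power_sum r (graph_of n E) = x"
      using degree_power_sum_eq[OF sg, of r] E(2) by (simp add: adjE)
    moreover have "\<not> contains_copy (graph_of n E) F"
      using contains_copy_iff_embeds[OF sg F(1)] E(1) by (simp add: adjE free_def)
    ultimately show "x \<in> S"
      unfolding S_def using sg by blast
  qed
  have fin: "finite S" unfolding S_def by (rule finite_graphs)
  \<comment> \<open>With a single class this is the edgeless graph, which makes the set of
    candidates nonempty.\<close>
  have "free n (multipartite n (\<lambda>_. 0))"
    using k_ge_2 by (intro free_multipartite) auto
  then have "S \<noteq> {}" using S_iff by blast
  then have "Max S \<in> S" using fin by simp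
  then obtain E where E: "free n E" "Max S = (\<Sum>v<n. vdeg E n v ^ r)"
    using S_iff by blast
  have "extremal r n E"
    unfolding extremal_def
  proof (intro conjI allI impI E(1))
    fix E' assume "free n E'"
    then have "(\<Sum>v<n. vdeg E' n v ^ r) \<in> S" using S_iff by blast
    then have "(\<Sum>v<n. vdeg E' n v ^ r) \<le> (\<Sum>v<n. vdeg E n v ^ r)"
      unfolding E(2)[symmetric] using fin by simp
    then show "(\<Sum>v<n. real (vdeg E' n v) ^ r) \<le> (\<Sum>v<n. real (vdeg E n v) ^ r)"
      by (simp flip: of_nat_power of_nat_sum)
  qed
  moreover have "real (ex_power r n F) = (\<Sum>v<n. real (vdeg E n v) ^ r)"
    unfolding ex_power_def S_def[symmetric] E(2) by simp
  ultimately show ?thesis by blast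
qed

lemma simple_induced_subgraph: "simple_graph F \<Longrightarrow> simple_graph (induced_subgraph F S)"
  by (auto simp: simple_graph_def induced_subgraph_def)

lemma decomp_free_iff:
  assumes F: "simple_graph F" "\<not> bipartite F" and G: "simple_graph G" "verts G = {..<n}"
  shows "forbidden_graph.decomp_free (verts F) (adj F) (chromatic_number F - 1) n (adj G) \<longleftrightarrow>
         (\<forall>H\<in>decomposition_family F. \<not> contains_copy G H)"
proof -
  interpret forbidden_graph "verts F" "adj F" "chromatic_number F - 1"
    using forbidden_graph_of_simple_graph(1)[OF F] .
  note Suc = forbidden_graph_of_simple_graph(2)[OF F]
  have copy: "contains_copy G (induced_subgraph F {v \<in> verts F. c v = i \<or> c v = j}) \<longleftrightarrow>
      embeds {v \<in> verts F. c v = i \<or> c v = j} (adj F) (adj G) n"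
    for c :: "'a \<Rightarrow> nat" and i j
  proof -
    define D where "D = {v \<in> verts F. c v = i \<or> c v = j}"
    have "verts (induced_subgraph F D) = D"
      by (auto simp: induced_subgraph_def D_def)
    moreover have "adj (induced_subgraph F D) x y \<longleftrightarrow> adj F x y" if "x \<in> D" "y \<in> D" for x y
      using that by (auto simp: induced_subgraph_def adj_def)
    then have "embeds D (adj (induced_subgraph F D)) (adj G) n \<longleftrightarrow> embeds D (adj F) (adj G) n"
      unfolding embeds_def by simp
    ultimately show ?thesis
      using contains_copy_iff_embeds[OF G simple_induced_subgraph[OF F(1)], of D]
      by (simp add: D_def)
  qed
  show ?thesis
  proof
    assume dfree: "decomp_free n (adj G)"
    show "\<forall>H\<in>decomposition_family F. \<not> contains_copy G H"
    proof
      fix H assume "H \<in> decomposition_family F"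
      then obtain c i j where H: "H = induced_subgraph F {v \<in> verts F. c v = i \<or> c v = j}"
          and c: "proper_colouring F (chromatic_number F) c"
          and ij: "i < chromatic_number F" "j < chromatic_number F" "i \<noteq> j"
        unfolding decomposition_family_def by (elim CollectE exE conjE) (rule that)
      have "\<not> embeds {v \<in> verts F. c v = i \<or> c v = j} (adj F) (adj G) n"
        using dfree c ij unfolding decomp_free_def Suc proper_colouring_iff[OF F(1)] by simp
      then show "\<not> contains_copy G H"
        unfolding H copy .
    qed
  next
    assume R: "\<forall>H\<in>decomposition_family F. \<not> contains_copy G H"
    show "decomp_free n (adj G)"
      unfolding decomp_free_def Suc
    proof (intro conjI allI impI graph_rel_adj[OF G])
      fix p i j
      assume "colouring (verts F) (adj F) (chromatic_number F) p"
        and ij: "i < chromatic_number F" "j < chromatic_number F" "i \<noteq> j"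
      then have "proper_colouring F (chromatic_number F) p"
        using proper_colouring_iff[OF F(1)] by simp
      then have "induced_subgraph F {v \<in> verts F. p v = i \<or> p v = j} \<in> decomposition_family F"
        unfolding decomposition_family_def using ij by (intro CollectI exI[of _ p] exI[of _ i] exI[of _ j] conjI refl)
      from bspec[OF R this] show "\<not> embeds {x \<in> verts F. p x = i \<or> p x = j} (adj F) (adj G) n"
        unfolding copy .
    qed
  qed
qed

lemma biex_attained:
  fixes n :: nat
  assumes F: "simple_graph F" "\<not> bipartite F"
  defines "dfree \<equiv> forbidden_graph.decomp_free (verts F) (adj F) (chromatic_number F - 1) n"
  shows "\<And>E. dfree E \<Longrightarrow> (\<Sum>v<n. vdeg E n v) \<le> 2 * biex n F"
    and "\<exists>E. dfree E \<and> (\<Sum>v<n. vdeg E n v) = 2 * biex n F"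
proof -
  interpret forbidden_graph "verts F" "adj F" "chromatic_number F - 1"
    using forbidden_graph_of_simple_graph(1)[OF F] .
  define S where "S = {card (edges G) | G :: nat graph.
            simple_graph G \<and> verts G = {..<n} \<and> (\<forall>H\<in>decomposition_family F. \<not> contains_copy G H)}"
  have S_iff: "x \<in> S \<longleftrightarrow> (\<exists>E. dfree E \<and> (\<Sum>v<n. vdeg E n v) = 2 * x)" for x
  proof
    assume "x \<in> S"
    then obtain G where G: "x = card (edges G)" "simple_graph G" "verts G = {..<n}"
        "\<forall>H\<in>decomposition_family F. \<not> contains_copy G H"
      by (auto simp: S_def)
    then show "\<exists>E. dfree E \<and> (\<Sum>v<n. vdeg E n v) = 2 * x"
      unfolding dfree_def using decomp_free_iff[OF F G(2,3)] handshake[OF G(2,3)] by blast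
  next
    assume "\<exists>E. dfree E \<and> (\<Sum>v<n. vdeg E n v) = 2 * x"
    then obtain E where E: "dfree E" "(\<Sum>v<n. vdeg E n v) = 2 * x"
      by blast
    have g: "graph_rel n E" using E(1) unfolding dfree_def decomp_free_def by blast
    note sg = simple_graph_of[OF g] verts_graph_of[of n E]
    have adjE: "adj (graph_of n E) = E"
      using adj_graph_of[OF g] by (intro ext) auto
    have "card (edges (graph_of n E)) = x"
      using handshake[OF sg] E(2) by (simp add: adjE)
    moreover have "\<forall>H\<in>decomposition_family F. \<not> contains_copy (graph_of n E) H"
      using decomp_free_iff[OF F sg] E(1) unfolding adjE dfree_def by blast
    ultimately show "x \<in> S"
      unfolding S_def using sg by blast
  qed
  have fin: "finite S" unfolding S_def by (rule finite_graphs)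
  have biex: "biex n F = Max S"
    by (simp add: biex_def ex_family_def S_def)
  show "(\<Sum>v<n. vdeg E n v) \<le> 2 * biex n F" if E: "dfree E" for E
  proof -
    have g: "graph_rel n E" using E unfolding dfree_def decomp_free_def by blast
    have "adj (graph_of n E) = E"
      using adj_graph_of[OF g] by (intro ext) auto
    then have *: "(\<Sum>v<n. vdeg E n v) = 2 * card (edges (graph_of n E))"
      using handshake[OF simple_graph_of[OF g] verts_graph_of] by simp
    then have "card (edges (graph_of n E)) \<in> S"
      using S_iff E by blast
    then show ?thesis
      unfolding * biex using fin by simp
  qed
  \<comment> \<open>A member embedding into an edgeless graph would have no edges, so its two colour
    classes could be merged, contradicting the chromatic number.\<close>
  have "dfree (\<lambda>_ _. False)"
    unfolding dfree_def decomp_free_def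
  proof (intro conjI allI impI notI)
    show "graph_rel n (\<lambda>_ _. False)" by (simp add: graph_rel_def)
    fix p i j
    assume p: "colouring (verts F) (adj F) (Suc (chromatic_number F - 1)) p"
      "i < Suc (chromatic_number F - 1)" "j < Suc (chromatic_number F - 1)" "i \<noteq> j"
      and emb: "embeds {x\<in>verts F. p x = i \<or> p x = j} (adj F) (\<lambda>_ _. False) n"
    have "\<exists>q. colouring (verts F) (adj F) (chromatic_number F - 1) q"
      by (rule merge_colour_classes[OF p]) (use emb in \<open>auto simp: embeds_def\<close>)
    then show False using not_k_colourable by blast
  qed
  then have "0 \<in> S" using S_iff[of 0] by (auto simp: vdeg_def)
  then have "Max S \<in> S" using fin by (intro Max_in) auto
  then show "\<exists>E. dfree E \<and> (\<Sum>v<n. vdeg E n v) = 2 * biex n F"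
    using S_iff biex by simp
qed

lemma complete_partite_graph_of:
  assumes "\<forall>v<n. c v < k" "k \<le> n \<longrightarrow> c ` {..<n} = {..<k}"
  shows "complete_partite k (graph_of n (multipartite n c))"
  unfolding complete_partite_def
  using assms by (intro exI[of _ c]) (auto simp: graph_of_def multipartite_def)

theorem theorem1p7:
  fixes F :: "'a graph" and r :: nat
  assumes "simple_graph F" and "\<not> bipartite F" and "r \<ge> 1"
  shows "\<exists>T :: nat \<Rightarrow> nat graph.
           (\<forall>n. simple_graph (T n) \<and> verts (T n) = {..<n} \<and>
                complete_partite (chromatic_number F - 1) (T n)) \<and>
           (\<lambda>n. real (ex_power r n F) - real (degree_power_sum r (T n)))
             \<in> \<Theta>(\<lambda>n. real (biex n F) * real n ^ (r - 1))"
proof -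
  note F = assms(1,2)
  define k where "k = chromatic_number F - 1"
  interpret forbidden_graph "verts F" "adj F" k
    unfolding k_def using forbidden_graph_of_simple_graph(1)[OF F] .
  obtain \<beta> C N where pos: "\<beta> > 0" "C > 0" and up: "\<forall>n\<ge>N. \<forall>E b. extremal r n E \<longrightarrow>
           (\<forall>E'. decomp_free n E' \<longrightarrow> (\<Sum>v<n. vdeg E' n v) \<le> 2 * b) \<longrightarrow>
           (\<exists>c. (\<forall>v<n. c v < k) \<and> (\<forall>i<k. \<beta> * real n \<le> real (card (part n c i))) \<and>
                (\<Sum>v<n. real (vdeg E n v) ^ r) \<le>
                  (\<Sum>v<n. real (cross n c v) ^ r) + C * real b * real n ^ (r - 1))"
    using upper_bound[OF assms(3)] by (elim exE conjE) (rule that)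
  obtain \<delta> N' where \<delta>: "\<delta> > 0" and low: "\<forall>n\<ge>N'. \<forall>c E0. (\<forall>v<n. c v < k) \<longrightarrow>
           (\<forall>i<k. \<beta> * real n \<le> real (card (part n c i))) \<longrightarrow> decomp_free n E0 \<longrightarrow>
           (\<exists>E. free n E \<and>
              (\<Sum>v<n. real (cross n c v) ^ r) + \<delta> * real (\<Sum>v<n. vdeg E0 n v) * real n ^ (r - 1)
                \<le> (\<Sum>v<n. real (vdeg E n v) ^ r))"
    using lower_bound[OF assms(3) pos(1)] by (elim exE conjE) (rule that)
  note biex = biex_attained[OF F, folded k_def]
  define M where "M = max N N'"
  \<comment> \<open>Collects what is needed of the colouring for each single \<open>n\<close>, so
    that one choice produces the whole sequence. Below \<open>M\<close> only a complete partite
    graph is asked for. The factor 2 in the lower estimate is the degree sum per edge.\<close>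
  define good where "good n c \<longleftrightarrow> (\<forall>v<n. c v < k) \<and> (k \<le> n \<longrightarrow> c ` {..<n} = {..<k}) \<and>
      (M \<le> n \<longrightarrow>
        (\<Sum>v<n. real (cross n c v) ^ r) + 2 * \<delta> * (real (biex n F) * real n ^ (r - 1)) \<le> real (ex_power r n F) \<and>
        real (ex_power r n F) \<le> (\<Sum>v<n. real (cross n c v) ^ r) + C * (real (biex n F) * real n ^ (r - 1)))"
    for n c
  have "\<exists>c. good n c" for n
  proof (cases "M \<le> n")
    case True
    obtain E where E: "extremal r n E" "real (ex_power r n F) = (\<Sum>v<n. real (vdeg E n v) ^ r)"
      using ex_power_attained[OF F] by blast
    have N: "N \<le> n" "N' \<le> n" using True by (simp_all add: M_def)
    have "\<forall>E'. decomp_free n E' \<longrightarrow> (\<Sum>v<n. vdeg E' n v) \<le> 2 * biex n F"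
      by (intro allI impI) (rule biex(1))
    from mp[OF mp[OF spec[OF spec[OF mp[OF spec[OF up] N(1)]]] E(1)] this]
    obtain c where c: "\<forall>v<n. c v < k" "\<forall>i<k. \<beta> * real n \<le> real (card (part n c i))"
        "(\<Sum>v<n. real (vdeg E n v) ^ r) \<le>
           (\<Sum>v<n. real (cross n c v) ^ r) + C * real (biex n F) * real n ^ (r - 1)"
      by (elim exE conjE) (rule that)
    obtain E0 where E0: "decomp_free n E0" "(\<Sum>v<n. vdeg E0 n v) = 2 * biex n F"
      using biex(2) by blast
    from mp[OF mp[OF mp[OF spec[OF spec[OF mp[OF spec[OF low] N(2)]]] c(1)] c(2)] E0(1)]
    obtain E' where E': "free n E'"
        "(\<Sum>v<n. real (cross n c v) ^ r) + \<delta> * real (\<Sum>v<n. vdeg E0 n v) * real n ^ (r - 1)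
           \<le> (\<Sum>v<n. real (vdeg E' n v) ^ r)"
      by (elim exE conjE) (rule that)
    have "(\<Sum>v<n. real (vdeg E' n v) ^ r) \<le> real (ex_power r n F)"
      using E E'(1) by (simp add: extremal_def)
    then have "(\<Sum>v<n. real (cross n c v) ^ r) + 2 * \<delta> * (real (biex n F) * real n ^ (r - 1)) \<le> real (ex_power r n F)"
      using E'(2) unfolding E0(2) by (simp add: mult_ac)
    \<comment> \<open>Linear size makes every part nonempty, as \<open>complete_partite\<close>
      requires.\<close>
    moreover have "c ` {..<n} = {..<k}" if "k \<le> n"
    proof
      show "{..<k} \<subseteq> c ` {..<n}"
      proof
        fix i assume "i \<in> {..<k}"
        then have "\<beta> * real n \<le> real (card (part n c i))" "n > 0"
          using c(2) that by auto
        then have "card (part n c i) > 0"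
          using pos(1) by (smt (verit) mult_pos_pos of_nat_0_less_iff)
        then show "i \<in> c ` {..<n}"
          by (auto simp: card_gt_0_iff part_def)
      qed
    qed (use c(1) in auto)
    ultimately show ?thesis
      using c(1,3) E(2) by (intro exI[of _ c]) (simp add: good_def mult_ac)
  next
    case False
    have "(\<lambda>v. v mod k) ` {..<n} = {..<k}" if "k \<le> n"
    proof
      show "{..<k} \<subseteq> (\<lambda>v. v mod k) ` {..<n}"
      proof
        fix i assume "i \<in> {..<k}"
        with that show "i \<in> (\<lambda>v. v mod k) ` {..<n}"
          by (intro image_eqI[of _ _ i]) auto
      qed
    qed (use k_ge_2 in auto)
    then show ?thesis
      using False k_ge_2 by (intro exI[of _ "\<lambda>v. v mod k"]) (auto simp: good_def)
  qed
  then obtain c where c: "\<And>n. good n (c n)"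
    by metis
  define T where "T n = graph_of n (multipartite n (c n))" for n
  have T: "simple_graph (T n)" "verts (T n) = {..<n}" "complete_partite k (T n)" for n
    using c[of n] unfolding T_def good_def
    by (auto intro: simple_graph_of graph_rel_multipartite complete_partite_graph_of)
  have dps: "real (degree_power_sum r (T n)) = (\<Sum>v<n. real (cross n (c n) v) ^ r)" for n
  proof -
    have "adj (T n) = multipartite n (c n)"
      unfolding T_def using adj_graph_of[OF graph_rel_multipartite] by (intro ext) auto
    then show ?thesis
      using degree_power_sum_eq[OF T(1,2)] by (simp add: vdeg_multipartite)
  qed
  have sandwich: "2 * \<delta> * (real (biex n F) * real n ^ (r - 1)) \<le> real (ex_power r n F) - real (degree_power_sum r (T n))"
    "real (ex_power r n F) - real (degree_power_sum r (T n)) \<le> C * (real (biex n F) * real n ^ (r - 1))"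
    if "n \<ge> M" for n
    using c[of n] that unfolding good_def dps by auto
  have "(\<lambda>n. real (ex_power r n F) - real (degree_power_sum r (T n)))
             \<in> \<Theta>(\<lambda>n. real (biex n F) * real n ^ (r - 1))"
  proof (rule bigthetaI)
    have nonneg: "0 \<le> 2 * \<delta> * (real (biex n F) * real n ^ (r - 1))" for n
      using \<delta> by simp
    have norm: "norm (real (ex_power r n F) - real (degree_power_sum r (T n))) =
        real (ex_power r n F) - real (degree_power_sum r (T n))" if "n \<ge> M" for n
      using sandwich(1)[OF that] nonneg[of n] by simp
    have norm': "norm (real (biex n F) * real n ^ (r - 1)) = real (biex n F) * real n ^ (r - 1)" for n
      by simp
    show "(\<lambda>n. real (ex_power r n F) - real (degree_power_sum r (T n)))
             \<in> O(\<lambda>n. real (biex n F) * real n ^ (r - 1))"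
      by (rule bigoI[of _ C], rule eventually_sequentiallyI[of M]) (simp only: norm norm' sandwich)
    show "(\<lambda>n. real (ex_power r n F) - real (degree_power_sum r (T n)))
             \<in> \<Omega>(\<lambda>n. real (biex n F) * real n ^ (r - 1))"
    proof (rule landau_omega.bigI[of "2 * \<delta>"])
      show "2 * \<delta> > 0" using \<delta> by simp
      show "\<forall>\<^sub>F n in sequentially. 2 * \<delta> * norm (real (biex n F) * real n ^ (r - 1)) \<le>
          norm (real (ex_power r n F) - real (degree_power_sum r (T n)))"
        by (rule eventually_sequentiallyI[of M]) (simp only: norm norm' sandwich)
    qed
  qed
  then show ?thesis
    using T unfolding k_def by blast
qed

end
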